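(* Let $\lambda$ be a countable limit ordinal, let $(\{L_i\}_{i\in\omega},K)$ be a $\lambda$-mixable pair, and let $f\colon\mathbb{Z}\to\mathbb{N}\cup\{\infty\}$ be almost periodic. Suppose that either $f$ takes only finite values, or the pair has a unique limit structure $L_\infty$. Let $L_\lambda=\sum_{n\in\mathbb{Z}}(1+L_{f(n)}+1+K)$ be the $\mathbb{Z}$-sum (with $L_{f(n)}=L_\infty$ when $f(n)=\infty$). Then $L_\lambda$ has Scott complexity $\Sigma_{\lambda+1}$.
   Context: All structures are countable; $\equiv_\alpha$ is the standard back-and-forth equivalence at level $\alpha$. Scott complexity of $\mathcal{A}$: least complexity among $\Sigma_\alpha$, d-$\Sigma_\alpha$, $\Pi_\alpha$ of an $\mathcal{L}_{\omega_1\omega}$ Scott sentence (a sentence true in a countable structure iff it is isomorphic to $\mathcal{A}$). Scott rank $SR(\mathcal{A})$: e.g. the parameterless Scott rank $uSR(\mathcal{A})$ is the least $\alpha$ such that $\mathcal{A}$ has a $\Pi_{\alpha+1}$ Scott sentence, and the parametrized Scott rank $pSR(\mathcal{A})$ is the least $\alpha$ such that $\mathcal{A}$ has a $\Sigma_{\alpha+2}$ Scott sentence; for a limit $\lambda$, "$SR(\mathcal{A})<\lambda$" does not depend on which is used. A function $f\colon\mathbb{Z}\to\mathbb{N}\cup\{\infty\}$ is almost periodic if it is not periodic but for every $n\in\mathbb{N}$ the function $\min(n,f)$ is periodic. A pair $(\{L_i\}_{i\in\omega},K)$ of a sequence of linear orders and a linear order $K$ is $\lambda$-mixable if for some fundamental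 sequence of non-zero ordinals $\delta_i\to\lambda$: (1) $SR(K)<\lambda$; (2) $SR(L_i)<\lambda$ for all $i$; (3) $L_i\equiv_{\delta_i}L_{i+1}$; (4) $L_i\not\equiv_{\delta_{i+1}}L_{i+1}$; (5) every finite alternating sum $1+L_{a_0}+1+K+1+L_{a_1}+1+K+\cdots+1+L_{a_n}$ has intervals isomorphic to $K$ only within the written $K$ blocks (or as the entire written $K$ block). Here $1$ denotes a one-point order and intervals are open intervals $(a,b)=\{x: a<x<b\}$. A limit structure for the pair is a countable linear order $\mathcal{N}$ such that for every $n$ there is $i$ with $\mathcal{N}\equiv_{\delta_n}L_i$; the pair has a unique limit structure $L_\infty$ if all its limit structures are isomorphic to $L_\infty$. *)

theory Defs
  imports Main "HOL-Library.Countable_Set_Type" "HOL-Library.Extended_Nat"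
begin

section \<open>Countable ordinals\<close>

text \<open>The countable ordinals are the elements of the well-order \<open>\<omega>\<^sub>1\<close>, the cardinal successor of
  \<open>\<omega>\<close>.\<close>

typedef omega1 = "Field (cardSuc natLeq)"
proof -
  have "infinite (Field (cardSuc natLeq))"
    using cardSuc_finite[OF natLeq_Card_order] by (simp add: Field_natLeq)
  then show ?thesis
    by (metis ex_in_conv finite.emptyI)
qed

lemma Card_order_omega1: "Card_order (cardSuc natLeq)"
  by (rule cardSuc_Card_order[OF natLeq_Card_order])

lemma Well_order_omega1: "Well_order (cardSuc natLeq)"
  using Card_order_omega1 by (rule card_order_on_well_order_on)

instantiation omega1 :: wellorder
begin

definition less_eq_omega1 :: "omega1 \<Rightarrow> omega1 \<Rightarrow> bool" where
  "a \<le> b \<longleftrightarrow> (Rep_omega1 a, Rep_omega1 b) \<in> cardSuc natLeq"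

definition less_omega1 :: "omega1 \<Rightarrow> omega1 \<Rightarrow> bool" where
  "a < b \<longleftrightarrow> a \<le> b \<and> a \<noteq> (b :: omega1)"

instance
proof -
  let ?r = "cardSuc natLeq"
  have lin: "linear_order_on (Field ?r) ?r" and wf: "wf (?r - Id)"
    using Well_order_omega1 unfolding well_order_on_def by auto
  have refl: "refl_on (Field ?r) ?r" and trans: "trans ?r" and antisym: "antisym ?r"
    and total: "total_on (Field ?r) ?r"
    using lin unfolding linear_order_on_def partial_order_on_def preorder_on_def by auto
  have a1: "a \<le> a" for a :: omega1
    using refl Rep_omega1[of a] by (simp add: less_eq_omega1_def refl_on_def)
  have a2: "a = b" if "a \<le> b" "b \<le> a" for a b :: omega1
    using that antisym by (metis less_eq_omega1_def antisymD Rep_omega1_inject)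
  have a3: "a \<le> c" if "a \<le> b" "b \<le> c" for a b c :: omega1
    using that trans by (metis less_eq_omega1_def transD)
  have a4: "a \<le> b \<or> b \<le> a" for a b :: omega1
    using total a1[of a] Rep_omega1[of a] Rep_omega1[of b]
    by (metis less_eq_omega1_def total_on_def)
  have wf': "wf {(a, b :: omega1). a < b}"
    by (rule wf_subset[OF wf_inv_image[OF wf, of Rep_omega1]])
       (auto simp: inv_image_def less_omega1_def less_eq_omega1_def Rep_omega1_inject)
  show "OFCLASS(omega1, wellorder_class)"
  proof
    fix P :: "omega1 \<Rightarrow> bool" and a
    assume "\<And>x. (\<And>y. y < x \<Longrightarrow> P y) \<Longrightarrow> P x"
    then show "P a" using wf_induct_rule[OF wf', of P a] by blast
  qed (use a1 a2 a3 a4 in \<open>auto simp: less_omega1_def\<close>)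
qed

end

instantiation omega1 :: zero
begin

definition zero_omega1 :: omega1 where
  "0 = (LEAST a :: omega1. True)"

instance ..

end

lemma zero_le_omega1 [simp]: "0 \<le> (a :: omega1)"
  unfolding zero_omega1_def by (rule Least_le) simp

lemma countable_lessThan_omega1:
  includes cardinal_syntax
  shows "countable {..< a :: omega1}"
proof -
  let ?r = "cardSuc natLeq"
  have "|underS ?r (Rep_omega1 a)| <o ?r"
    by (rule card_of_underS[OF Card_order_omega1 Rep_omega1])
  then have "|underS ?r (Rep_omega1 a)| \<le>o natLeq"
    using cardSuc_ordLeq_ordLess[OF natLeq_Card_order card_of_Card_order] by blast
  then have "countable (underS ?r (Rep_omega1 a))"
    by (metis countable_card_le_natLeq)
  moreover have "Rep_omega1 ` {..<a} \<subseteq> underS ?r (Rep_omega1 a)"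
    by (auto simp: underS_def less_omega1_def less_eq_omega1_def Rep_omega1_inject)
  ultimately show ?thesis
    by (metis countable_subset countable_image_inj_on inj_on_def Rep_omega1_inject)
qed

lemma uncountable_omega1:
  includes cardinal_syntax
  shows "\<not> countable (UNIV :: omega1 set)"
proof
  let ?r = "cardSuc natLeq"
  assume "countable (UNIV :: omega1 set)"
  then have "countable (range Rep_omega1)" by simp
  then have "countable (Field ?r)"
    using type_definition.Rep_range[OF type_definition_omega1] by simp
  then have "|Field ?r| \<le>o natLeq"
    by (simp add: countable_card_le_natLeq)
  then have "?r \<le>o natLeq"
    using card_of_Field_ordIso[OF Card_order_omega1] ordIso_ordLeq_trans ordIso_symmetric by blast
  then show False
    using cardSuc_greater[OF natLeq_Card_order] not_ordLess_ordLeq by blast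
qed

lemma countable_bounded_omega1:
  assumes "countable (A :: omega1 set)"
  shows "\<exists>b. \<forall>a\<in>A. a < b"
proof (rule ccontr)
  assume "\<not> ?thesis"
  then have "UNIV \<subseteq> (\<Union>a\<in>A. insert a {..<a})"
    by (auto simp: not_less) (metis le_less)
  moreover have "countable (\<Union>a\<in>A. insert a {..<a})"
    using assms by (auto intro: countable_lessThan_omega1)
  ultimately show False
    using uncountable_omega1 countable_subset by blast
qed

definition osuc :: "omega1 \<Rightarrow> omega1" where
  "osuc a = (LEAST b. a < b)"

lemma less_osuc: "a < osuc a"
proof -
  have "\<exists>b. a < b" using countable_bounded_omega1[of "{a}"] by simp
  then show ?thesis unfolding osuc_def by (rule LeastI_ex)
qed

lemma less_osuc_iff: "b < osuc a \<longleftrightarrow> b \<le> a"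
  by (metis less_osuc osuc_def not_less_Least not_less le_less_trans)

definition limit_ordinal :: "omega1 \<Rightarrow> bool" where
  "limit_ordinal l \<longleftrightarrow> 0 < l \<and> (\<forall>a<l. osuc a < l)"

definition fundamental_sequence :: "omega1 \<Rightarrow> (nat \<Rightarrow> omega1) \<Rightarrow> bool" where
  "fundamental_sequence l \<delta> \<longleftrightarrow> strict_mono \<delta> \<and> (\<forall>i. \<delta> i < l) \<and> (\<forall>a<l. \<exists>i. a < \<delta> i)"


section \<open>Structures with one binary relation\<close>

text \<open>Only the restriction of \<open>lt M\<close> to \<open>pts M\<close> is relevant. Up to isomorphism, the countable
  structures are exactly those of type \<open>nat rstruct\<close>, as the set of points need not be all
  of \<open>nat\<close>.\<close>

datatype 'a rstruct = RStruct (pts: "'a set") (lt: "'a rel")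

definition isomorphic :: "'a rstruct \<Rightarrow> 'b rstruct \<Rightarrow> bool" (infix "\<cong>\<^sub>s" 50) where
  "M \<cong>\<^sub>s N \<longleftrightarrow> (\<exists>h. bij_betw h (pts M) (pts N) \<and>
     (\<forall>x\<in>pts M. \<forall>y\<in>pts M. (x, y) \<in> lt M \<longleftrightarrow> (h x, h y) \<in> lt N))"

definition linear_order :: "'a rstruct \<Rightarrow> bool" where
  "linear_order M \<longleftrightarrow> lt M \<subseteq> pts M \<times> pts M \<and> strict_linear_order_on (pts M) (lt M)"

definition interval :: "'a rstruct \<Rightarrow> 'a \<Rightarrow> 'a \<Rightarrow> 'a rstruct" where
  "interval M a b =
     (let I = {x \<in> pts M. (a, x) \<in> lt M \<and> (x, b) \<in> lt M} in RStruct I (lt M \<inter> I \<times> I))"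

definition single :: "nat rstruct" where
  "single = RStruct {0} {}"

definition ord_sum :: "'i::linorder set \<Rightarrow> ('i \<Rightarrow> 'a rstruct) \<Rightarrow> ('i \<times> 'a) rstruct" where
  "ord_sum I M = RStruct (SIGMA i:I. pts (M i))
     {((i, a), (j, b)) | i a j b. i \<in> I \<and> j \<in> I \<and> a \<in> pts (M i) \<and> b \<in> pts (M j) \<and>
        (i < j \<or> i = j \<and> (a, b) \<in> lt (M i))}"

definition list_sum :: "'a rstruct list \<Rightarrow> (nat \<times> 'a) rstruct" where
  "list_sum Ms = ord_sum {..<length Ms} (\<lambda>i. Ms ! i)"


section \<open>Infinitary formulas and Scott sentences\<close>

text \<open>Formulas of \<open>\<L>\<^bsub>\<omega>\<^sub>1\<omega>\<^esub>\<close> over one binary relation symbol. Variables are natural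
  numbers.\<close>

datatype fm =
    Top
  | Less nat nat
  | Eq nat nat
  | Neg fm
  | And fm fm
  | Conj "nat \<Rightarrow> fm"
  | Disj "nat \<Rightarrow> fm"
  | Ex nat fm
  | All nat fm

primrec sat :: "'a rstruct \<Rightarrow> fm \<Rightarrow> (nat \<Rightarrow> 'a) \<Rightarrow> bool" where
  "sat M Top = (\<lambda>e. True)"
| "sat M (Less x y) = (\<lambda>e. (e x, e y) \<in> lt M)"
| "sat M (Eq x y) = (\<lambda>e. e x = e y)"
| "sat M (Neg p) = (\<lambda>e. \<not> sat M p e)"
| "sat M (And p q) = (\<lambda>e. sat M p e \<and> sat M q e)"
| "sat M (Conj P) = (\<lambda>e. \<forall>i. sat M (P i) e)"
| "sat M (Disj P) = (\<lambda>e. \<exists>i. sat M (P i) e)"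
| "sat M (Ex x p) = (\<lambda>e. \<exists>a\<in>pts M. sat M p (e(x := a)))"
| "sat M (All x p) = (\<lambda>e. \<forall>a\<in>pts M. sat M p (e(x := a)))"

primrec fv :: "fm \<Rightarrow> nat set" where
  "fv Top = {}"
| "fv (Less x y) = {x, y}"
| "fv (Eq x y) = {x, y}"
| "fv (Neg p) = fv p"
| "fv (And p q) = fv p \<union> fv q"
| "fv (Conj P) = (\<Union>i. fv (P i))"
| "fv (Disj P) = (\<Union>i. fv (P i))"
| "fv (Ex x p) = fv p - {x}"
| "fv (All x p) = fv p - {x}"

text \<open>Only used for sentences, whose truth does not depend on the assignment; quantifying over
  all assignments also covers the empty structure.\<close>

definition models :: "'a rstruct \<Rightarrow> fm \<Rightarrow> bool" where
  "models M p \<longleftrightarrow> (\<forall>e. sat M p e)"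

primrec qfree :: "fm \<Rightarrow> bool" where
  "qfree Top = True"
| "qfree (Less x y) = True"
| "qfree (Eq x y) = True"
| "qfree (Neg p) = qfree p"
| "qfree (And p q) = (qfree p \<and> qfree q)"
| "qfree (Conj P) = False"
| "qfree (Disj P) = False"
| "qfree (Ex x p) = False"
| "qfree (All x p) = False"

text \<open>\<open>\<Sigma>\<^sub>0 = \<Pi>\<^sub>0\<close>: finitary quantifier-free formulas; \<open>\<Sigma>\<^sub>\<alpha>\<close>: countable disjunctions of formulas
  \<open>\<exists>x\<^sub>1\<dots>x\<^sub>k. p\<close> with \<open>p\<close> in \<open>\<Pi>\<^sub>\<beta>\<close> for some \<open>\<beta> < \<alpha>\<close>; dually for \<open>\<Pi>\<^sub>\<alpha>\<close>.\<close>

inductive sigma_fm :: "omega1 \<Rightarrow> fm \<Rightarrow> bool" and pi_fm :: "omega1 \<Rightarrow> fm \<Rightarrow> bool" where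
  sigma_zero: "qfree p \<Longrightarrow> sigma_fm 0 p"
| pi_zero: "qfree p \<Longrightarrow> pi_fm 0 p"
| sigma_step: "0 < a \<Longrightarrow> (\<And>i. b i < a) \<Longrightarrow> (\<And>i. pi_fm (b i) (P i)) \<Longrightarrow>
    sigma_fm a (Disj (\<lambda>i. foldr Ex (xs i) (P i)))"
| pi_step: "0 < a \<Longrightarrow> (\<And>i. b i < a) \<Longrightarrow> (\<And>i. sigma_fm (b i) (P i)) \<Longrightarrow>
    pi_fm a (Conj (\<lambda>i. foldr All (xs i) (P i)))"

datatype complexity = CSigma omega1 | CdSigma omega1 | CPi omega1

primrec in_class :: "complexity \<Rightarrow> fm \<Rightarrow> bool" where
  "in_class (CSigma a) p = sigma_fm a p"
| "in_class (CdSigma a) p = (\<exists>q r. p = And q r \<and> sigma_fm a q \<and> pi_fm a r)"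
| "in_class (CPi a) p = pi_fm a p"

fun complexity_le :: "complexity \<Rightarrow> complexity \<Rightarrow> bool" where
  "complexity_le (CSigma a) (CSigma b) = (a \<le> b)"
| "complexity_le (CSigma a) (CdSigma b) = (a \<le> b)"
| "complexity_le (CSigma a) (CPi b) = (a < b)"
| "complexity_le (CdSigma a) (CSigma b) = (a < b)"
| "complexity_le (CdSigma a) (CdSigma b) = (a \<le> b)"
| "complexity_le (CdSigma a) (CPi b) = (a < b)"
| "complexity_le (CPi a) (CSigma b) = (a < b)"
| "complexity_le (CPi a) (CdSigma b) = (a \<le> b)"
| "complexity_le (CPi a) (CPi b) = (a \<le> b)"

definition scott_sentence :: "'a rstruct \<Rightarrow> fm \<Rightarrow> bool" where
  "scott_sentence M p \<longleftrightarrow> fv p = {} \<and> (\<forall>N :: nat rstruct. models N p \<longleftrightarrow> N \<cong>\<^sub>s M)"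

definition has_scott_sentence :: "'a rstruct \<Rightarrow> complexity \<Rightarrow> bool" where
  "has_scott_sentence M C \<longleftrightarrow> (\<exists>p. in_class C p \<and> scott_sentence M p)"

text \<open>Since \<open>\<Sigma>\<^sub>\<alpha>\<close> and \<open>\<Pi>\<^sub>\<alpha>\<close> are incomparable, complexity \<open>\<Sigma>\<^sub>\<alpha>\<close> excludes a \<open>\<Pi>\<^sub>\<alpha>\<close> Scott sentence.\<close>

definition scott_complexity :: "'a rstruct \<Rightarrow> complexity \<Rightarrow> bool" where
  "scott_complexity M C \<longleftrightarrow> has_scott_sentence M C \<and>
     (\<forall>D. has_scott_sentence M D \<longrightarrow> complexity_le C D)"

definition is_uSR :: "'a rstruct \<Rightarrow> omega1 \<Rightarrow> bool" where
  "is_uSR M a \<longleftrightarrow> has_scott_sentence M (CPi (osuc a)) \<and>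
     (\<forall>b<a. \<not> has_scott_sentence M (CPi (osuc b)))"

definition SR_less :: "'a rstruct \<Rightarrow> omega1 \<Rightarrow> bool" where
  "SR_less M l \<longleftrightarrow> (\<exists>a<l. is_uSR M a)"


section \<open>Back-and-forth relations\<close>

definition atomic_equiv :: "'a rstruct \<Rightarrow> 'a list \<Rightarrow> 'a rstruct \<Rightarrow> 'a list \<Rightarrow> bool" where
  "atomic_equiv M as N bs \<longleftrightarrow> length as = length bs \<and>
     (\<forall>i<length as. \<forall>j<length as. (as ! i = as ! j \<longleftrightarrow> bs ! i = bs ! j) \<and>
        ((as ! i, as ! j) \<in> lt M \<longleftrightarrow> (bs ! i, bs ! j) \<in> lt N))"

function bf_le :: "omega1 \<Rightarrow> 'a rstruct \<Rightarrow> 'a list \<Rightarrow> 'a rstruct \<Rightarrow> 'a list \<Rightarrow> bool" where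
  "bf_le a M as N bs \<longleftrightarrow>
     (if a = 0 then atomic_equiv M as N bs
      else \<forall>b. b < a \<longrightarrow> (\<forall>ds\<in>lists (pts N). \<exists>cs\<in>lists (pts M).
             length cs = length ds \<and> bf_le b N (bs @ ds) M (as @ cs)))"
  by pat_completeness auto
termination
  by (relation "inv_image {(x, y). x < y} fst") (auto intro: wf)

declare bf_le.simps [simp del]

definition bf_equiv :: "omega1 \<Rightarrow> 'a rstruct \<Rightarrow> 'a rstruct \<Rightarrow> bool" where
  "bf_equiv a M N \<longleftrightarrow> bf_le a M [] N [] \<and> bf_le a N [] M []"


section \<open>Mixable pairs\<close>

text \<open>The sum \<open>1 + L\<^bsub>a\<^sub>0\<^esub> + 1 + K + 1 + L\<^bsub>a\<^sub>1\<^esub> + 1 + K + \<dots> + 1 + L\<^bsub>a\<^sub>n\<^esub>\<close>, where \<open>as\<close> lists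
  \<open>a\<^sub>0, \<dots>, a\<^bsub>n-1\<^esub>\<close> and \<open>c = a\<^sub>n\<close>. The \<open>j\<close>-th written copy of \<open>K\<close> is the summand with
  index \<open>4 * j + 3\<close>.\<close>

definition alternating_sum ::
  "(nat \<Rightarrow> nat rstruct) \<Rightarrow> nat rstruct \<Rightarrow> nat list \<Rightarrow> nat \<Rightarrow> (nat \<times> nat) rstruct" where
  "alternating_sum L K as c =
     list_sum (concat (map (\<lambda>a. [single, L a, single, K]) as) @ [single, L c])"

definition K_only_in_K_blocks :: "(nat \<Rightarrow> nat rstruct) \<Rightarrow> nat rstruct \<Rightarrow> bool" where
  "K_only_in_K_blocks L K \<longleftrightarrow> (\<forall>as c x y. let S = alternating_sum L K as c in
     x \<in> pts S \<and> y \<in> pts S \<and> (x, y) \<in> lt S \<and> interval S x y \<cong>\<^sub>s K \<longrightarrow>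
     (\<exists>j<length as. pts (interval S x y) \<subseteq> {4 * j + 3} \<times> pts K))"

definition mixable_along ::
  "omega1 \<Rightarrow> (nat \<Rightarrow> omega1) \<Rightarrow> (nat \<Rightarrow> nat rstruct) \<Rightarrow> nat rstruct \<Rightarrow> bool" where
  "mixable_along l \<delta> L K \<longleftrightarrow>
     fundamental_sequence l \<delta> \<and> (\<forall>i. \<delta> i \<noteq> 0) \<and>
     linear_order K \<and> (\<forall>i. linear_order (L i)) \<and>
     SR_less K l \<and> (\<forall>i. SR_less (L i) l) \<and>
     (\<forall>i. bf_equiv (\<delta> i) (L i) (L (Suc i))) \<and>
     (\<forall>i. \<not> bf_equiv (\<delta> (Suc i)) (L i) (L (Suc i))) \<and>
     K_only_in_K_blocks L K"

text \<open>The witness \<open>i\<close> has to satisfy \<open>i \<ge> n\<close>: otherwise every \<open>L i\<close> would itself be a limit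
  structure, and no mixable pair could have a unique one. As \<open>L i \<equiv>\<^bsub>\<delta>\<^sub>n\<^esub> L n\<close> for \<open>i \<ge> n\<close>, the
  condition says that \<open>N\<close> agrees with the tail of the sequence at each level \<open>\<delta> n\<close>.\<close>

definition limit_structure ::
  "(nat \<Rightarrow> omega1) \<Rightarrow> (nat \<Rightarrow> nat rstruct) \<Rightarrow> nat rstruct \<Rightarrow> bool" where
  "limit_structure \<delta> L N \<longleftrightarrow> linear_order N \<and> (\<forall>n. \<exists>i\<ge>n. bf_equiv (\<delta> n) N (L i))"

definition unique_limit_structure ::
  "(nat \<Rightarrow> omega1) \<Rightarrow> (nat \<Rightarrow> nat rstruct) \<Rightarrow> nat rstruct \<Rightarrow> bool" where
  "unique_limit_structure \<delta> L Linf \<longleftrightarrow>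
     limit_structure \<delta> L Linf \<and> (\<forall>N. limit_structure \<delta> L N \<longrightarrow> N \<cong>\<^sub>s Linf)"

definition periodic :: "(int \<Rightarrow> 'a) \<Rightarrow> bool" where
  "periodic g \<longleftrightarrow> (\<exists>p>0. \<forall>k. g (k + p) = g k)"

definition almost_periodic :: "(int \<Rightarrow> enat) \<Rightarrow> bool" where
  "almost_periodic f \<longleftrightarrow> \<not> periodic f \<and> (\<forall>n. periodic (\<lambda>k. min (enat n) (f k)))"

definition mixed_sum ::
  "(nat \<Rightarrow> nat rstruct) \<Rightarrow> nat rstruct \<Rightarrow> nat rstruct \<Rightarrow> (int \<Rightarrow> enat) \<Rightarrow> (int \<times> nat \<times> nat) rstruct"
  where
  "mixed_sum L K Linf f = ord_sum UNIV
     (\<lambda>n. list_sum [single, (case f n of enat k \<Rightarrow> L k | \<infinity> \<Rightarrow> Linf), single, K])"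

end

theory Submission
  imports Defs
begin

text \<open>Write \<open>M\<^sub>f\<close> for the mixed sum. Condition (5) makes the written copies of \<open>K\<close> exactly the maximal
  intervals isomorphic to \<open>K\<close>, so over the left end \<open>a\<close> of one block every summand of \<open>M\<^sub>f\<close> is definable
  at one fixed level below \<open>\<lambda>\<close>. If \<open>(M\<^sub>f, a) \<le>\<^sub>\<lambda> (N, b)\<close>, then \<open>N\<close> splits in the same way, into summands
  equivalent to those of \<open>M\<^sub>f\<close> at all levels below \<open>\<lambda>\<close>. They are isomorphic: the \<open>L\<^sub>i\<close> and \<open>K\<close> have Scott
  rank below \<open>\<lambda>\<close>, and \<open>L\<^sub>\<infinity>\<close> is the only limit structure. As \<open>(M\<^sub>f, a) \<le>\<^sub>\<lambda> (N, b)\<close> is a \<open>\<Pi>\<^sub>\<lambda>\<close> condition on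
  \<open>b\<close>, this gives a \<open>\<Sigma>\<^bsub>\<lambda>+1\<^esub>\<close> Scott sentence.

  No single \<open>N\<close> refutes all \<open>\<Pi>\<^bsub>\<lambda>+1\<^esub>\<close> Scott sentences, so the lower bound is a category argument. Given
  a sentence of a smaller class that holds in \<open>M\<^sub>f\<close>, hence in all shifts of \<open>M\<^sub>f\<close>, a generic limit \<open>g\<close>
  of shifts of \<open>f\<close> is built in stages. Each stage preserves the truth of one \<open>\<Sigma>\<^sub>\<lambda>\<close> instance of the
  sentence by fixing \<open>f\<close> up to a finite precision, and makes \<open>g\<close> differ from one shift of \<open>f\<close>, which
  is possible because \<open>f\<close> is almost periodic. The sentence then holds in \<open>M\<^sub>g\<close>, but \<open>M\<^sub>g\<close> is not
  isomorphic to \<open>M\<^sub>f\<close>.\<close>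


section \<open>Ordinals\<close>

text \<open>A true \<Sigma>-formula of level at most \<open>l\<close> stays true along a
  back-and-forth relation of some level below \<open>l\<close>, and truncating \<open>f\<close> at
  \<open>m\<close> determines every block up to level \<open>\<delta> m\<close>. Away from the
  blocks that contain its parameters, such a formula therefore depends on \<open>f\<close> only up
  to a finite precision, uniform over all positions; this continuity lets a limit of shifts inherit
  it. The obstacle is the blocks that do contain parameters: there agreement up to a precision is
  not enough, because the parameters live in one particular structure. Their indices have to be
  frozen, and no precision freezes an index that may still grow without bound; hence the separate
  notion of a decided position. The levels \<open>up n\<close> count from a level at which being
  isomorphic to \<open>K\<close> is preserved. Each move to a longer tuple and each exchange of the
  two structures costs one successor, so recovering all cells costs a fixed finite number of them
  and stays below \<open>l\<close>.\<close>

lemma osuc_le_iff: "osuc a \<le> b \<longleftrightarrow> a < b"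
  by (metis less_osuc_iff not_less)

lemma osuc_pos: "0 < osuc a"
  using less_osuc_iff zero_le_omega1 by blast

lemma le_osuc: "a \<le> osuc a"
  by (simp add: less_osuc less_imp_le)

lemma limit_osuc: "limit_ordinal l \<Longrightarrow> a < l \<Longrightarrow> osuc a < l"
  by (simp add: limit_ordinal_def)

lemma limit_pos: "limit_ordinal l \<Longrightarrow> 0 < l"
  by (simp add: limit_ordinal_def)

lemma limit_osuc_pow: "limit_ordinal l \<Longrightarrow> a < l \<Longrightarrow> (osuc ^^ n) a < l"
  by (induction n) (auto simp: limit_osuc)

lemma le_osuc_pow: "m \<le> n \<Longrightarrow> (osuc ^^ m) a \<le> (osuc ^^ n) a"
proof (induction n)
  case (Suc n)
  then show ?case
    by (cases "m = Suc n") (auto intro: order_trans[OF _ le_osuc])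
qed simp


section \<open>Isomorphisms and images\<close>

text \<open>As \<open>bf_le\<close> only compares structures of the same type, structures are moved to a common type
  along injections.\<close>

definition img :: "('a \<Rightarrow> 'b) \<Rightarrow> 'a rstruct \<Rightarrow> 'b rstruct" where
  "img h M = RStruct (h ` pts M) (map_prod h h ` lt M)"

lemma pts_img [simp]: "pts (img h M) = h ` pts M"
  by (simp add: img_def)

lemma lt_img: "inj h \<Longrightarrow> (h x, h y) \<in> lt (img h M) \<longleftrightarrow> (x, y) \<in> lt M"
  by (auto simp: img_def inj_def)

lemma iso_img: "inj h \<Longrightarrow> M \<cong>\<^sub>s img h M"
  unfolding isomorphic_def bij_betw_def
  by (rule exI[of _ h]) (metis inj_on_subset lt_img pts_img subset_UNIV)

lemma iso_sym: 
  assumes "M \<cong>\<^sub>s N"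
  shows "N \<cong>\<^sub>s M"
proof -
  obtain h where h: "bij_betw h (pts M) (pts N)"
    "\<forall>x\<in>pts M. \<forall>y\<in>pts M. (x, y) \<in> lt M \<longleftrightarrow> (h x, h y) \<in> lt N"
    using assms by (auto simp: isomorphic_def)
  let ?g = "inv_into (pts M) h"
  have "bij_betw ?g (pts N) (pts M)" using h(1) by (rule bij_betw_inv_into)
  moreover have "(x, y) \<in> lt N \<longleftrightarrow> (?g x, ?g y) \<in> lt M" if "x \<in> pts N" "y \<in> pts N" for x y
  proof -
    have "?g x \<in> pts M" "?g y \<in> pts M" "h (?g x) = x" "h (?g y) = y"
      using that h(1) by (auto simp: bij_betw_def inv_into_into f_inv_into_f)
    then show ?thesis using h(2) by metis
  qed
  ultimately show ?thesis unfolding isomorphic_def by blast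
qed

lemma iso_trans:
  assumes "M \<cong>\<^sub>s N" "N \<cong>\<^sub>s P"
  shows "M \<cong>\<^sub>s P"
proof -
  obtain h where h: "bij_betw h (pts M) (pts N)"
    "\<forall>x\<in>pts M. \<forall>y\<in>pts M. (x, y) \<in> lt M \<longleftrightarrow> (h x, h y) \<in> lt N"
    using assms by (auto simp: isomorphic_def)
  obtain g where g: "bij_betw g (pts N) (pts P)"
    "\<forall>x\<in>pts N. \<forall>y\<in>pts N. (x, y) \<in> lt N \<longleftrightarrow> (g x, g y) \<in> lt P"
    using assms by (auto simp: isomorphic_def)
  have "bij_betw (g \<circ> h) (pts M) (pts P)" using h(1) g(1) by (rule bij_betw_trans)
  moreover have "\<forall>x\<in>pts M. \<forall>y\<in>pts M. (x, y) \<in> lt M \<longleftrightarrow> ((g \<circ> h) x, (g \<circ> h) y) \<in> lt P"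
    using h g by (simp add: bij_betw_apply)
  ultimately show ?thesis unfolding isomorphic_def by blast
qed


section \<open>Back-and-forth relations\<close>

lemma bf_le_0: "bf_le 0 M as N bs \<longleftrightarrow> atomic_equiv M as N bs"
  by (simp add: bf_le.simps)

lemma bf_le_pos: "0 < a \<Longrightarrow> bf_le a M as N bs \<longleftrightarrow>
    (\<forall>b<a. \<forall>ds\<in>lists (pts N). \<exists>cs\<in>lists (pts M).
       length cs = length ds \<and> bf_le b N (bs @ ds) M (as @ cs))"
  by (subst bf_le.simps) auto

lemma bf_le_ext:
  assumes "bf_le a M as N bs" "b < a" "set ds \<subseteq> pts N"
  obtains cs where "set cs \<subseteq> pts M" "length cs = length ds" "bf_le b N (bs @ ds) M (as @ cs)"
proof -
  have "0 < a" using assms(2) by (metis zero_le_omega1 order.strict_trans1)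
  moreover have "ds \<in> lists (pts N)" using assms(3) by (simp add: in_lists_conv_set subset_iff)
  ultimately obtain cs where "cs \<in> lists (pts M)" "length cs = length ds" "bf_le b N (bs @ ds) M (as @ cs)"
    using assms(1,2) bf_le_pos by metis
  then show ?thesis using that[of cs] by auto
qed

lemma bf_leI:
  assumes "0 < a"
    and "\<And>b ds. b < a \<Longrightarrow> set ds \<subseteq> pts N \<Longrightarrow>
      \<exists>cs. set cs \<subseteq> pts M \<and> length cs = length ds \<and> bf_le b N (bs @ ds) M (as @ cs)"
  shows "bf_le a M as N bs"
  using assms by (simp add: bf_le_pos in_lists_conv_set subset_iff Bex_def Ball_def)

lemma atomic_equiv_sym: "atomic_equiv M as N bs \<Longrightarrow> atomic_equiv N bs M as"
  by (auto simp: atomic_equiv_def)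

lemma bf_le_atomic: "bf_le a M as N bs \<Longrightarrow> atomic_equiv M as N bs"
proof -
  assume a: "bf_le a M as N bs"
  show ?thesis
  proof (cases "a = 0")
    case False
    then have "0 < a" by (simp add: le_neq_trans)
    from bf_le_ext[OF a this, of "[]"] show ?thesis
      by (auto simp: bf_le_0 intro: atomic_equiv_sym)
  qed (use a in \<open>simp add: bf_le_0\<close>)
qed

lemma bf_le_length: "bf_le a M as N bs \<Longrightarrow> length as = length bs"
  using bf_le_atomic atomic_equiv_def by blast

lemma bf_le_mono: 
  assumes "bf_le a M as N bs" "b \<le> a"
  shows "bf_le b M as N bs"
proof (cases "b = 0")
  case True
  then show ?thesis using assms(1) bf_le_atomic bf_le_0 by blast
next
  case False
  then have "0 < b" by (simp add: le_neq_trans)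
  then show ?thesis
    by (rule bf_leI) (meson assms bf_le_ext order_less_le_trans)
qed

text \<open>Extending by the empty tuple exchanges the two sides at the price of one level. As the
  relation is not symmetric, this is how reverse directions are usually obtained below.\<close>

lemma bf_le_swap: "bf_le a M as N bs \<Longrightarrow> b < a \<Longrightarrow> bf_le b N bs M as"
  by (erule bf_le_ext[of _ _ _ _ _ _ "[]"]) auto

lemma bf_le_refl: "bf_le a M as M as"
proof (induction a arbitrary: as rule: less_induct)
  case (less a)
  show ?case
  proof (cases "a = 0")
    case True
    then show ?thesis by (simp add: bf_le_0 atomic_equiv_def)
  next
    case False
    then have "0 < a" by (simp add: le_neq_trans)
    then show ?thesis by (rule bf_leI) (use less in blast)
  qed
qed

lemma bf_le_trans: "bf_le a M as N bs \<Longrightarrow> bf_le a N bs P cs \<Longrightarrow> bf_le a M as P cs"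
proof (induction a arbitrary: M as N bs P cs rule: less_induct)
  case (less a)
  show ?case
  proof (cases "a = 0")
    case True
    then show ?thesis using less.prems by (auto simp: bf_le_0 atomic_equiv_def)
  next
    case False
    then have "0 < a" by (simp add: le_neq_trans)
    then show ?thesis
    proof (rule bf_leI)
      fix b ds assume b: "b < a" and ds: "set ds \<subseteq> pts P"
      obtain es where es: "set es \<subseteq> pts N" "length es = length ds"
        "bf_le b P (cs @ ds) N (bs @ es)"
        using bf_le_ext[OF less.prems(2) b ds] by blast
      obtain fs where "set fs \<subseteq> pts M" "length fs = length es"
        "bf_le b N (bs @ es) M (as @ fs)"
        using bf_le_ext[OF less.prems(1) b es(1)] by blast
      then show "\<exists>fs. set fs \<subseteq> pts M \<and> length fs = length ds \<and> bf_le b P (cs @ ds) M (as @ fs)"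
        using less.IH[OF b] es by metis
    qed
  qed
qed

section \<open>Permuting, repeating and dropping parameters\<close>

lemma atomic_equiv_reindex:
  assumes "atomic_equiv M as N bs" "set is \<subseteq> {..<length as}"
  shows "atomic_equiv M (map ((!) as) is) N (map ((!) bs) is)"
  using assms by (simp add: atomic_equiv_def subset_iff)

lemma bf_le_reindex:
  assumes "bf_le a M as N bs" "set is \<subseteq> {..<length as}"
  shows "bf_le a M (map ((!) as) is) N (map ((!) bs) is)"
  using assms
proof (induction a arbitrary: M as N bs "is" rule: less_induct)
  case (less a)
  show ?case
  proof (cases "a = 0")
    case True
    then show ?thesis using less.prems by (simp add: bf_le_0 atomic_equiv_reindex)
  next
    case False
    then have "0 < a" by (simp add: le_neq_trans)
    then show ?thesis
    proof (rule bf_leI)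
      fix b ds assume b: "b < a" and ds: "set ds \<subseteq> pts N"
      have len: "length as = length bs" using less.prems bf_le_length by blast
      obtain cs where cs: "set cs \<subseteq> pts M" "length cs = length ds"
        "bf_le b N (bs @ ds) M (as @ cs)"
        using bf_le_ext[OF less.prems(1) b ds] by blast
      let ?js = "is @ map (\<lambda>i. length as + i) [0..<length ds]"
      have "set ?js \<subseteq> {..<length (bs @ ds)}"
        using less.prems(2) len by auto
      from less.IH[OF b cs(3) this]
      have 1: "bf_le b N (map ((!) (bs @ ds)) ?js) M (map ((!) (as @ cs)) ?js)" .
      have 2: "map ((!) (bs @ ds)) ?js = map ((!) bs) is @ ds"
        using less.prems(2) len by (auto simp: nth_append intro!: nth_equalityI)
      have 3: "map ((!) (as @ cs)) ?js = map ((!) as) is @ cs"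
        using less.prems(2) len cs(2) by (auto simp: nth_append intro!: nth_equalityI)
      show "\<exists>cs. set cs \<subseteq> pts M \<and> length cs = length ds \<and>
          bf_le b N (map ((!) bs) is @ ds) M (map ((!) as) is @ cs)"
        using 1 cs(1,2) unfolding 2 3 by blast
    qed
  qed
qed

lemma bf_le_sub:
  assumes "bf_le a M as N bs" 
    and "as' = map ((!) as) is" "bs' = map ((!) bs) is" "\<forall>i\<in>set is. i < length as"
  shows "bf_le a M as' N bs'"
  using bf_le_reindex[OF assms(1)] assms(2-4) by auto

text \<open>The relation depends only on which entries are paired. An inclusion between sets of
  pairs is a form of this that \<open>auto\<close> can check for concrete lists.\<close>

lemma bf_le_zip:
  assumes "bf_le a M as N bs" "length as' = length bs'" "set (zip as' bs') \<subseteq> set (zip as bs)"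
  shows "bf_le a M as' N bs'"
proof -
  have len: "length as = length bs" by (rule bf_le_length[OF assms(1)])
  have "\<forall>i<length as'. \<exists>k<length as. as ! k = as' ! i \<and> bs ! k = bs' ! i"
  proof (intro allI impI)
    fix i assume "i < length as'"
    then have "(as' ! i, bs' ! i) \<in> set (zip as bs)" using assms(2,3) by (auto simp: set_zip)
    then show "\<exists>k<length as. as ! k = as' ! i \<and> bs ! k = bs' ! i" using len by (auto simp: set_zip)
  qed
  then obtain f where f: "\<forall>i<length as'. f i < length as \<and> as ! f i = as' ! i \<and> bs ! f i = bs' ! i" by metis
  show ?thesis
    by (rule bf_le_sub[OF assms(1), of _ "map f [0..<length as']"])
       (use f assms(2) in \<open>auto intro!: nth_equalityI\<close>)
qed

lemma atomic_nth:
  assumes "atomic_equiv M as N bs" "i < length as" "j < length as"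
  shows "as ! i = as ! j \<longleftrightarrow> bs ! i = bs ! j" "(as ! i, as ! j) \<in> lt M \<longleftrightarrow> (bs ! i, bs ! j) \<in> lt N"
  using assms by (auto simp: atomic_equiv_def)

text \<open>Both directions are proved together because each extension step passes from one to the
  other.\<close>

lemma bf_le_iso_map:
  assumes "bij_betw h (pts M) (pts N)"
    "\<forall>x\<in>pts M. \<forall>y\<in>pts M. (x, y) \<in> lt M \<longleftrightarrow> (h x, h y) \<in> lt N"
    "set as \<subseteq> pts M"
  shows "bf_le a M as N (map h as) \<and> bf_le a N (map h as) M as"
  using assms(3)
proof (induction a arbitrary: as rule: less_induct)
  case (less a)
  have inj: "inj_on h (pts M)" and im: "h ` pts M = pts N"
    using assms(1) by (auto simp: bij_betw_def)
  show ?case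
  proof (cases "a = 0")
    case True
    have "atomic_equiv M as N (map h as)"
      using less.prems inj assms(2) by (auto simp: atomic_equiv_def inj_on_eq_iff subset_iff)
    then show ?thesis using True by (simp add: bf_le_0 atomic_equiv_sym)
  next
    case False
    then have a: "0 < a" by (simp add: le_neq_trans)
    have "\<exists>cs. set cs \<subseteq> pts M \<and> length cs = length ds \<and> bf_le b N (map h as @ ds) M (as @ cs)"
      if "b < a" "set ds \<subseteq> pts N" for b ds
    proof -
      let ?cs = "map (inv_into (pts M) h) ds"
      have "set ?cs \<subseteq> pts M" using that(2) im by (auto simp: inv_into_into subset_iff)
      moreover have "map h ?cs = ds" using that(2) im by (auto simp: f_inv_into_f map_idI subset_iff)
      ultimately show ?thesis using less.IH[OF that(1), of "as @ ?cs"] less.prems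
        by (metis Un_subset_iff length_map map_append set_append)
    qed
    moreover have "\<exists>cs. set cs \<subseteq> pts N \<and> length cs = length ds \<and> bf_le b M (as @ ds) N (map h as @ cs)"
      if "b < a" "set ds \<subseteq> pts M" for b ds
    proof -
      have "set (map h ds) \<subseteq> pts N" using that(2) im by auto
      then show ?thesis using less.IH[OF that(1), of "as @ ds"] less.prems that(2)
        by (metis Un_subset_iff length_map map_append set_append)
    qed
    ultimately show ?thesis using bf_leI[OF a] by metis
  qed
qed

section \<open>Equivalence of whole structures and change of type\<close>

lemma iso_bf_equiv: "M \<cong>\<^sub>s N \<Longrightarrow> bf_equiv a M N"
  unfolding isomorphic_def bf_equiv_def using bf_le_iso_map[of _ M N "[]" a] by auto

lemma bf_equiv_sym: "bf_equiv a M N \<Longrightarrow> bf_equiv a N M"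
  by (auto simp: bf_equiv_def)

lemma bf_equiv_trans: "bf_equiv a M N \<Longrightarrow> bf_equiv a N P \<Longrightarrow> bf_equiv a M P"
  unfolding bf_equiv_def by (meson bf_le_trans)

lemma bf_equiv_mono: "bf_equiv a M N \<Longrightarrow> b \<le> a \<Longrightarrow> bf_equiv b M N"
  unfolding bf_equiv_def by (meson bf_le_mono)

lemma bf_le_img:
  assumes "inj h"
  shows "bf_le a M as N bs \<longleftrightarrow> bf_le a (img h M) (map h as) (img h N) (map h bs)"
proof (induction a arbitrary: M as N bs rule: less_induct)
  case (less a)
  show ?case
  proof (cases "a = 0")
    case True
    have "length bs = length as \<Longrightarrow> ?thesis"
      using assms by (simp add: True bf_le_0 atomic_equiv_def lt_img inj_eq)
    then show ?thesis by (auto simp: True bf_le_0 atomic_equiv_def)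
  next
    case False
    then have a: "0 < a" by (simp add: le_neq_trans)
    have eq: "lists (pts (img h X)) = map h ` lists (pts X)" for X
      by (simp add: lists_image)
    show ?thesis unfolding bf_le_pos[OF a] eq
      using less.IH by (simp add: ball_simps)
  qed
qed

lemma bf_equiv_img: "inj h \<Longrightarrow> bf_equiv a (img h M) (img h N) \<longleftrightarrow> bf_equiv a M N"
  unfolding bf_equiv_def using bf_le_img[of h a _ "[]" _ "[]"] by simp


subsection \<open>Restriction to intervals\<close>

definition restr :: "'a rstruct \<Rightarrow> 'a set \<Rightarrow> 'a rstruct" where
  "restr M I = RStruct (pts M \<inter> I) (lt M \<inter> (pts M \<inter> I) \<times> (pts M \<inter> I))"

lemma pts_restr [simp]: "pts (restr M I) = pts M \<inter> I"
  and lt_restr: "lt (restr M I) = lt M \<inter> (pts M \<inter> I) \<times> (pts M \<inter> I)"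
  by (simp_all add: restr_def)

lemma interval_restr: "interval M a b = restr M {x. (a, x) \<in> lt M \<and> (x, b) \<in> lt M}"
  by (simp add: interval_def restr_def Let_def Int_def conj_commute)

lemma pts_interval: "pts (interval M a b) = {x \<in> pts M. (a, x) \<in> lt M \<and> (x, b) \<in> lt M}"
  by (simp add: interval_def Let_def)

lemma lt_interval: "lt (interval M a b) = lt M \<inter> pts (interval M a b) \<times> pts (interval M a b)"
  by (simp add: interval_def Let_def)

text \<open>With the endpoints kept as the first two entries, the atomic type forces every answer to
  a point of one interval into the other interval.\<close>

lemma bf_le_interval:
  assumes "bf_le a M (x # y # as) N (x' # y' # bs)"
    and "set as \<subseteq> pts (interval M x y)" "set bs \<subseteq> pts (interval N x' y')"
  shows "bf_le a (interval M x y) as (interval N x' y') bs"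
  using assms
proof (induction a arbitrary: M x y as N x' y' bs rule: less_induct)
  case (less a)
  have at: "atomic_equiv M (x # y # as) N (x' # y' # bs)" by (rule bf_le_atomic[OF less.prems(1)])
  show ?case
  proof (cases "a = 0")
    case True
    have len: "length as = length bs" using at by (auto simp: atomic_equiv_def)
    have "(as ! i = as ! j) = (bs ! i = bs ! j)" "((as ! i, as ! j) \<in> lt M) = ((bs ! i, bs ! j) \<in> lt N)" 
      if "i < length as" "j < length as" for i j
      using atomic_nth[OF at, of "i + 2" "j + 2"] that by auto
    moreover have "as ! i \<in> pts (interval M x y)" "bs ! i \<in> pts (interval N x' y')" if "i < length as" for i
      using that less.prems(2,3) len by auto
    ultimately show ?thesis using len
      by (simp add: True bf_le_0 atomic_equiv_def lt_interval)
  next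
    case False
    then have a: "0 < a" by (simp add: le_neq_trans)
    then show ?thesis
    proof (rule bf_leI)
      fix b ds assume b: "b < a" and ds: "set ds \<subseteq> pts (interval N x' y')"
      then have "set ds \<subseteq> pts N" by (auto simp: pts_interval)
      then obtain cs where cs: "set cs \<subseteq> pts M" "length cs = length ds"
        "bf_le b N ((x' # y' # bs) @ ds) M ((x # y # as) @ cs)"
        using bf_le_ext[OF less.prems(1) b] by blast
      have at': "atomic_equiv N ((x' # y' # bs) @ ds) M ((x # y # as) @ cs)"
        using bf_le_atomic[OF cs(3)] .
      have len: "length as = length bs" using at by (auto simp: atomic_equiv_def)
      have "cs ! i \<in> pts (interval M x y)" if "i < length cs" for i
      proof -
        have "(x', ds ! i) \<in> lt N" "(ds ! i, y') \<in> lt N"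
          using ds that cs(2) by (auto simp: pts_interval subset_iff)
        then have "(x, cs ! i) \<in> lt M" "(cs ! i, y) \<in> lt M"
          using atomic_nth(2)[OF at', of 0 "length as + 2 + i"] 
                atomic_nth(2)[OF at', of "length as + 2 + i" 1] that cs(2) len
          by (auto simp: nth_append)
        then show ?thesis using cs(1) that by (auto simp: pts_interval)
      qed
      then have "set cs \<subseteq> pts (interval M x y)" by (metis in_set_conv_nth subsetI)
      moreover have "bf_le b (interval N x' y') (bs @ ds) (interval M x y) (as @ cs)"
        using less.IH[OF b, of N x' y' "bs @ ds" M x y "as @ cs"] cs(3) less.prems ds calculation by simp
      ultimately show "\<exists>cs. set cs \<subseteq> pts (interval M x y) \<and> length cs = length ds \<and>
          bf_le b (interval N x' y') (bs @ ds) (interval M x y) (as @ cs)"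
        using cs(2) by blast
    qed
  qed
qed


subsection \<open>Sums\<close>

definition component :: "('a \<Rightarrow> 'i) \<Rightarrow> 'a rstruct \<Rightarrow> 'i \<Rightarrow> 'a rstruct" where
  "component loc M i = restr M {x. loc x = i}"

text \<open>Answers \<open>C i\<close> found cell by cell are interleaved in the pattern that the
  locations of \<open>ds\<close> prescribe.\<close>

lemma reassemble:
  assumes "\<And>i. length (C i) = length (filter (\<lambda>x. loc x = i) ds)"
    and "\<And>i. \<forall>c\<in>set (C i). loc c = i"
  shows "\<exists>cs. map loc cs = map loc ds \<and> (\<forall>i. filter (\<lambda>x. loc x = i) cs = C i)"
  using assms
proof (induction ds arbitrary: C)
  case Nil
  then show ?case by (intro exI[of _ "[]"]) simp
next
  case (Cons d ds)
  obtain c cs0 where c: "C (loc d) = c # cs0"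
    using Cons.prems(1)[of "loc d"] by (cases "C (loc d)") auto
  let ?C = "C(loc d := cs0)"
  have "length (?C i) = length (filter (\<lambda>x. loc x = i) ds)" for i
    using Cons.prems(1)[of i] c by (auto split: if_splits)
  moreover have "\<forall>c\<in>set (?C i). loc c = i" for i
    using Cons.prems(2)[of i] c by auto
  ultimately obtain cs where cs: "map loc cs = map loc ds"
    "\<forall>i. filter (\<lambda>x. loc x = i) cs = ?C i"
    using Cons.IH[of ?C] by blast
  have "loc c = loc d" using Cons.prems(2)[of "loc d"] c by simp
  then show ?case using cs c by (intro exI[of _ "c # cs"]) auto
qed

lemma sum_step:
  assumes loc: "map loc as = map loc bs"
    and step: "\<And>i. \<exists>cs. set cs \<subseteq> pts (component loc M i) \<and> 
      length cs = length (filter (\<lambda>x. loc x = i) ds) \<and>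
      bf_le b (component loc N i) (filter (\<lambda>x. loc x = i) bs @ filter (\<lambda>x. loc x = i) ds)
              (component loc M i) (filter (\<lambda>x. loc x = i) as @ cs)"
  shows "\<exists>cs. set cs \<subseteq> pts M \<and> map loc cs = map loc ds \<and>
    (\<forall>i. bf_le b (component loc N i) (filter (\<lambda>x. loc x = i) (bs @ ds))
              (component loc M i) (filter (\<lambda>x. loc x = i) (as @ cs)))"
proof -
  obtain C where C: "\<And>i. set (C i) \<subseteq> pts (component loc M i)"
      "\<And>i. length (C i) = length (filter (\<lambda>x. loc x = i) ds)"
      "\<And>i. bf_le b (component loc N i) (filter (\<lambda>x. loc x = i) bs @ filter (\<lambda>x. loc x = i) ds)
              (component loc M i) (filter (\<lambda>x. loc x = i) as @ C i)"
    using step by metis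
  have "\<forall>c\<in>set (C i). loc c = i" for i using C(1)[of i] by (auto simp: component_def)
  then obtain cs where cs: "map loc cs = map loc ds" "\<forall>i. filter (\<lambda>x. loc x = i) cs = C i"
    using reassemble[of C loc ds] C(2) by blast
  have "c \<in> pts M" if "c \<in> set cs" for c
  proof -
    have "c \<in> set (filter (\<lambda>x. loc x = loc c) cs)" using that by simp
    then show ?thesis using cs(2) C(1)[of "loc c"] by (auto simp: component_def)
  qed
  then show ?thesis using cs C(3) by (intro exI[of _ cs]) auto
qed

lemma nth_filter_pos:
  assumes "map loc as = map loc bs" "k < length as" "loc (as ! k) = i"
  shows "\<exists>j < length (filter (\<lambda>x. loc x = i) as). filter (\<lambda>x. loc x = i) as ! j = as ! k \<and>
     filter (\<lambda>x. loc x = i) bs ! j = bs ! k"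
  using assms
proof (induction as arbitrary: bs k)
  case (Cons a as)
  obtain b bs' where bs: "bs = b # bs'" using Cons.prems by (cases bs) auto
  show ?case
  proof (cases k)
    case 0
    then show ?thesis using Cons.prems bs by auto
  next
    case (Suc k')
    have "\<exists>j < length (filter (\<lambda>x. loc x = i) as). filter (\<lambda>x. loc x = i) as ! j = as ! k' \<and>
     filter (\<lambda>x. loc x = i) bs' ! j = bs' ! k'"
      using Cons.IH[of bs' k'] Cons.prems Suc bs by auto
    then obtain j where j: "j < length (filter (\<lambda>x. loc x = i) as)" "filter (\<lambda>x. loc x = i) as ! j = as ! k'"
     "filter (\<lambda>x. loc x = i) bs' ! j = bs' ! k'" by blast
    show ?thesis
    proof (cases "loc a = i")
      case True
      then show ?thesis using j Suc bs Cons.prems by (intro exI[of _ "Suc j"]) auto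
    next
      case False
      then show ?thesis using j Suc bs Cons.prems by (intro exI[of _ j]) auto
    qed
  qed
qed simp

text \<open>An ordered sum described from outside: the relation \<open>R\<close> between locations
  decides the order across cells. Two structures to be compared can share one \<open>loc\<close>
  without their summands being named.\<close>

definition layered :: "('a \<Rightarrow> 'i) \<Rightarrow> ('i \<Rightarrow> 'i \<Rightarrow> bool) \<Rightarrow> 'a rstruct \<Rightarrow> bool" where
  "layered loc R M \<longleftrightarrow> (\<forall>x\<in>pts M. \<forall>y\<in>pts M. loc x \<noteq> loc y \<longrightarrow> ((x, y) \<in> lt M \<longleftrightarrow> R (loc x) (loc y)))"

lemma sum_atomic:
  assumes "layered loc R M" "layered loc R N"
    and loc: "map loc as = map loc bs" and pts: "set as \<subseteq> pts M" "set bs \<subseteq> pts N"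
    and c: "\<And>i. atomic_equiv (component loc M i) (filter (\<lambda>x. loc x = i) as) (component loc N i) (filter (\<lambda>x. loc x = i) bs)"
  shows "atomic_equiv M as N bs"
  unfolding atomic_equiv_def
proof (intro conjI allI impI)
  show len: "length as = length bs" using loc by (metis length_map)
  fix i j assume ij: "i < length as" "j < length as"
  have l: "loc (as ! k) = loc (bs ! k)" if "k < length as" for k
    using loc that len by (metis nth_map)
  have p: "as ! i \<in> pts M" "as ! j \<in> pts M" "bs ! i \<in> pts N" "bs ! j \<in> pts N"
    using pts ij len by auto
  have "(as ! i = as ! j \<longleftrightarrow> bs ! i = bs ! j) \<and> ((as ! i, as ! j) \<in> lt M \<longleftrightarrow> (bs ! i, bs ! j) \<in> lt N)"
  proof (cases "loc (as ! i) = loc (as ! j)")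
    case False
    then show ?thesis using assms(1,2) p l[OF ij(1)] l[OF ij(2)] unfolding layered_def by metis
  next
    case True
    let ?l = "loc (as ! i)"
    obtain i' where i': "i' < length (filter (\<lambda>x. loc x = ?l) as)" "filter (\<lambda>x. loc x = ?l) as ! i' = as ! i"
       "filter (\<lambda>x. loc x = ?l) bs ! i' = bs ! i" using nth_filter_pos[OF loc ij(1) refl] by blast
    obtain j' where j': "j' < length (filter (\<lambda>x. loc x = ?l) as)" "filter (\<lambda>x. loc x = ?l) as ! j' = as ! j"
       "filter (\<lambda>x. loc x = ?l) bs ! j' = bs ! j" using nth_filter_pos[OF loc ij(2)] True by metis
    show ?thesis using atomic_nth[OF c i'(1) j'(1)] i' j' p l[OF ij(1)] l[OF ij(2)] True
      by (auto simp: component_def lt_restr)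
  qed
  then show "(as ! i = as ! j) = (bs ! i = bs ! j)" "((as ! i, as ! j) \<in> lt M) = ((bs ! i, bs ! j) \<in> lt N)" by auto
qed

text \<open>Answering in every cell separately is a correct strategy, because comparisons across
  cells are settled by the locations, on which both tuples agree.\<close>

lemma bf_le_sum:
  assumes "layered loc R M" "layered loc R N"
    and loc: "map loc as = map loc bs" and pts: "set as \<subseteq> pts M" "set bs \<subseteq> pts N"
    and c: "\<And>i. bf_le a (component loc M i) (filter (\<lambda>x. loc x = i) as) (component loc N i) (filter (\<lambda>x. loc x = i) bs)"
  shows "bf_le a M as N bs"
  using assms
proof (induction a arbitrary: M as N bs rule: less_induct)
  case (less a)
  show ?case
  proof (cases "a = 0")
    case True
    then show ?thesis using sum_atomic[OF less.prems(1-5)] less.prems(6) by (simp add: bf_le_0)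
  next
    case False
    then have a: "0 < a" by (simp add: le_neq_trans)
    then show ?thesis
    proof (rule bf_leI)
      fix b ds assume b: "b < a" and ds: "set ds \<subseteq> pts N"
      have "\<exists>cs. set cs \<subseteq> pts (component loc M i) \<and> 
        length cs = length (filter (\<lambda>x. loc x = i) ds) \<and>
        bf_le b (component loc N i) (filter (\<lambda>x. loc x = i) bs @ filter (\<lambda>x. loc x = i) ds)
                (component loc M i) (filter (\<lambda>x. loc x = i) as @ cs)" for i
      proof -
        have "set (filter (\<lambda>x. loc x = i) ds) \<subseteq> pts (component loc N i)" using ds by (auto simp: component_def)
        then show ?thesis using bf_le_ext[OF less.prems(6)[of i] b] by metis
      qed
      from sum_step[OF less.prems(3) this] obtain cs where cs: "set cs \<subseteq> pts M" "map loc cs = map loc ds"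
        "\<And>i. bf_le b (component loc N i) (filter (\<lambda>x. loc x = i) (bs @ ds))
              (component loc M i) (filter (\<lambda>x. loc x = i) (as @ cs))" by blast
      have "bf_le b N (bs @ ds) M (as @ cs)"
        by (rule less.IH[OF b]) (use less.prems cs ds in auto)
      then show "\<exists>cs. set cs \<subseteq> pts M \<and> length cs = length ds \<and> bf_le b N (bs @ ds) M (as @ cs)"
        using cs by (metis length_map)
    qed
  qed
qed

text \<open>Unlike in \<open>bf_le_sum\<close> there are two location functions: the cells of an
  unknown structure will be defined by comparison and not by the coordinates of its points.\<close>

lemma iso_glue:
  assumes M: "\<forall>x\<in>pts M. \<forall>y\<in>pts M. locM x \<noteq> locM y \<longrightarrow> ((x, y) \<in> lt M \<longleftrightarrow> R (locM x) (locM y))"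
    and N: "\<forall>x\<in>pts N. \<forall>y\<in>pts N. locN x \<noteq> locN y \<longrightarrow> ((x, y) \<in> lt N \<longleftrightarrow> R (locN x) (locN y))"
    and c: "\<And>i. component locM M i \<cong>\<^sub>s component locN N i"
  shows "M \<cong>\<^sub>s N"
proof -
  obtain H where H: "\<And>i. bij_betw (H i) (pts (component locM M i)) (pts (component locN N i))"
    "\<And>i. \<forall>x\<in>pts (component locM M i). \<forall>y\<in>pts (component locM M i). (x, y) \<in> lt (component locM M i) \<longleftrightarrow> (H i x, H i y) \<in> lt (component locN N i)"
    using c unfolding isomorphic_def by metis
  let ?h = "\<lambda>x. H (locM x) x"
  have hp: "?h x \<in> pts N" "locN (?h x) = locM x" if "x \<in> pts M" for x
    using bij_betw_apply[OF H(1)[of "locM x"], of x] that by (auto simp: component_def)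
  have "inj_on ?h (pts M)"
  proof (rule inj_onI)
    fix x y assume xy: "x \<in> pts M" "y \<in> pts M" "?h x = ?h y"
    then have "locM x = locM y" using hp(2) by metis
    then show "x = y" using xy H(1)[of "locM x"]
      by (auto simp: bij_betw_def inj_on_def component_def)
  qed
  moreover have "z \<in> ?h ` pts M" if "z \<in> pts N" for z
  proof -
    have "z \<in> pts (component locN N (locN z))" using that by (simp add: component_def)
    then obtain x where "x \<in> pts (component locM M (locN z))" "z = H (locN z) x"
      using H(1)[of "locN z"] by (auto simp: bij_betw_def)
    then have "x \<in> pts M" "z = ?h x" by (auto simp: component_def)
    then show ?thesis by blast
  qed
  ultimately have "bij_betw ?h (pts M) (pts N)" using hp(1) by (auto simp: bij_betw_def)
  moreover have "(x, y) \<in> lt M \<longleftrightarrow> (?h x, ?h y) \<in> lt N" if xy: "x \<in> pts M" "y \<in> pts M" for x y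
  proof (cases "locM x = locM y")
    case False
    then show ?thesis using M N xy hp by metis
  next
    case True
    then show ?thesis using H(2)[of "locM x"] xy hp[OF xy(1)] hp[OF xy(2)]
      by (auto simp: component_def lt_restr)
  qed
  ultimately show ?thesis unfolding isomorphic_def by blast
qed


section \<open>Formulas\<close>

text \<open>One assignment stands for the whole block of quantifiers. A variable may occur twice in
  \<open>xs\<close>; the inner binding then overrides the outer one, and the final assignment is of
  the same kind.\<close>

lemma sat_foldr_All: "sat M (foldr All xs p) e \<longleftrightarrow>
  (\<forall>e'. (\<forall>x\<in>set xs. e' x \<in> pts M) \<and> (\<forall>x. x \<notin> set xs \<longrightarrow> e' x = e x) \<longrightarrow> sat M p e')"
proof (induction xs arbitrary: e)
  case Nil
  then show ?case by (auto simp: fun_eq_iff[symmetric])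
next
  case (Cons x xs)
  show ?case
  proof (intro iffI allI impI)
    fix e' assume a: "sat M (foldr All (x # xs) p) e"
      and e': "(\<forall>y\<in>set (x # xs). e' y \<in> pts M) \<and> (\<forall>y. y \<notin> set (x # xs) \<longrightarrow> e' y = e y)"
    have "sat M (foldr All xs p) (e(x := e' x))" using a e' by simp
    then show "sat M p e'" unfolding Cons.IH by (rule allE[of _ e']) (use e' in auto)
  next
    assume a: "\<forall>e'. (\<forall>y\<in>set (x # xs). e' y \<in> pts M) \<and> (\<forall>y. y \<notin> set (x # xs) \<longrightarrow> e' y = e y) \<longrightarrow> sat M p e'"
    have "sat M p e'" if "c \<in> pts M" "\<forall>y\<in>set xs. e' y \<in> pts M" "\<forall>y. y \<notin> set xs \<longrightarrow> e' y = (e(x := c)) y" for c e'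
    proof -
      have "e' x \<in> pts M" using that by (cases "x \<in> set xs") auto
      then show ?thesis using that by (intro a[rule_format]) auto
    qed
    then show "sat M (foldr All (x # xs) p) e" by (simp add: Cons.IH)
  qed
qed

lemma sat_foldr_Ex_neg: "sat M (foldr Ex xs p) e \<longleftrightarrow> \<not> sat M (foldr All xs (Neg p)) e"
  by (induction xs arbitrary: e) auto

lemma sat_foldr_Ex: "sat M (foldr Ex xs p) e \<longleftrightarrow>
  (\<exists>e'. (\<forall>x\<in>set xs. e' x \<in> pts M) \<and> (\<forall>x. x \<notin> set xs \<longrightarrow> e' x = e x) \<and> sat M p e')"
  unfolding sat_foldr_Ex_neg sat_foldr_All by auto

lemma fv_foldr_All [simp]: "fv (foldr All xs p) = fv p - set xs"
  and fv_foldr_Ex [simp]: "fv (foldr Ex xs p) = fv p - set xs"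
  by (induction xs) auto

lemma sat_cong: "(\<And>x. x \<in> fv p \<Longrightarrow> e x = e' x) \<Longrightarrow> sat M p e \<longleftrightarrow> sat M p e'"
proof (induction p arbitrary: e e')
  case (Neg p)
  then show ?case by (metis fv.simps(4) sat.simps(4))
next
  case (And p q)
  then show ?case by (metis Un_iff fv.simps(5) sat.simps(5))
next
  case (Conj P)
  have "sat M (P i) e = sat M (P i) e'" for i by (rule Conj.IH) (use Conj.prems in auto)
  then show ?case by simp
next
  case (Disj P)
  have "sat M (P i) e = sat M (P i) e'" for i by (rule Disj.IH) (use Disj.prems in auto)
  then show ?case by simp
next
  case (Ex x p)
  have "sat M p (e(x := c)) = sat M p (e'(x := c))" for c by (rule Ex.IH) (use Ex.prems in auto)
  then show ?case by simp
next
  case (All x p)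
  have "sat M p (e(x := c)) = sat M p (e'(x := c))" for c by (rule All.IH) (use All.prems in auto)
  then show ?case by simp
qed auto

lemma sat_img: "inj h \<Longrightarrow> sat (img h M) p (\<lambda>x. h (e x)) \<longleftrightarrow> sat M p e"
proof (induction p arbitrary: e)
  case (Ex x p)
  have "sat (img h M) p ((\<lambda>y. h (e y))(x := h c)) \<longleftrightarrow> sat M p (e(x := c))" for c
  proof -
    have eq: "(\<lambda>y. h (e y))(x := h c) = (\<lambda>y. h ((e(x := c)) y))" by auto
    show ?thesis unfolding eq by (rule Ex.IH[OF Ex.prems])
  qed
  then show ?case by simp
next
  case (All x p)
  have "sat (img h M) p ((\<lambda>y. h (e y))(x := h c)) \<longleftrightarrow> sat M p (e(x := c))" for c
  proof -
    have eq: "(\<lambda>y. h (e y))(x := h c) = (\<lambda>y. h ((e(x := c)) y))" by auto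
    show ?thesis unfolding eq by (rule All.IH[OF All.prems])
  qed
  then show ?case by simp
qed (auto simp: lt_img inj_eq)

lemma models_sentence: "fv p = {} \<Longrightarrow> models M p \<longleftrightarrow> sat M p e"
  unfolding models_def by (metis empty_iff sat_cong)

lemma models_img: "inj h \<Longrightarrow> fv p = {} \<Longrightarrow> models (img h M) p \<longleftrightarrow> models M p"
  using models_sentence sat_img by metis

lemma scott_sentence_countable:
  fixes N :: "'b::countable rstruct"
  assumes "scott_sentence M p"
  shows "models N p \<longleftrightarrow> N \<cong>\<^sub>s M"
proof -
  have i: "inj (to_nat :: 'b \<Rightarrow> nat)" by simp
  have "models N p \<longleftrightarrow> models (img to_nat N) p"
    using models_img[OF i, of p N] assms unfolding scott_sentence_def by blast
  also have "\<dots> \<longleftrightarrow> img to_nat N \<cong>\<^sub>s M" using assms unfolding scott_sentence_def by blast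
  also have "\<dots> \<longleftrightarrow> N \<cong>\<^sub>s M" 
    by (rule iffI[OF iso_trans[OF iso_img[OF i]] iso_trans[OF iso_sym[OF iso_img[OF i]]]])
  finally show ?thesis .
qed


subsection \<open>Preservation under back-and-forth relations\<close>

lemma qfree_sat:
  assumes "atomic_equiv M (map e vs) N (map e' vs)"
  shows "qfree p \<Longrightarrow> fv p \<subseteq> set vs \<Longrightarrow> sat M p e \<longleftrightarrow> sat N p e'"
proof (induction p)
  case (Less x y)
  then have "x \<in> set vs" "y \<in> set vs" by auto
  then obtain i j where "i < length vs" "j < length vs" "vs ! i = x" "vs ! j = y"
    by (auto simp: in_set_conv_nth)
  then show ?case using atomic_nth(2)[OF assms, of i j] by simp
next
  case (Eq x y)
  then have "x \<in> set vs" "y \<in> set vs" by auto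
  then obtain i j where "i < length vs" "j < length vs" "vs ! i = x" "vs ! j = y"
    by (auto simp: in_set_conv_nth)
  then show ?case using atomic_nth(1)[OF assms, of i j] by simp
qed auto

lemma zip_map_same: "zip (map f ys) (map g ys) = map (\<lambda>y. (f y, g y)) ys"
  by (induction ys) auto

text \<open>One block of quantifiers becomes one extension of tuples. The quantified variables may
  shadow entries of \<open>vs\<close>, so these are filtered out before \<open>xs\<close> is
  appended.\<close>

lemma bf_le_assignment:
  assumes le: "bf_le a N (map e' vs) M (map e vs)" and b: "b < a"
    and e1: "\<forall>x\<in>set xs. e1 x \<in> pts M" "\<forall>x. x \<notin> set xs \<longrightarrow> e1 x = e x"
  obtains e1' where "\<forall>x\<in>set xs. e1' x \<in> pts N" "\<forall>x. x \<notin> set xs \<longrightarrow> e1' x = e' x"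
    "bf_le b M (map e1 (filter (\<lambda>v. v \<notin> set xs) vs @ xs)) N (map e1' (filter (\<lambda>v. v \<notin> set xs) vs @ xs))"
proof -
  have "set (map e1 xs) \<subseteq> pts M" using e1 by auto
  from bf_le_ext[OF le b this] obtain cs where cs: "set cs \<subseteq> pts N" "length cs = length xs"
    "bf_le b M (map e vs @ map e1 xs) N (map e' vs @ cs)" by (metis length_map)
  \<comment> \<open>A variable that occurs several times in \<open>xs\<close> needs a single value.
    One occurrence is chosen; the others agree with it because equalities between entries belong to
    the atomic type.\<close>
  define k where "k x = (SOME k. k < length xs \<and> xs ! k = x)" for x
  have k: "k x < length xs" "xs ! (k x) = x" if "x \<in> set xs" for x
    using someI_ex[of "\<lambda>k. k < length xs \<and> xs ! k = x"] that by (auto simp: k_def in_set_conv_nth)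
  define e1' where "e1' x = (if x \<in> set xs then cs ! k x else e' x)" for x
  have "map e1' xs = cs"
  proof (rule nth_equalityI)
    fix i assume "i < length (map e1' xs)"
    then have i: "i < length xs" by simp
    have "(map e vs @ map e1 xs) ! (length vs + i) = (map e vs @ map e1 xs) ! (length vs + k (xs ! i)) 
       \<longleftrightarrow> (map e' vs @ cs) ! (length vs + i) = (map e' vs @ cs) ! (length vs + k (xs ! i))"
      by (rule atomic_nth(1)[OF bf_le_atomic[OF cs(3)]]) (use i k in auto)
    then show "map e1' xs ! i = cs ! i" using i k by (auto simp: e1'_def nth_append)
  qed (use cs(2) in simp)
  then have le': "bf_le b M (map e vs @ map e1 xs) N (map e' vs @ map e1' xs)" using cs(3) by simp
  have "bf_le b M (map e1 (filter (\<lambda>v. v \<notin> set xs) vs @ xs)) N (map e1' (filter (\<lambda>v. v \<notin> set xs) vs @ xs))"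
  proof (rule bf_le_zip[OF le'])
    have "map e1 (filter (\<lambda>v. v \<notin> set xs) vs) = map e (filter (\<lambda>v. v \<notin> set xs) vs)"
      "map e1' (filter (\<lambda>v. v \<notin> set xs) vs) = map e' (filter (\<lambda>v. v \<notin> set xs) vs)"
      using e1 by (auto simp: e1'_def)
    then show "set (zip (map e1 (filter (\<lambda>v. v \<notin> set xs) vs @ xs)) (map e1' (filter (\<lambda>v. v \<notin> set xs) vs @ xs)))
      \<subseteq> set (zip (map e vs @ map e1 xs) (map e' vs @ map e1' xs))"
      by (simp add: zip_map_same) auto
  qed simp
  then show thesis using that[of e1'] cs(1,2) k by (auto simp: e1'_def subset_iff)
qed

text \<open>Each quantifier block uses one extension, which also exchanges the two structures. Hence
  \<Pi>-formulas pass from left to right and \<Sigma>-formulas from right to left, by a simultaneous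
  induction.\<close>

lemma bf_le_preserves:
  "sigma_fm a p \<Longrightarrow> (\<And>(M :: 'a rstruct) N e e' vs. fv p \<subseteq> set vs \<Longrightarrow> bf_le a N (map e' vs) M (map e vs) \<Longrightarrow>
      sat M p e \<Longrightarrow> sat N p e')"
  "pi_fm a p \<Longrightarrow> (\<And>(M :: 'a rstruct) N e e' vs. fv p \<subseteq> set vs \<Longrightarrow> bf_le a M (map e vs) N (map e' vs) \<Longrightarrow>
      sat M p e \<Longrightarrow> sat N p e')"
proof (induction rule: sigma_fm_pi_fm.inducts)
  case (sigma_zero p)
  then show ?case using qfree_sat bf_le_0 by blast
next
  case (pi_zero p)
  then show ?case using qfree_sat bf_le_0 by blast
next
  case (sigma_step a b P xs)
  obtain i e1 where e1: "\<forall>x\<in>set (xs i). e1 x \<in> pts M" "\<forall>x. x \<notin> set (xs i) \<longrightarrow> e1 x = e x" "sat M (P i) e1"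
    using sigma_step.prems(3) by (auto simp: sat_foldr_Ex)
  let ?vs = "filter (\<lambda>v. v \<notin> set (xs i)) vs @ xs i"
  obtain e1' where e1': "\<forall>x\<in>set (xs i). e1' x \<in> pts N" "\<forall>x. x \<notin> set (xs i) \<longrightarrow> e1' x = e' x"
    "bf_le (b i) M (map e1 ?vs) N (map e1' ?vs)"
    using bf_le_assignment[OF sigma_step.prems(2) sigma_step.hyps(2) e1(1,2)] by blast
  have "fv (P i) \<subseteq> set ?vs" using sigma_step.prems(1) by auto
  then have "sat N (P i) e1'" using sigma_step.IH e1'(3) e1(3) by blast
  then show ?case using e1' by (auto simp: sat_foldr_Ex)
next
  case (pi_step a b P xs)
  have "sat N (P i) e1'" if e1': "\<forall>x\<in>set (xs i). e1' x \<in> pts N" "\<forall>x. x \<notin> set (xs i) \<longrightarrow> e1' x = e' x" for i e1'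
  proof -
    let ?vs = "filter (\<lambda>v. v \<notin> set (xs i)) vs @ xs i"
    obtain e1 where e1: "\<forall>x\<in>set (xs i). e1 x \<in> pts M" "\<forall>x. x \<notin> set (xs i) \<longrightarrow> e1 x = e x"
      "bf_le (b i) N (map e1' ?vs) M (map e1 ?vs)"
      using bf_le_assignment[OF pi_step.prems(2) pi_step.hyps(2) e1'] by blast
    have "fv (P i) \<subseteq> set ?vs" using pi_step.prems(1) by auto
    moreover have "sat M (P i) e1" using pi_step.prems(3) e1 by (auto simp: sat_foldr_All)
    ultimately show ?thesis using pi_step.IH e1(3) by blast
  qed
  then show ?case by (auto simp: sat_foldr_All)
qed

text \<open>A \<Pi> Scott sentence is preserved along the relation, so a single direction at a
  single level below \<open>l\<close> recognises \<open>M\<close>. The compared structures may live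
  on any countable type.\<close>

lemma SR_less_bf:
  fixes M :: "'a rstruct" and l :: omega1
  assumes "SR_less M l" "limit_ordinal l"
  obtains k where "k < l"
    "\<And>(N :: 'b::countable rstruct) N'. bf_le k N [] N' [] \<Longrightarrow> N \<cong>\<^sub>s M \<Longrightarrow> N' \<cong>\<^sub>s M"
proof -
  obtain a p where a: "a < l" "pi_fm (osuc a) p" "scott_sentence M p"
    using assms(1) by (auto simp: SR_less_def is_uSR_def has_scott_sentence_def)
  have fv: "fv p = {}" using a(3) by (simp add: scott_sentence_def)
  have "N' \<cong>\<^sub>s M" if "bf_le (osuc a) N [] N' []" "N \<cong>\<^sub>s M" for N N' :: "'b rstruct"
  proof -
    have "models N p" using that(2) scott_sentence_countable[OF a(3)] by blast
    then have "sat N p e" for e by (simp add: models_def)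
    then have "sat N' p e" for e
      using bf_le_preserves(2)[OF a(2), of "[]" N e N' e] fv that(1) by simp
    then have "models N' p" by (simp add: models_def)
    then show ?thesis using scott_sentence_countable[OF a(3)] by blast
  qed
  then show thesis using that limit_osuc[OF assms(2) a(1)] by blast
qed


subsection \<open>Defining back-and-forth classes\<close>

text \<open>The class of \<open>(N, bs)\<close> with \<open>(M, as) \<le>\<^sub>\<alpha> (N, bs)\<close> is not \<open>\<Pi>\<^sub>\<alpha>\<close>-definable in general, because a
  formula for \<open>\<le>\<^sub>\<alpha>\<close> has two quantifier blocks per level; \<open>bf_rank\<close> counts these and stays below every
  limit ordinal above \<open>\<alpha>\<close>.\<close>

function bf_rank :: "omega1 \<Rightarrow> omega1" where
  "bf_rank a = (LEAST c. \<forall>b. b < a \<longrightarrow> osuc (bf_rank b) < c)"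
  by pat_completeness auto
termination by (relation "{(x, y). x < y}") (auto intro: wf)

declare bf_rank.simps [simp del]

lemma bf_rank_step: "b < a \<Longrightarrow> osuc (bf_rank b) < bf_rank a"
proof -
  assume "b < a"
  have "countable ((\<lambda>b. osuc (bf_rank b)) ` {..<a})" by (simp add: countable_lessThan_omega1)
  then have "\<exists>c. \<forall>b<a. osuc (bf_rank b) < c" using countable_bounded_omega1 by fastforce
  from LeastI_ex[OF this] have "\<forall>b<a. osuc (bf_rank b) < bf_rank a" unfolding bf_rank.simps[of a, symmetric] .
  then show ?thesis using \<open>b < a\<close> by blast
qed

lemma bf_rank_le: "(\<And>b. b < a \<Longrightarrow> osuc (bf_rank b) < c) \<Longrightarrow> bf_rank a \<le> c"
  by (subst bf_rank.simps[of a]) (simp add: Least_le)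

lemma bf_rank_limit: "limit_ordinal m \<Longrightarrow> a < m \<Longrightarrow> bf_rank a < m"
proof (induction a arbitrary: m rule: less_induct)
  case (less a)
  consider "a = 0" | b where "a = osuc b" | "limit_ordinal a"
  proof (cases "a = 0 \<or> limit_ordinal a")
    case False
    then have "0 < a" by (simp add: le_neq_trans)
    with False obtain b where "b < a" "\<not> osuc b < a" by (auto simp: limit_ordinal_def)
    then have "a = osuc b" by (simp add: antisym osuc_le_iff not_less)
    then show ?thesis using that by blast
  qed (use that in blast)
  then show ?case
  proof cases
    case 1
    have "bf_rank 0 \<le> 0" by (rule bf_rank_le) (use zero_le_omega1 not_le in blast)
    then show ?thesis using 1 less.prems(2) by (meson order_le_less_trans)
  next
    case (2 b)
    have b: "bf_rank b < m" using less.IH[of b] less.prems less_osuc[of b] 2 by force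
    have "bf_rank a \<le> osuc (osuc (bf_rank b))"
    proof (rule bf_rank_le)
      fix c assume "c < a"
      then have "c = b \<or> c < b" using 2 less_osuc_iff by (metis le_less)
      then show "osuc (bf_rank c) < osuc (osuc (bf_rank b))"
        by (metis bf_rank_step less_osuc order.strict_trans)
    qed
    then show ?thesis using limit_osuc[OF less.prems(1)] b by (meson order_le_less_trans)
  next
    case 3
    \<comment> \<open>The induction hypothesis is used with \<open>a\<close> in place of
      \<open>m\<close>; this is why \<open>m\<close> is generalised.\<close>
    have "bf_rank a \<le> a"
      by (rule bf_rank_le) (use less.IH 3 limit_osuc in blast)
    then show ?thesis using less.prems(2) by (meson order_le_less_trans)
  qed
qed

text \<open>The two directions go together because each is built from the other one at lower levels.
  Variable \<open>i\<close> stands for entry \<open>i\<close> of the tuple.\<close>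

definition bf_definable :: "omega1 \<Rightarrow> omega1 \<Rightarrow> 'a rstruct \<Rightarrow> 'a list \<Rightarrow> bool" where
  "bf_definable c a M as \<longleftrightarrow>
    (\<exists>p. pi_fm c p \<and> fv p \<subseteq> {..<length as} \<and>
       (\<forall>N e. sat N p e \<longleftrightarrow> bf_le a M as N (map e [0..<length as]))) \<and>
    (\<exists>p. pi_fm c p \<and> fv p \<subseteq> {..<length as} \<and>
       (\<forall>N e. sat N p e \<longleftrightarrow> bf_le a N (map e [0..<length as]) M as))"

lemma fv_foldr_And: "fv (foldr And ps Top) = (\<Union>p\<in>set ps. fv p)"
  and qfree_foldr_And: "qfree (foldr And ps Top) \<longleftrightarrow> (\<forall>p\<in>set ps. qfree p)"
  and sat_foldr_And: "sat M (foldr And ps Top) e \<longleftrightarrow> (\<forall>p\<in>set ps. sat M p e)"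
  by (induction ps) auto

lemma atomic_equiv_commute: "atomic_equiv M as N bs \<longleftrightarrow> atomic_equiv N bs M as"
  using atomic_equiv_sym by blast

lemma bf_definable_0: "bf_definable 0 0 M as"
proof -
  let ?n = "length as"
  define lit where "lit b p = (if b then p else Neg p)" for b p
  have lit: "sat N (lit b p) e \<longleftrightarrow> (b \<longleftrightarrow> sat N p e)" "fv (lit b p) = fv p" "qfree (lit b p) \<longleftrightarrow> qfree p"
    for N :: "'a rstruct" and b p e by (auto simp: lit_def)
  let ?ps = "concat (map (\<lambda>i. concat (map (\<lambda>j. [lit (as ! i = as ! j) (Eq i j),
     lit ((as ! i, as ! j) \<in> lt M) (Less i j)]) [0..<?n])) [0..<?n])"
  let ?p = "foldr And ?ps Top"
  have "qfree ?p" by (auto simp: qfree_foldr_And lit)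
  moreover have "fv ?p \<subseteq> {..<?n}" by (auto simp: fv_foldr_And lit)
  moreover have "sat N ?p e \<longleftrightarrow> atomic_equiv M as N (map e [0..<?n])" for N e
    unfolding sat_foldr_And atomic_equiv_def by (simp add: lit) (simp add: Ball_def)
  ultimately show ?thesis
    unfolding bf_definable_def bf_le_0 atomic_equiv_commute[of _ _ M as]
    by (intro conjI exI[of _ ?p]) (auto intro: pi_zero)
qed

lemma assignment_list:
  assumes "length ds = m"
  obtains e' where "map e' [n..<n + m] = ds" "\<forall>x. x \<notin> set [n..<n + m] \<longrightarrow> e' x = e x"
    "map e' [0..<n + m] = map e [0..<n] @ ds"
proof -
  define e' where "e' x = (if x \<in> set [n..<n + m] then ds ! (x - n) else e x)" for x
  have "map e' [n..<n + m] = ds" using assms by (auto simp: e'_def intro!: nth_equalityI)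
  moreover have "map e' [0..<n] = map e [0..<n]" by (auto simp: e'_def)
  moreover have "map e' [0..<n + m] = map e' [0..<n] @ map e' [n..<n + m]"
    by (metis map_append le_add1 upt_add_eq_append zero_le)
  ultimately show thesis using that[of e'] by (simp add: e'_def)
qed

text \<open>A quantifier over tuples of the fixed countable \<open>M\<close> becomes a countable
  conjunction or disjunction; one over tuples of \<open>N\<close> becomes a block of variables.
  \<open>P1\<close> lets every \<open>ds\<close> of \<open>N\<close> have a partner in
  \<open>M\<close>, \<open>P2\<close> lets every \<open>cs\<close> of \<open>M\<close> have a
  partner in \<open>N\<close>. The successor in the bound on \<open>c\<close> pays for the inner
  alternation.\<close>

lemma bf_definable_step:
  fixes M :: "'a::countable rstruct"
  assumes IH: "\<And>b as. b < a \<Longrightarrow> bf_definable (bf_rank b) b M as"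
    and a: "0 < a" and c: "\<And>b. b < a \<Longrightarrow> osuc (bf_rank b) < c"
  shows "bf_definable c a M as"
proof -
  let ?n = "length as"
  obtain p where p: "\<And>b bs. b < a \<Longrightarrow> pi_fm (bf_rank b) (p b bs) \<and> fv (p b bs) \<subseteq> {..<length bs} \<and>
       (\<forall>N e. sat N (p b bs) e \<longleftrightarrow> bf_le b M bs N (map e [0..<length bs]))"
    using IH unfolding bf_definable_def by metis
  obtain q where q: "\<And>b bs. b < a \<Longrightarrow> pi_fm (bf_rank b) (q b bs) \<and> fv (q b bs) \<subseteq> {..<length bs} \<and>
       (\<forall>N e. sat N (q b bs) e \<longleftrightarrow> bf_le b N (map e [0..<length bs]) M bs)"
    using IH unfolding bf_definable_def by metis
  define B where "B = from_nat_into {..<a}"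
  have "{..<a} \<noteq> {}" using a by auto
  then have B: "range B = {..<a}" unfolding B_def
    by (rule range_from_nat_into) (rule countable_lessThan_omega1)
  then have Ba: "B u < a" for u by auto
  have all_B: "(\<forall>b. b < a \<longrightarrow> X b) \<longleftrightarrow> (\<forall>u. X (B u))" for X
    using B Ba by (metis imageE lessThan_iff)
  have c0: "0 < c" using c[OF a] by (meson order_le_less_trans zero_le_omega1)
  \<comment> \<open>Numbers that do not code a tuple of \<open>M\<close> of length \<open>m\<close>
    contribute a false disjunct.\<close>
  define Q where "Q u m j = (let cs = from_nat j :: 'a list in
      if set cs \<subseteq> pts M \<and> length cs = m then q (B u) (as @ cs) else Neg Top)" for u m j
  define P1 where "P1 k = (case prod_decode k of (u, m) \<Rightarrow> 
      foldr All [?n..<?n + m] (Disj (\<lambda>j. foldr Ex [] (Q u m j))))" for k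
  have satQ: "(\<exists>j. sat N (Q u m j) e) \<longleftrightarrow> (\<exists>cs\<in>lists (pts M). length cs = m \<and> bf_le (B u) N (map e [0..<?n + m]) M (as @ cs))" for u m N e
  proof -
    have "(\<exists>j. sat N (Q u m j) e) \<longleftrightarrow> (\<exists>cs. set cs \<subseteq> pts M \<and> length cs = m \<and> sat N (q (B u) (as @ cs)) e)"
      unfolding Q_def Let_def
      by (auto split: if_splits) (metis from_nat_to_nat)
    also have "\<dots> \<longleftrightarrow> (\<exists>cs. set cs \<subseteq> pts M \<and> length cs = m \<and> bf_le (B u) N (map e [0..<?n + m]) M (as @ cs))"
      using q[OF Ba[of u]] by auto
    finally show ?thesis by (auto simp: in_lists_conv_set subset_iff)
  qed
  have sig: "sigma_fm (osuc (bf_rank (B u))) (Disj (\<lambda>j. foldr Ex [] (Q u m j)))" for u m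
  proof (rule sigma_step[where xs = "\<lambda>_. []"])
    show "0 < osuc (bf_rank (B u))" by (rule osuc_pos)
    fix j
    let ?cs = "from_nat j :: 'a list"
    \<comment> \<open>The classes are not cumulative: \<open>Neg Top\<close> has level 0 only, so
      the level drops to 0 wherever this default is taken.\<close>
    let ?b = "\<lambda>j. if set (from_nat j :: 'a list) \<subseteq> pts M \<and> length (from_nat j :: 'a list) = m then bf_rank (B u) else 0"
    show "?b j < osuc (bf_rank (B u))" by (simp add: less_osuc osuc_pos)
    show "pi_fm (?b j) (Q u m j)" using q[OF Ba[of u]] by (auto simp: Q_def Let_def intro: pi_zero)
  qed
  have pi1: "pi_fm c (Conj P1)"
  proof -
    have "P1 = (\<lambda>k. foldr All [?n..<?n + snd (prod_decode k)] 
       (Disj (\<lambda>j. foldr Ex [] (Q (fst (prod_decode k)) (snd (prod_decode k)) j))))"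
      unfolding P1_def by (auto split: prod.splits)
    then show ?thesis using pi_step[OF c0 c[OF Ba] sig] by simp
  qed
  have "fv (Q u m j) \<subseteq> {..<?n + m}" for u m j
    using q[OF Ba[of u], of "as @ from_nat j"] by (auto simp: Q_def Let_def)
  then have "fv (P1 k) \<subseteq> {..<?n}" for k
    by (cases "prod_decode k") (fastforce simp: P1_def)
  then have fv1: "fv (Conj P1) \<subseteq> {..<?n}" by auto
  have sat1: "sat N (Conj P1) e \<longleftrightarrow> bf_le a M as N (map e [0..<?n])" for N e
  proof -
    have "sat N (Conj P1) e \<longleftrightarrow> (\<forall>u m. sat N (foldr All [?n..<?n + m] (Disj (\<lambda>j. foldr Ex [] (Q u m j)))) e)"
    proof -
      have "(\<forall>k. X (prod_decode k)) \<longleftrightarrow> (\<forall>u m. X (u, m))" for X :: "nat \<times> nat \<Rightarrow> bool"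
        by (metis prod_encode_inverse surj_pair)
      from this[of "\<lambda>(u, m). sat N (foldr All [?n..<?n + m] (Disj (\<lambda>j. foldr Ex [] (Q u m j)))) e"]
      show ?thesis by (simp add: P1_def case_prod_beta)
    qed
    also have "\<dots> \<longleftrightarrow> (\<forall>u. \<forall>ds\<in>lists (pts N). \<exists>cs\<in>lists (pts M). length cs = length ds \<and>
        bf_le (B u) N (map e [0..<?n] @ ds) M (as @ cs))"
    proof (intro iffI allI ballI)
      fix u ds assume a1: "\<forall>u m. sat N (foldr All [?n..<?n + m] (Disj (\<lambda>j. foldr Ex [] (Q u m j)))) e"
        and ds: "ds \<in> lists (pts N)"
      obtain e' where e': "map e' [?n..<?n + length ds] = ds" "\<forall>x. x \<notin> set [?n..<?n + length ds] \<longrightarrow> e' x = e x"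
        "map e' [0..<?n + length ds] = map e [0..<?n] @ ds"
        using assignment_list[OF refl, of ?n ds e] by blast
      have "\<forall>x\<in>set [?n..<?n + length ds]. e' x \<in> pts N"
      proof
        fix x assume "x \<in> set [?n..<?n + length ds]"
        then have "e' x \<in> set (map e' [?n..<?n + length ds])" by simp
        then show "e' x \<in> pts N" unfolding e'(1) using ds by auto
      qed
      then have "\<exists>j. sat N (Q u (length ds) j) e'"
        using a1[rule_format, of "length ds" u] e'(2) unfolding sat_foldr_All by simp
      then show "\<exists>cs\<in>lists (pts M). length cs = length ds \<and> bf_le (B u) N (map e [0..<?n] @ ds) M (as @ cs)"
        unfolding satQ e'(3) .
    next
      fix u m assume a1: "\<forall>u. \<forall>ds\<in>lists (pts N). \<exists>cs\<in>lists (pts M). length cs = length ds \<and>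
        bf_le (B u) N (map e [0..<?n] @ ds) M (as @ cs)"
      have "\<exists>j. sat N (Q u m j) e'" if e': "\<forall>x\<in>set [?n..<?n + m]. e' x \<in> pts N"
        "\<forall>x. x \<notin> set [?n..<?n + m] \<longrightarrow> e' x = e x" for e'
      proof -
        have "map e' [?n..<?n + m] \<in> lists (pts N)" using e'(1) by auto
        moreover have "map e' [0..<?n + m] = map e [0..<?n] @ map e' [?n..<?n + m]"
        proof -
          have "map e' [0..<?n] = map e [0..<?n]" using e'(2) by auto
          then show ?thesis by (metis map_append le_add1 upt_add_eq_append zero_le)
        qed
        ultimately show ?thesis unfolding satQ using a1 by (metis diff_add_inverse length_map length_upt)
      qed
      then show "sat N (foldr All [?n..<?n + m] (Disj (\<lambda>j. foldr Ex [] (Q u m j)))) e"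
        unfolding sat_foldr_All by simp
    qed
    also have "\<dots> \<longleftrightarrow> bf_le a M as N (map e [0..<?n])"
      unfolding bf_le_pos[OF a] all_B ..
    finally show ?thesis .
  qed
  \<comment> \<open>The constant disjunction gives an existential block the outer shape of a
    \<Sigma>-formula.\<close>
  define R where "R u cs = Disj (\<lambda>_::nat. foldr Ex [?n..<?n + length cs] (p (B u) (as @ cs)))" for u cs
  define P2 where "P2 k = (case prod_decode k of (u, j) \<Rightarrow> let cs = from_nat j :: 'a list in
      if set cs \<subseteq> pts M then R u cs else Top)" for k
  have sigR: "sigma_fm (osuc (bf_rank (B u))) (R u cs)" for u cs
    unfolding R_def by (rule sigma_step[OF osuc_pos]) (use p[OF Ba[of u]] less_osuc in auto)
  have pi2: "pi_fm c (Conj (\<lambda>k. foldr All [] (P2 k)))"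
  proof (rule pi_step[OF c0])
    fix k
    let ?b = "\<lambda>k. if set (from_nat (snd (prod_decode k)) :: 'a list) \<subseteq> pts M then osuc (bf_rank (B (fst (prod_decode k)))) else 0"
    show "?b k < c" using c[OF Ba] c0 by simp
    show "sigma_fm (?b k) (P2 k)" using sigR
      by (auto simp: P2_def Let_def intro: sigma_zero split: prod.splits)
  qed
  have "fv (R u cs) \<subseteq> {..<?n}" for u cs
    using p[OF Ba[of u], of "as @ cs"] by (fastforce simp: R_def)
  then have "fv (P2 k) \<subseteq> {..<?n}" for k
    by (cases "prod_decode k") (simp add: P2_def Let_def)
  then have fv2: "fv (Conj (\<lambda>k. foldr All [] (P2 k))) \<subseteq> {..<?n}" by auto
  have sat2: "sat N (Conj (\<lambda>k. foldr All [] (P2 k))) e \<longleftrightarrow> bf_le a N (map e [0..<?n]) M as" for N e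
  proof -
    have "sat N (Conj (\<lambda>k. foldr All [] (P2 k))) e \<longleftrightarrow> (\<forall>u. \<forall>cs\<in>lists (pts M). sat N (R u cs) e)"
    proof -
      have "(\<forall>k. X (prod_decode k)) \<longleftrightarrow> (\<forall>u m. X (u, m))" for X :: "nat \<times> nat \<Rightarrow> bool"
        by (metis prod_encode_inverse surj_pair)
      from this[of "\<lambda>(u, j). let cs = from_nat j :: 'a list in set cs \<subseteq> pts M \<longrightarrow> sat N (R u cs) e"]
      have "sat N (Conj (\<lambda>k. foldr All [] (P2 k))) e \<longleftrightarrow>
          (\<forall>u j. set (from_nat j :: 'a list) \<subseteq> pts M \<longrightarrow> sat N (R u (from_nat j)) e)"
        by (simp add: P2_def case_prod_beta Let_def)
      also have "\<dots> \<longleftrightarrow> (\<forall>u cs. set cs \<subseteq> pts M \<longrightarrow> sat N (R u cs) e)" by (metis from_nat_to_nat)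
      finally show ?thesis by (auto simp: in_lists_conv_set subset_iff)
    qed
    also have "\<dots> \<longleftrightarrow> (\<forall>u. \<forall>cs\<in>lists (pts M). \<exists>ds\<in>lists (pts N). length ds = length cs \<and>
        bf_le (B u) M (as @ cs) N (map e [0..<?n] @ ds))"
    proof (intro iff_allI ball_cong refl)
      fix u cs
      have pq: "sat N (p (B u) (as @ cs)) e' \<longleftrightarrow> bf_le (B u) M (as @ cs) N (map e' [0..<?n + length cs])" for e'
        using p[OF Ba[of u], of "as @ cs"] by simp
      show "sat N (R u cs) e \<longleftrightarrow> (\<exists>ds\<in>lists (pts N). length ds = length cs \<and>
        bf_le (B u) M (as @ cs) N (map e [0..<?n] @ ds))"
      proof
        assume "sat N (R u cs) e"
        then obtain e' where e': "\<forall>x\<in>set [?n..<?n + length cs]. e' x \<in> pts N"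
          "\<forall>x. x \<notin> set [?n..<?n + length cs] \<longrightarrow> e' x = e x" "sat N (p (B u) (as @ cs)) e'"
          unfolding R_def by (auto simp: sat_foldr_Ex)
        have "map e' [?n..<?n + length cs] \<in> lists (pts N)" using e'(1) by auto
        moreover have "map e' [0..<?n + length cs] = map e [0..<?n] @ map e' [?n..<?n + length cs]"
        proof -
          have "map e' [0..<?n] = map e [0..<?n]" using e'(2) by auto
          then show ?thesis by (metis map_append le_add1 upt_add_eq_append zero_le)
        qed
        ultimately show "\<exists>ds\<in>lists (pts N). length ds = length cs \<and>
          bf_le (B u) M (as @ cs) N (map e [0..<?n] @ ds)"
          using e'(3) unfolding pq by (metis diff_add_inverse length_map length_upt)
      next
        assume "\<exists>ds\<in>lists (pts N). length ds = length cs \<and> bf_le (B u) M (as @ cs) N (map e [0..<?n] @ ds)"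
        then obtain ds where ds: "ds\<in>lists (pts N)" "length ds = length cs" 
          "bf_le (B u) M (as @ cs) N (map e [0..<?n] @ ds)" by blast
        obtain e' where e': "map e' [?n..<?n + length cs] = ds" "\<forall>x. x \<notin> set [?n..<?n + length cs] \<longrightarrow> e' x = e x"
          "map e' [0..<?n + length cs] = map e [0..<?n] @ ds"
          using assignment_list[OF ds(2), of ?n e] by blast
        have "\<forall>x\<in>set [?n..<?n + length cs]. e' x \<in> pts N"
        proof
          fix x assume "x \<in> set [?n..<?n + length cs]"
          then have "e' x \<in> set (map e' [?n..<?n + length cs])" by simp
          then show "e' x \<in> pts N" unfolding e'(1) using ds(1) by auto
        qed
        moreover have "sat N (p (B u) (as @ cs)) e'" unfolding pq e'(3) by (rule ds(3))
        ultimately show "sat N (R u cs) e" using e'(2) unfolding R_def sat.simps sat_foldr_Ex by blast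
      qed
    qed
    also have "\<dots> \<longleftrightarrow> bf_le a N (map e [0..<?n]) M as"
      unfolding bf_le_pos[OF a] all_B ..
    finally show ?thesis .
  qed
  show ?thesis unfolding bf_definable_def
    using pi1 fv1 sat1 pi2 fv2 sat2 by blast
qed

lemma bf_definable_rank:
  fixes M :: "'a::countable rstruct"
  shows "bf_definable (bf_rank a) a M as"
proof (induction a arbitrary: as rule: less_induct)
  case (less a)
  show ?case
  proof (cases "a = 0")
    case True
    have "bf_rank 0 \<le> 0" by (rule bf_rank_le) (use zero_le_omega1 not_le in blast)
    then have "bf_rank 0 = 0" by (simp add: antisym)
    then show ?thesis using True bf_definable_0 by simp
  next
    case False
    then have "0 < a" by (simp add: le_neq_trans)
    then show ?thesis using bf_definable_step less bf_rank_step by metis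
  qed
qed

text \<open>At a limit nothing is lost: \<open>bf_rank b\<close> and its successor stay below
  \<open>l\<close> for all \<open>b < l\<close>, so the step can be taken with
  \<open>c = l\<close>.\<close>

lemma bf_definable_limit:
  fixes M :: "'a::countable rstruct"
  assumes "limit_ordinal l"
  shows "bf_definable l l M as"
  by (rule bf_definable_step[OF bf_definable_rank limit_pos[OF assms]])
     (simp add: assms bf_rank_limit limit_osuc)


section \<open>Dense linear orders without least element\<close>

lemma linear_orderD:
  assumes "linear_order M"
  shows "(x, x) \<notin> lt M" "(x, y) \<in> lt M \<Longrightarrow> (y, z) \<in> lt M \<Longrightarrow> (x, z) \<in> lt M"
    "x \<in> pts M \<Longrightarrow> y \<in> pts M \<Longrightarrow> x \<noteq> y \<Longrightarrow> (x, y) \<in> lt M \<or> (y, x) \<in> lt M"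
    "(x, y) \<in> lt M \<Longrightarrow> x \<in> pts M \<and> y \<in> pts M"
  using assms unfolding linear_order_def strict_linear_order_on_def irrefl_def trans_def total_on_def
  by blast+

lemma linear_orderI:
  assumes "\<And>x. (x, x) \<notin> lt M" "\<And>x y z. (x, y) \<in> lt M \<Longrightarrow> (y, z) \<in> lt M \<Longrightarrow> (x, z) \<in> lt M"
    "\<And>x y. x \<in> pts M \<Longrightarrow> y \<in> pts M \<Longrightarrow> x \<noteq> y \<Longrightarrow> (x, y) \<in> lt M \<or> (y, x) \<in> lt M"
    "\<And>x y. (x, y) \<in> lt M \<Longrightarrow> x \<in> pts M \<and> y \<in> pts M"
  shows "linear_order M"
  using assms unfolding linear_order_def strict_linear_order_on_def irrefl_def trans_def total_on_def
  by (intro conjI subrelI; blast)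

lemma finite_linear_max:
  assumes "linear_order M" "finite A" "A \<noteq> {}" "A \<subseteq> pts M"
  shows "\<exists>m\<in>A. \<forall>x\<in>A. x = m \<or> (x, m) \<in> lt M"
  using assms(2-4)
proof (induction rule: finite_ne_induct)
  case (insert x F)
  then obtain m where m: "m \<in> F" "\<forall>x\<in>F. x = m \<or> (x, m) \<in> lt M" by auto
  then consider "(x, m) \<in> lt M" | "(m, x) \<in> lt M" | "x = m"
    using linear_orderD(3)[OF assms(1), of x m] insert.prems by auto
  then show ?case
  proof cases
    case 1
    then show ?thesis using m by (intro bexI[of _ m]) auto
  next
    case 2
    then show ?thesis using m linear_orderD(2)[OF assms(1), of _ m x]
      by (intro bexI[of _ x]) auto
  qed (use m in auto)
qed simp

lemma finite_linear_min:
  assumes "linear_order M" "finite A" "A \<noteq> {}" "A \<subseteq> pts M"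
  shows "\<exists>m\<in>A. \<forall>x\<in>A. x = m \<or> (m, x) \<in> lt M"
  using assms(2-4)
proof (induction rule: finite_ne_induct)
  case (insert x F)
  then obtain m where m: "m \<in> F" "\<forall>x\<in>F. x = m \<or> (m, x) \<in> lt M" by auto
  then consider "(x, m) \<in> lt M" | "(m, x) \<in> lt M" | "x = m"
    using linear_orderD(3)[OF assms(1), of x m] insert.prems by auto
  then show ?case
  proof cases
    case 2
    then show ?thesis using m by (intro bexI[of _ m]) auto
  next
    case 1
    then show ?thesis using m linear_orderD(2)[OF assms(1), of x m _]
      by (intro bexI[of _ x]) auto
  qed (use m in auto)
qed simp

definition is_max :: "'a rstruct \<Rightarrow> 'a \<Rightarrow> bool" where
  "is_max M m \<longleftrightarrow> m \<in> pts M \<and> (\<forall>x\<in>pts M. (m, x) \<notin> lt M)"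

text \<open>The shape forced on every \<open>L c\<close> if \<open>K\<close> were empty; whether the
  order is empty and whether it has a greatest point remain free.\<close>

definition dense_no_min :: "'a rstruct \<Rightarrow> bool" where
  "dense_no_min M \<longleftrightarrow> linear_order M \<and> (\<forall>y\<in>pts M. \<exists>x\<in>pts M. (x, y) \<in> lt M) \<and>
     (\<forall>x y. (x, y) \<in> lt M \<longrightarrow> (\<exists>z\<in>pts M. (x, z) \<in> lt M \<and> (z, y) \<in> lt M))"

text \<open>Atomic equivalence alone is no invariant of the game: an entry that is greatest on one
  side only could not be continued. So the positions also record which entries are greatest.\<close>

definition max_coherent :: "'a rstruct \<Rightarrow> 'a list \<Rightarrow> 'a rstruct \<Rightarrow> 'a list \<Rightarrow> bool" where
  "max_coherent M as N bs \<longleftrightarrow> set as \<subseteq> pts M \<and> set bs \<subseteq> pts N \<and> atomic_equiv M as N bs \<and>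
     (\<forall>i<length as. is_max M (as ! i) \<longleftrightarrow> is_max N (bs ! i))"

lemma atomic_equiv_snoc:
  assumes "linear_order M" "linear_order N" "atomic_equiv M as N bs"
    and "\<forall>i<length as. as ! i \<noteq> c \<and> bs ! i \<noteq> d \<and> ((as ! i, c) \<in> lt M \<longleftrightarrow> (bs ! i, d) \<in> lt N) \<and>
       ((c, as ! i) \<in> lt M \<longleftrightarrow> (d, bs ! i) \<in> lt N)"
  shows "atomic_equiv M (as @ [c]) N (bs @ [d])"
proof -
  have irr: "(c, c) \<notin> lt M" "(d, d) \<notin> lt N"
    using assms(1,2) by (simp_all add: linear_orderD(1))
  show ?thesis using assms(3,4) irr
    unfolding atomic_equiv_def by (auto simp: nth_append less_Suc_eq)
qed

text \<open>Cantor's argument for the rationals, with a greatest point answered by a greatest point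
  and any other point by one that is not greatest, which keeps room above it.\<close>

lemma max_coherent_extend:
  assumes D: "dense_no_min M" "dense_no_min N"
    and ne: "pts M \<noteq> {}" and mx: "(\<exists>m. is_max N m) \<Longrightarrow> (\<exists>m. is_max M m)"
    and co: "max_coherent M as N bs" and d: "d \<in> pts N"
  shows "\<exists>c. max_coherent M (as @ [c]) N (bs @ [d])"
proof -
  have lM: "linear_order M" and lN: "linear_order N" using D by (auto simp: dense_no_min_def)
  note M = linear_orderD[OF lM] and N = linear_orderD[OF lN]
  have no_min: "\<exists>x\<in>pts M. (x, y) \<in> lt M" if "y \<in> pts M" for y using D that by (auto simp: dense_no_min_def)
  have dense: "\<exists>z\<in>pts M. (x, z) \<in> lt M \<and> (z, y) \<in> lt M" if "(x, y) \<in> lt M" for x y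
    using D that by (auto simp: dense_no_min_def)
  have as: "set as \<subseteq> pts M" "set bs \<subseteq> pts N" and at: "atomic_equiv M as N bs"
    and cm: "\<forall>i<length as. is_max M (as ! i) \<longleftrightarrow> is_max N (bs ! i)"
    using co by (auto simp: max_coherent_def)
  have len: "length as = length bs" using at by (simp add: atomic_equiv_def)
  have asp: "as ! i \<in> pts M" "bs ! i \<in> pts N" if "i < length as" for i using as that len by auto
  show ?thesis
  proof (cases "d \<in> set bs")
    case True
    then obtain k where k: "k < length as" "bs ! k = d" using len by (auto simp: in_set_conv_nth)
    have "atomic_equiv M (as @ [as ! k]) N (bs @ [d])"
      using atomic_equiv_reindex[OF at, of "[0..<length as] @ [k]"] k len map_nth[of as] map_nth[of bs] by (simp add: lessThan_atLeast0)
    then have "max_coherent M (as @ [as ! k]) N (bs @ [d])"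
      using as d asp k cm len unfolding max_coherent_def by (auto simp: nth_append less_Suc_eq)
    then show ?thesis by blast
  next
    case nin: False
    have key: "\<exists>c. max_coherent M (as @ [c]) N (bs @ [d])" 
      if c: "c \<in> pts M" "is_max M c \<longleftrightarrow> is_max N d"
        and lt: "\<And>i. i < length as \<Longrightarrow> (bs ! i, d) \<in> lt N \<Longrightarrow> (as ! i, c) \<in> lt M"
        and gt: "\<And>i. i < length as \<Longrightarrow> (d, bs ! i) \<in> lt N \<Longrightarrow> (c, as ! i) \<in> lt M" for c
    proof -
      have "as ! i \<noteq> c \<and> bs ! i \<noteq> d \<and> ((as ! i, c) \<in> lt M \<longleftrightarrow> (bs ! i, d) \<in> lt N) \<and>
        ((c, as ! i) \<in> lt M \<longleftrightarrow> (d, bs ! i) \<in> lt N)" if i: "i < length as" for i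
      proof -
        have "bs ! i \<noteq> d" using nin i len by auto
        then have "(bs ! i, d) \<in> lt N \<or> (d, bs ! i) \<in> lt N" using N(3) asp[OF i] d by blast
        then show ?thesis using lt[OF i] gt[OF i] \<open>bs ! i \<noteq> d\<close> M(1,2) N(1,2) by blast
      qed
      then have "atomic_equiv M (as @ [c]) N (bs @ [d])"
        using atomic_equiv_snoc[OF lM lN at] by blast
      then show ?thesis using as c d cm len unfolding max_coherent_def
        by (intro exI[of _ c]) (auto simp: nth_append less_Suc_eq)
    qed
    show ?thesis
    proof (cases "is_max N d")
      case True
      then obtain c where c: "is_max M c" using mx by auto
      have ncm: "\<not> is_max M (as ! i)" if "i < length as" for i
      proof
        assume "is_max M (as ! i)"
        then have "is_max N (bs ! i)" using cm that by blast
        then have "bs ! i = d" using True N(3) by (auto simp: is_max_def)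
        then show False using nin that len by auto
      qed
      show ?thesis
      proof (rule key)
        show "c \<in> pts M" using c by (simp add: is_max_def)
        show "is_max M c \<longleftrightarrow> is_max N d" using c True by simp
        fix i assume i: "i < length as"
        show "(as ! i, c) \<in> lt M"
          using M(3)[of "as ! i" c] asp[OF i] c ncm[OF i] by (auto simp: is_max_def)
        show "(c, as ! i) \<in> lt M" if "(d, bs ! i) \<in> lt N" 
          using that True asp[OF i] by (auto simp: is_max_def)
      qed
    next
      case nmax: False
      define A where "A = {as ! i | i. i < length as \<and> (bs ! i, d) \<in> lt N}"
      define B where "B = {as ! i | i. i < length as \<and> (d, bs ! i) \<in> lt N}"
      have fin: "finite A" "finite B" by (auto simp: A_def B_def)
      have sub: "A \<subseteq> pts M" "B \<subseteq> pts M" using asp by (auto simp: A_def B_def)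
      have AB: "(x, y) \<in> lt M" if xy: "x \<in> A" "y \<in> B" for x y
        
      proof -
        obtain i i' where i: "i < length as" "x = as ! i" "(bs ! i, d) \<in> lt N"
          "i' < length as" "y = as ! i'" "(d, bs ! i') \<in> lt N" using xy by (auto simp: A_def B_def)
        then show ?thesis using N(2)[OF i(3,6)] atomic_nth(2)[OF at i(1,4)] by simp
      qed
      have "\<exists>c\<in>pts M. \<not> is_max M c \<and> (\<forall>x\<in>A. (x, c) \<in> lt M) \<and> (\<forall>x\<in>B. (c, x) \<in> lt M)"
      proof (cases "B = {}")
        case False
        then obtain b where b: "b \<in> B" "\<forall>x\<in>B. x = b \<or> (b, x) \<in> lt M"
          using finite_linear_min[OF lM fin(2) _ sub(2)] by meson
        have bp: "b \<in> pts M" using b sub by blast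
        have "\<exists>c\<in>pts M. (c, b) \<in> lt M \<and> (\<forall>x\<in>A. (x, c) \<in> lt M)"
        proof (cases "A = {}")
          case True
          then show ?thesis using no_min[OF bp] by blast
        next
          case False
          then obtain a where a: "a \<in> A" "\<forall>x\<in>A. x = a \<or> (x, a) \<in> lt M"
            using finite_linear_max[OF lM fin(1) _ sub(1)] by meson
          obtain c where "c \<in> pts M" "(a, c) \<in> lt M" "(c, b) \<in> lt M"
            using dense AB[OF a(1) b(1)] by blast
          then show ?thesis using a(2) M(2)[of _ a c] by (intro bexI[of _ c]) auto
        qed
        then obtain c where c: "c \<in> pts M" "(c, b) \<in> lt M" "\<forall>x\<in>A. (x, c) \<in> lt M" by blast
        moreover have "\<not> is_max M c" using c bp by (auto simp: is_max_def)
        moreover have "\<forall>x\<in>B. (c, x) \<in> lt M" using c(2) b(2) M(2)[of c b] by auto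
        ultimately show ?thesis by blast
      next
        case emp: True
        show ?thesis
        proof (cases "A = {}")
          case True
          obtain x where "x \<in> pts M" using ne by auto
          then obtain c where "c \<in> pts M" "(c, x) \<in> lt M" using no_min by blast
          then have "c \<in> pts M" "\<not> is_max M c" using \<open>x \<in> pts M\<close> by (auto simp: is_max_def)
          then show ?thesis unfolding emp True by blast
        next
          case False
          then obtain a where a: "a \<in> A" "\<forall>x\<in>A. x = a \<or> (x, a) \<in> lt M"
            using finite_linear_max[OF lM fin(1) _ sub(1)] by meson
          then obtain i where i: "i < length as" "a = as ! i" "(bs ! i, d) \<in> lt N" by (auto simp: A_def)
          \<comment> \<open>\<open>d\<close> lies above the partner of \<open>a\<close>, so neither
            this partner nor \<open>a\<close> is greatest, and there is room above
            \<open>a\<close>.\<close>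
          then have "\<not> is_max N (bs ! i)" using d by (auto simp: is_max_def)
          then have "\<not> is_max M a" using i cm by blast
          then obtain y where "y \<in> pts M" "(a, y) \<in> lt M" using asp i by (auto simp: is_max_def)
          then obtain c where c: "c \<in> pts M" "(a, c) \<in> lt M" "(c, y) \<in> lt M" using dense by blast
          then have "\<not> is_max M c" using \<open>y \<in> pts M\<close> by (auto simp: is_max_def)
          moreover have "\<forall>x\<in>A. (x, c) \<in> lt M" using a(2) c M(2)[of _ a c] by auto
          ultimately show ?thesis unfolding emp using c(1) by blast
        qed
      qed
      then obtain c where c: "c \<in> pts M" "\<not> is_max M c" "\<forall>x\<in>A. (x, c) \<in> lt M" "\<forall>x\<in>B. (c, x) \<in> lt M"
        by blast
      show ?thesis by (rule key[of c]) (use c nmax in \<open>auto simp: A_def B_def\<close>)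
    qed
  qed
qed

lemma max_coherent_sym: "max_coherent M as N bs \<Longrightarrow> max_coherent N bs M as"
  by (auto simp: max_coherent_def atomic_equiv_sym) (auto simp: atomic_equiv_def)

lemma max_coherent_extends:
  assumes D: "dense_no_min M" "dense_no_min N"
    and ne: "pts M \<noteq> {}" and mx: "(\<exists>m. is_max N m) \<Longrightarrow> (\<exists>m. is_max M m)"
  shows "max_coherent M as N bs \<Longrightarrow> set ds \<subseteq> pts N \<Longrightarrow>
    \<exists>cs. length cs = length ds \<and> max_coherent M (as @ cs) N (bs @ ds)"
proof (induction ds arbitrary: as bs)
  case (Cons d ds)
  obtain c where "max_coherent M (as @ [c]) N (bs @ [d])"
    using max_coherent_extend[OF D ne mx Cons.prems(1)] Cons.prems(2) by auto
  from Cons.IH[OF this] obtain cs where "length cs = length ds"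
    "max_coherent M ((as @ [c]) @ cs) N ((bs @ [d]) @ ds)" using Cons.prems(2) by auto
  then show ?case by (intro exI[of _ "c # cs"]) simp
qed auto

lemma max_coherent_bf_le:
  assumes "dense_no_min M" "dense_no_min N" "pts M \<noteq> {}" "pts N \<noteq> {}"
    "(\<exists>m. is_max M m) \<longleftrightarrow> (\<exists>m. is_max N m)" "max_coherent M as N bs"
  shows "bf_le a M as N bs"
  using assms
proof (induction a arbitrary: M as N bs rule: less_induct)
  case (less a)
  show ?case
  proof (cases "a = 0")
    case True
    then show ?thesis using less.prems(6) by (simp add: bf_le_0 max_coherent_def)
  next
    case False
    then have "0 < a" by (simp add: le_neq_trans)
    then show ?thesis
    proof (rule bf_leI)
      fix b ds assume b: "b < a" and ds: "set ds \<subseteq> pts N"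
      obtain cs where cs: "length cs = length ds" "max_coherent M (as @ cs) N (bs @ ds)"
        using max_coherent_extends[OF less.prems(1,2,3) _ less.prems(6) ds] less.prems(5) by blast
      have "bf_le b N (bs @ ds) M (as @ cs)"
        by (rule less.IH[OF b less.prems(2,1,4,3)]) (use less.prems(5) cs(2) max_coherent_sym in auto)
      then show "\<exists>cs. set cs \<subseteq> pts M \<and> length cs = length ds \<and> bf_le b N (bs @ ds) M (as @ cs)"
        using cs by (auto simp: max_coherent_def)
    qed
  qed
qed

text \<open>Having a greatest point is an \<exists>\<forall> property, so two extensions detect
  it.\<close>

lemma bf_le_is_max:
  assumes "bf_le a N [] M []" "c < b" "b < a" "0 < c" "is_max M m"
  shows "(\<exists>m. is_max N m)"
proof -
  have "set [m] \<subseteq> pts M" using assms(5) by (simp add: is_max_def)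
  from bf_le_ext[OF assms(1,3) this] obtain ns where ns: "set ns \<subseteq> pts N" "length ns = length [m]"
    "bf_le b M ([] @ [m]) N ([] @ ns)" by blast
  then obtain n where n: "ns = [n]" by (auto simp: length_Suc_conv)
  have "(n, x) \<notin> lt N" if "x \<in> pts N" for x
  proof
    assume nx: "(n, x) \<in> lt N"
    have "set [x] \<subseteq> pts N" using that by simp
    from bf_le_ext[OF ns(3) assms(2) this] obtain ys where ys: "set ys \<subseteq> pts M" "length ys = length [x]"
      "bf_le c N (([] @ ns) @ [x]) M (([] @ [m]) @ ys)" by blast
    then obtain y where y: "ys = [y]" by (auto simp: length_Suc_conv)
    have "(m, y) \<in> lt M"
      using atomic_nth(2)[OF bf_le_atomic[OF ys(3)], of 0 1] nx n y by simp
    then show False using assms(5) ys(1) y by (auto simp: is_max_def)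
  qed
  then show ?thesis using ns(1) n by (auto simp: is_max_def)
qed

text \<open>Two levels below \<open>d\<close> are enough to compare emptiness and the existence of a
  greatest point, and these two facts determine such an order up to every level.\<close>

lemma bf_equiv_dense_no_min:
  assumes "dense_no_min M" "dense_no_min N" "bf_equiv d M N" "0 < c" "c < b" "b < d"
  shows "bf_equiv a M N"
proof (cases "pts M = {} \<or> pts N = {}")
  case True
  have "(pts M = {}) = (pts N = {})"
  proof -
    have "pts Y \<noteq> {}" if XY: "bf_le d Y [] X []" "pts X \<noteq> {}" for X Y :: "'a rstruct"
    proof -
      obtain x where "set [x] \<subseteq> pts X" using XY(2) by auto
      from bf_le_ext[OF XY(1) assms(6) this] show ?thesis by (metis length_0_conv list.distinct(1) set_empty subset_empty)
    qed
    then show ?thesis using assms(3) unfolding bf_equiv_def by blast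
  qed
  then have "M \<cong>\<^sub>s N" using True by (auto simp: isomorphic_def)
  then show ?thesis by (rule iso_bf_equiv)
next
  case False
  have "(\<exists>m. is_max M m) \<longleftrightarrow> (\<exists>m. is_max N m)"
    using assms(3) bf_le_is_max assms(4-6) unfolding bf_equiv_def by metis
  moreover have "max_coherent M [] N []" "max_coherent N [] M []" by (auto simp: max_coherent_def atomic_equiv_def)
  ultimately show ?thesis
    using False assms(1,2) unfolding bf_equiv_def by (auto intro!: max_coherent_bf_le)
qed


section \<open>Mixed sums\<close>

type_synonym pt = "int \<times> nat \<times> nat"

text \<open>A point \<open>(k, r, z)\<close> lies in summand \<open>r\<close> of the
  \<open>k\<close>-th group: 0 and 2 are the single points, 1 is the copy of \<open>L\<close>, 3 is
  the copy of \<open>K\<close>.\<close>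

definition cell :: "pt \<Rightarrow> int \<times> nat" where
  "cell x = (fst x, fst (snd x))"

definition cell_less :: "int \<times> nat \<Rightarrow> int \<times> nat \<Rightarrow> bool" where
  "cell_less i j \<longleftrightarrow> fst i < fst j \<or> fst i = fst j \<and> snd i < snd j"

text \<open>The one-point summands \<open>lpt k\<close> and \<open>rpt k\<close> enclose the \<open>k\<close>-th copy of \<open>L\<^bsub>f(k)\<^esub>\<close>.\<close>

definition lpt :: "int \<Rightarrow> pt" where "lpt k = (k, 0, 0)"
definition rpt :: "int \<Rightarrow> pt" where "rpt k = (k, 2, 0)"

lemma cell_simps [simp]: "cell (k, r, z) = (k, r)" "cell (lpt k) = (k, 0)" "cell (rpt k) = (k, 2)"
  by (auto simp: cell_def lpt_def rpt_def)

lemma cell_less_simps [simp]: "cell_less (k, r) (k', r') \<longleftrightarrow> k < k' \<or> k = k' \<and> r < r'"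
  by (simp add: cell_less_def)

lemma linear_order_single: "linear_order single"
  by (auto simp: linear_order_def single_def strict_linear_order_on_def irrefl_def total_on_def trans_def)

lemma pts_single [simp]: "pts single = {0}" and lt_single [simp]: "lt single = {}"
  by (auto simp: single_def)

locale mixable =
  fixes l :: omega1 and \<delta> :: "nat \<Rightarrow> omega1"
    and L :: "nat \<Rightarrow> nat rstruct" and K Linf :: "nat rstruct"
  assumes limit: "limit_ordinal l" and mixable: "mixable_along l \<delta> L K"
begin

lemma strict_mono_delta: "strict_mono \<delta>" and delta_less: "\<delta> i < l"
  and delta_cofinal: "a < l \<Longrightarrow> \<exists>i. a < \<delta> i"
  and linear_K: "linear_order K" and linear_L: "linear_order (L n)"
  and SR_K: "SR_less K l" and SR_L: "SR_less (L n) l"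
  and equiv_Suc: "bf_equiv (\<delta> n) (L n) (L (Suc n))"
  and not_equiv_Suc: "\<not> bf_equiv (\<delta> (Suc n)) (L n) (L (Suc n))"
  and K_only: "K_only_in_K_blocks L K"
  using mixable by (auto simp: mixable_along_def fundamental_sequence_def)

section \<open>Equivalence and isomorphism of the summands\<close>

lemma delta_mono: "m \<le> n \<Longrightarrow> \<delta> m \<le> \<delta> n"
  using strict_mono_delta by (simp add: strict_mono_less_eq)

lemma delta_0: "0 < \<delta> 0"
  using mixable by (auto simp: mixable_along_def le_neq_trans)

lemma delta_strict: "m < n \<Longrightarrow> \<delta> m < \<delta> n"
  using strict_mono_delta by (simp add: strict_mono_less)

lemma L_equiv_le: "m \<le> i \<Longrightarrow> bf_equiv (\<delta> m) (L m) (L i)"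
proof (induction i rule: dec_induct)
  case base
  show ?case by (simp add: bf_equiv_def bf_le_refl)
next
  case (step n)
  show ?case by (rule bf_equiv_trans[OF step.IH bf_equiv_mono[OF equiv_Suc delta_mono[OF step.hyps(1)]]])
qed

lemma L_equiv: "m \<le> i \<Longrightarrow> m \<le> j \<Longrightarrow> bf_equiv (\<delta> m) (L i) (L j)"
  by (rule bf_equiv_trans[OF bf_equiv_sym[OF L_equiv_le] L_equiv_le])

definition block :: "enat \<Rightarrow> nat rstruct" where
  "block a = (case a of enat k \<Rightarrow> L k | \<infinity> \<Rightarrow> Linf)"

lemma block_simps [simp]: "block (enat k) = L k" "block \<infinity> = Linf"
  by (auto simp: block_def)

text \<open>The hypothesis on \<open>f\<close> and \<open>Linf\<close>, for one value. In the locale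
  \<open>Linf\<close> is arbitrary, so the value \<infinity> is meaningful only if
  \<open>Linf\<close> is the unique limit structure.\<close>

definition admissible :: "enat \<Rightarrow> bool" where
  "admissible a \<longleftrightarrow> a \<noteq> \<infinity> \<or> unique_limit_structure \<delta> L Linf"

lemma admissible_enat [simp]: "admissible (enat k)" by (simp add: admissible_def)

lemma linear_block: "admissible a \<Longrightarrow> linear_order (block a)"
  by (cases a) (auto simp: linear_L admissible_def unique_limit_structure_def limit_structure_def)

lemma block_equiv_L: 
  assumes "admissible a" "enat m \<le> a" "m \<le> i"
  shows "bf_equiv (\<delta> m) (block a) (L i)"
proof (cases a)
  case (enat k)
  then show ?thesis using assms L_equiv by simp
next
  case infinity
  then have "limit_structure \<delta> L Linf" using assms by (auto simp: admissible_def unique_limit_structure_def)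
  then obtain j where "j \<ge> m" "bf_equiv (\<delta> m) Linf (L j)" unfolding limit_structure_def by blast
  then show ?thesis using infinity bf_equiv_trans[OF _ L_equiv[of m j i]] assms by simp
qed

lemma min_enat_cases: "min (enat m) a = min (enat m) b \<Longrightarrow> a = b \<or> enat m \<le> a \<and> enat m \<le> b"
  by (auto simp: min_def split: if_splits)

text \<open>Different values with equal truncations at \<open>m\<close> are both at least
  \<open>m\<close>, and all such blocks are equivalent to \<open>L m\<close> at level
  \<open>\<delta> m\<close>.\<close>

lemma block_equiv:
  assumes "admissible a" "admissible b" "min (enat m) a = min (enat m) b"
  shows "bf_equiv (\<delta> m) (block a) (block b)"
  using min_enat_cases[OF assms(3)]
proof
  assume "enat m \<le> a \<and> enat m \<le> b"
  then show ?thesis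
    using bf_equiv_trans[OF block_equiv_L[OF assms(1), of m m] bf_equiv_sym[OF block_equiv_L[OF assms(2), of m m]]]
    by simp
qed (simp add: bf_equiv_def bf_le_refl)

text \<open>For a finite \<open>a = i\<close> below \<open>b\<close>, the block of \<open>b\<close>
  is equivalent to \<open>L (Suc i)\<close> at level \<open>\<delta> (Suc i)\<close>, whereas
  \<open>L i\<close> is not.\<close>

lemma block_not_iso_less: "admissible b \<Longrightarrow> a < b \<Longrightarrow> \<not> block a \<cong>\<^sub>s block b"
proof
  assume b: "admissible b" "a < b" "block a \<cong>\<^sub>s block b"
  then obtain i where i: "a = enat i" by (cases a) auto
  then have "enat (Suc i) \<le> b" using b(2) by (simp add: Suc_ile_eq)
  then have "bf_equiv (\<delta> (Suc i)) (block b) (L (Suc i))" using block_equiv_L[OF b(1)] by blast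
  then have "bf_equiv (\<delta> (Suc i)) (L i) (L (Suc i))"
    using bf_equiv_trans[OF iso_bf_equiv[OF b(3)]] i by simp
  then show False using not_equiv_Suc by blast
qed

lemma block_iso_eq: "admissible a \<Longrightarrow> admissible b \<Longrightarrow> block a \<cong>\<^sub>s block b \<Longrightarrow> a = b"
  using block_not_iso_less iso_sym by (metis linorder_neqE)

text \<open>If \<open>K\<close> is empty, condition (5) for \<open>1 + L\<^sub>c\<close> says that \<open>1 + L\<^sub>c\<close> has no adjacent points. Such \<open>L\<^sub>c\<close>
  that agree on being empty and on having a greatest element are equivalent at all levels, contrary
  to condition (4).\<close>

lemma pts_K: "pts K \<noteq> {}"
proof
  assume K: "pts K = {}"
  have dense: "dense_no_min (L c)" for c
  proof -
    let ?S = "alternating_sum L K [] c"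
    have pS: "pts ?S = {(0, 0)} \<union> {1} \<times> pts (L c)"
      by (auto simp: alternating_sum_def list_sum_def ord_sum_def less_Suc_eq)
    have lS: "((i, x), (j, y)) \<in> lt ?S \<longleftrightarrow> (i, x) \<in> pts ?S \<and> (j, y) \<in> pts ?S \<and> 
        (i < j \<or> i = 1 \<and> j = 1 \<and> (x, y) \<in> lt (L c))" for i x j y
      unfolding pS by (auto simp: alternating_sum_def list_sum_def ord_sum_def less_Suc_eq)
    have ne: "pts (interval ?S x y) \<noteq> {}" if xy: "(x, y) \<in> lt ?S" for x y
    proof
      assume "pts (interval ?S x y) = {}"
      then have "interval ?S x y \<cong>\<^sub>s K" using K by (simp add: isomorphic_def bij_betw_def)
      moreover have "x \<in> pts ?S" "y \<in> pts ?S" using xy lS by (cases x; cases y; auto)+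
      ultimately have "\<exists>j<length ([]::nat list). pts (interval ?S x y) \<subseteq> {4 * j + 3} \<times> pts K"
        using K_only xy unfolding K_only_in_K_blocks_def Let_def by blast
      then show False by simp
    qed
    have "\<exists>x\<in>pts (L c). (x, y) \<in> lt (L c)" if "y \<in> pts (L c)" for y
    proof -
      have "((0, 0), (1, y)) \<in> lt ?S" using that lS pS by simp
      from ne[OF this] obtain j z where z: "(j, z) \<in> pts (interval ?S (0, 0) (1, y))" by auto
      have "((0, 0), (j, z)) \<in> lt ?S" "((j, z), (1, y)) \<in> lt ?S" "(j, z) \<in> pts ?S"
        using z by (auto simp: pts_interval)
      then show ?thesis unfolding lS pS by auto
    qed
    moreover have "\<exists>z\<in>pts (L c). (x, z) \<in> lt (L c) \<and> (z, y) \<in> lt (L c)" if xy: "(x, y) \<in> lt (L c)" for x y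
    proof -
      have "((1, x), (1, y)) \<in> lt ?S" using linear_orderD(4)[OF linear_L xy] lS pS xy by simp
      from ne[OF this] obtain j z where z: "(j, z) \<in> pts (interval ?S (1, x) (1, y))" by auto
      have "((1, x), (j, z)) \<in> lt ?S" "((j, z), (1, y)) \<in> lt ?S" "(j, z) \<in> pts ?S"
        using z by (auto simp: pts_interval)
      then show ?thesis unfolding lS pS by auto
    qed
    ultimately show ?thesis by (simp add: dense_no_min_def linear_L)
  qed
  \<comment> \<open>Index 2 leaves the two positive levels \<open>\<delta> 0 < \<delta> 1\<close>
    below \<open>\<delta> 2\<close>.\<close>
  have "bf_equiv (\<delta> (Suc 2)) (L 2) (L (Suc 2))"
    by (rule bf_equiv_dense_no_min[OF dense dense equiv_Suc delta_0, where b = "\<delta> 1"]) (auto intro: delta_strict)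
  then show False using not_equiv_Suc by blast
qed


subsection \<open>The cells of a mixed sum\<close>

definition mixed :: "(int \<Rightarrow> enat) \<Rightarrow> pt rstruct" where
  "mixed f = mixed_sum L K Linf f"

text \<open>For \<open>r\<close> above 3 the value \<open>single\<close> is a mere default;
  \<open>pts_mixed\<close> therefore carries the bound on \<open>r\<close> separately.\<close>

definition cell_struct :: "(int \<Rightarrow> enat) \<Rightarrow> int \<Rightarrow> nat \<Rightarrow> nat rstruct" where
  "cell_struct f k r = (if r = 1 then block (f k) else if r = 3 then K else single)"

lemma cell_struct_simps [simp]: "cell_struct f k 0 = single" "cell_struct f k (Suc 0) = block (f k)"
  "cell_struct f k 2 = single" "cell_struct f k 3 = K"
  by (auto simp: cell_struct_def)

lemma nth_cells: "r < 4 \<Longrightarrow> [single, block (f k), single, K] ! r = cell_struct f k r"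
  by (auto simp: less_Suc_eq numeral_eq_Suc cell_struct_def)

lemma pts_mixed: "(k, r, z) \<in> pts (mixed f) \<longleftrightarrow> r < 4 \<and> z \<in> pts (cell_struct f k r)"
  unfolding mixed_def mixed_sum_def block_def[symmetric] using nth_cells[of r f k]
  by (auto simp: ord_sum_def list_sum_def)

lemma lt_mixed: "((k, r, z), (k', r', z')) \<in> lt (mixed f) \<longleftrightarrow> (k, r, z) \<in> pts (mixed f) \<and> (k', r', z') \<in> pts (mixed f) \<and>
    (cell_less (k, r) (k', r') \<or> k = k' \<and> r = r' \<and> (z, z') \<in> lt (cell_struct f k r))"
  unfolding pts_mixed unfolding mixed_def mixed_sum_def block_def[symmetric] using nth_cells[of r f k] nth_cells[of r' f k']
  by (auto simp: ord_sum_def list_sum_def)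

lemma lpt_in [simp]: "lpt k \<in> pts (mixed f)" and rpt_in [simp]: "rpt k \<in> pts (mixed f)"
  by (simp_all add: lpt_def rpt_def pts_mixed)

lemma lpt_iff: "x \<in> pts (mixed f) \<Longrightarrow> cell x = (k, 0) \<longleftrightarrow> x = lpt k"
  by (cases x) (auto simp: lpt_def pts_mixed)

lemma rpt_iff: "x \<in> pts (mixed f) \<Longrightarrow> cell x = (k, 2) \<longleftrightarrow> x = rpt k"
  by (cases x) (auto simp: rpt_def pts_mixed)

lemma cell_bound: "x \<in> pts (mixed f) \<Longrightarrow> snd (cell x) < 4"
  by (cases x) (auto simp: pts_mixed)

lemma layered_mixed: "layered cell cell_less (mixed f)"
  unfolding layered_def by (auto simp: lt_mixed cell_def)

lemma lt_mixed_cell: "x \<in> pts (mixed f) \<Longrightarrow> y \<in> pts (mixed f) \<Longrightarrow> cell x \<noteq> cell y \<Longrightarrow>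
    (x, y) \<in> lt (mixed f) \<longleftrightarrow> cell_less (cell x) (cell y)"
  using layered_mixed unfolding layered_def by blast

lemma lt_mixed_imp: "(x, y) \<in> lt (mixed f) \<Longrightarrow> x \<in> pts (mixed f) \<and> y \<in> pts (mixed f) \<and> (cell_less (cell x) (cell y) \<or> cell x = cell y)"
  by (cases x; cases y) (auto simp: lt_mixed)

lemma linear_cell: "admissible (f k) \<Longrightarrow> linear_order (cell_struct f k r)"
  by (auto simp: cell_struct_def linear_block linear_K linear_order_single)

lemma linear_mixed:
  assumes "\<And>k. admissible (f k)"
  shows "linear_order (mixed f)"
proof (rule linear_orderI)
  have "linear_order (cell_struct f k r)" for k r by (rule linear_cell) (rule assms)
  note lin = linear_orderD[OF this]
  show "(x, x) \<notin> lt (mixed f)" for x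
    using lin(1) by (cases x) (auto simp: lt_mixed)
  show "(x, z) \<in> lt (mixed f)" if "(x, y) \<in> lt (mixed f)" "(y, z) \<in> lt (mixed f)" for x y z
  proof -
    obtain k r a k' r' b k'' r'' c where e: "x = (k, r, a)" "y = (k', r', b)" "z = (k'', r'', c)"
      by (cases x; cases y; cases z)
    show ?thesis using that lin(2)[where x = a and y = b and z = c] unfolding e lt_mixed cell_less_simps by auto
  qed
  show "(x, y) \<in> lt (mixed f) \<or> (y, x) \<in> lt (mixed f)" if "x \<in> pts (mixed f)" "y \<in> pts (mixed f)" "x \<noteq> y" for x y
  proof (cases "cell x = cell y")
    case True
    obtain k r a b where "x = (k, r, a)" "y = (k, r, b)" using True by (cases x; cases y) auto
    then show ?thesis using that lin(3)[where x = a and y = b] by (auto simp: lt_mixed pts_mixed)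
  next
    case False
    then have "cell_less (cell x) (cell y) \<or> cell_less (cell y) (cell x)"
      by (cases x; cases y) auto
    then show ?thesis using lt_mixed_cell[OF that(1,2)] lt_mixed_cell[OF that(2,1)] False by auto
  qed
  show "x \<in> pts (mixed f) \<and> y \<in> pts (mixed f)" if "(x, y) \<in> lt (mixed f)" for x y using lt_mixed_imp[OF that] by blast
qed

definition inc :: "int \<times> nat \<Rightarrow> nat \<Rightarrow> pt" where
  "inc i z = (fst i, snd i, z)"

lemma inj_inc: "inj (inc i)" by (auto simp: inj_def inc_def)

text \<open>This is an equality and not only an isomorphism, so the order of a block must relate
  only points of the block; admissibility provides this through linearity.\<close>

lemma component_mixed:
  assumes "admissible (f k)" "r < 4"
  shows "component cell (mixed f) (k, r) = img (inc (k, r)) (cell_struct f k r)"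
proof -
  note lin = linear_orderD[OF linear_cell[of f k r, OF assms(1)]]
  have "pts (component cell (mixed f) (k, r)) = pts (img (inc (k, r)) (cell_struct f k r))"
    using assms(2) by (auto simp: component_def pts_mixed inc_def cell_def)
  moreover have "lt (component cell (mixed f) (k, r)) = lt (img (inc (k, r)) (cell_struct f k r))"
  proof -
    have "((k1, r1, z1), (k2, r2, z2)) \<in> lt (img (inc (k, r)) X) \<longleftrightarrow>
        k1 = k \<and> r1 = r \<and> k2 = k \<and> r2 = r \<and> (z1, z2) \<in> lt X" for k1 r1 z1 k2 r2 z2 and X :: "nat rstruct"
      by (auto simp: img_def inc_def image_iff intro!: bexI[of _ "(z1, z2)"])
    moreover have "((k1, r1, z1), (k2, r2, z2)) \<in> lt (component cell (mixed f) (k, r)) \<longleftrightarrow>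
        k1 = k \<and> r1 = r \<and> k2 = k \<and> r2 = r \<and> (z1, z2) \<in> lt (cell_struct f k r)" for k1 r1 z1 k2 r2 z2
      using assms(2) lin(4)[of z1 z2] by (auto simp: component_def lt_restr pts_mixed lt_mixed)
    ultimately show ?thesis by auto
  qed
  ultimately show ?thesis by (simp add: rstruct.expand)
qed

lemma component_mixed_empty: "\<not> r < 4 \<Longrightarrow> component cell (mixed f) (k, r) = RStruct {} {}"
proof -
  assume r: "\<not> r < 4"
  have "pts (component cell (mixed f) (k, r)) = {}" using r by (auto simp: component_def pts_mixed cell_def)
  moreover have "lt (component cell (mixed f) (k, r)) = {}" using calculation by (simp add: component_def lt_restr)
  ultimately show ?thesis by (metis rstruct.exhaust_sel)
qed

lemma component_mixed_equiv:
  assumes "admissible (f k)" "admissible (g k)" "min (enat m) (f k) = min (enat m) (g k)"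
  shows "bf_le (\<delta> m) (component cell (mixed f) (k, r)) [] (component cell (mixed g) (k, r)) []"
proof (cases "r < 4")
  case True
  have "bf_equiv (\<delta> m) (cell_struct f k r) (cell_struct g k r)"
    using block_equiv[OF assms] by (auto simp: cell_struct_def bf_equiv_def bf_le_refl)
  then show ?thesis
    using component_mixed[of f k r, OF assms(1) True] component_mixed[of g k r, OF assms(2) True] bf_equiv_img[OF inj_inc]
    unfolding bf_equiv_def by metis
qed (simp add: component_mixed_empty bf_le_refl)

lemma component_mixed_eq:
  assumes "admissible (f k)" "admissible (g k)" "r = 1 \<Longrightarrow> f k = g k"
  shows "component cell (mixed f) (k, r) = component cell (mixed g) (k, r)"
proof (cases "r < 4")
  case True
  then show ?thesis
    using component_mixed[of f k r, OF assms(1) True] component_mixed[of g k r, OF assms(2) True] assms(3) by (auto simp: cell_struct_def)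
qed (simp add: component_mixed_empty)

text \<open>Precision in the index function becomes a back-and-forth level: cells that contain an
  entry of \<open>es\<close> are the same in both sums, the others carry no parameter and are
  equivalent at level \<open>\<delta> m\<close>.\<close>

lemma mixed_equiv:
  assumes adm: "\<And>k. admissible (f k)" "\<And>k. admissible (g k)"
    and min: "\<And>k. min (enat m) (f k) = min (enat m) (g k)"
    and es: "set es \<subseteq> pts (mixed f)" "\<And>x. x \<in> set es \<Longrightarrow> f (fst x) = g (fst x)"
  shows "bf_le (\<delta> m) (mixed f) es (mixed g) es"
proof (rule bf_le_sum[OF layered_mixed layered_mixed refl es(1)])
  show "set es \<subseteq> pts (mixed g)"
  proof
    fix x assume x: "x \<in> set es"
    then have "x \<in> pts (mixed f)" "f (fst x) = g (fst x)" using es by auto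
    then show "x \<in> pts (mixed g)" by (cases x) (auto simp: pts_mixed cell_struct_def)
  qed
  fix i :: "int \<times> nat"
  obtain k r where i: "i = (k, r)" by (cases i)
  show "bf_le (\<delta> m) (component cell (mixed f) i) (filter (\<lambda>x. cell x = i) es) (component cell (mixed g) i) (filter (\<lambda>x. cell x = i) es)"
  proof (cases "f k = g k")
    case True
    show ?thesis unfolding i component_mixed_eq[of f k g r, OF adm True] by (rule bf_le_refl)
  next
    case False
    then have "filter (\<lambda>x. cell x = i) es = []"
      using es(2) i by (auto simp: filter_empty_conv cell_def)
    then show ?thesis using component_mixed_equiv[of f k g m r, OF adm min] i by simp
  qed
qed


subsection \<open>Intervals isomorphic to \<open>K\<close>\<close>

lemma length_alternating: "length (concat (map (\<lambda>a. [single, L a, single, K]) as)) = 4 * length as"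
  by (induction as) auto

lemma nth_alternating: "m < length as \<Longrightarrow> r < 4 \<Longrightarrow>
    concat (map (\<lambda>a. [single, L a, single, K]) as) ! (4 * m + r) = [single, L (as ! m), single, K] ! r"
proof (induction as arbitrary: m)
  case (Cons a as)
  show ?case
  proof (cases m)
    case 0
    have "concat (map (\<lambda>a. [single, L a, single, K]) (a # as)) ! (4 * m + r) =
        ([single, L a, single, K] @ concat (map (\<lambda>a. [single, L a, single, K]) as)) ! r"
      using 0 by simp
    also have "\<dots> = [single, L a, single, K] ! r" using Cons.prems by (simp only: nth_append) simp
    finally show ?thesis using 0 by simp
  next
    case (Suc m')
    have "concat (map (\<lambda>a. [single, L a, single, K]) (a # as)) ! (4 * m + r) =
        ([single, L a, single, K] @ concat (map (\<lambda>a. [single, L a, single, K]) as)) ! (4 + (4 * m' + r))"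
      using Suc by (simp add: algebra_simps)
    also have "\<dots> = concat (map (\<lambda>a. [single, L a, single, K]) as) ! (4 * m' + r)"
      by (simp only: nth_append) simp
    also have "\<dots> = [single, L (as ! m'), single, K] ! r"
      by (rule Cons.IH) (use Cons.prems Suc in auto)
    finally show ?thesis using Suc by simp
  qed
qed simp

text \<open>The groups from that of \<open>x\<close> to that of \<open>y\<close> form an initial
  segment of a finite alternating sum, where the hypothesis on copies of \<open>K\<close> applies.
  As \<open>K\<close> is nonempty, the interval has a point in the \<open>K\<close> block found, and
  the single points around this block confine \<open>x\<close> and \<open>y\<close>.\<close>

lemma K_interval_finite:
  assumes fin: "\<And>k. f k \<noteq> \<infinity>" and xy: "(x, y) \<in> lt (mixed f)" and iso: "interval (mixed f) x y \<cong>\<^sub>s K"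
  shows "\<exists>k. fst x = k \<and> 2 \<le> snd (cell x) \<and> (fst y = k \<or> y = lpt (k + 1))"
proof -
  have adm: "admissible (f k)" for k using fin by (simp add: admissible_def)
  obtain i r z where x: "x = (i, r, z)" by (cases x)
  obtain j s w where y: "y = (j, s, w)" by (cases y)
  have xp: "x \<in> pts (mixed f)" and yp: "y \<in> pts (mixed f)" and ij: "i \<le> j"
    using lt_mixed_imp[OF xy] x y by (auto simp: lt_mixed)
  define as where "as = map (\<lambda>u. the_enat (f u)) [i..j]"
  \<comment> \<open>The final \<open>1 + L 0\<close> is filler that every alternating sum ends with;
    the interval lies to its left.\<close>
  define T where "T = alternating_sum L K as 0"
  define Ms where "Ms = concat (map (\<lambda>a. [single, L a, single, K]) as) @ [single, L 0]"
  \<comment> \<open>Numbers the summands consecutively from group \<open>i\<close> on, four to a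
    group.\<close>
  define \<phi> where "\<phi> p = (nat (4 * (fst p - i)) + fst (snd p), snd (snd p))" for p :: pt
  have len: "length as = nat (j - i + 1)" by (simp add: as_def)
  have T: "T = list_sum Ms" by (simp add: T_def alternating_sum_def Ms_def)
  have lenM: "length Ms = 4 * length as + 2" by (simp add: Ms_def length_alternating)
  have nthM: "Ms ! (nat (4 * (k - i)) + q) = cell_struct f k q" if "i \<le> k" "k \<le> j" "q < 4" for k q
  proof -
    let ?m = "nat (k - i)"
    have m: "?m < length as" using that len by simp
    have e: "nat (4 * (k - i)) + q = 4 * ?m + q" using that by (simp add: nat_mult_distrib)
    have "4 * ?m + q < 4 * length as" using m that by simp
    then have "Ms ! (4 * ?m + q) = [single, L (as ! ?m), single, K] ! q"
      unfolding Ms_def by (simp add: nth_append length_alternating nth_alternating[OF m that(3)])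
    also have "as ! ?m = the_enat (f k)" using m that by (simp add: as_def)
    also have "[single, L (the_enat (f k)), single, K] ! q = [single, block (f k), single, K] ! q"
    proof -
      obtain n where "f k = enat n" using fin[of k] by auto
      then show ?thesis by simp
    qed
    finally show ?thesis using nth_cells[OF that(3)] e by metis
  qed
  have idx: "nat (4 * (k - i)) + q < length Ms" if "i \<le> k" "k \<le> j" "q < 4" for k q
    using that lenM len by (simp add: nat_mult_distrib)
  have ptsT: "\<phi> (k, q, v) \<in> pts T \<longleftrightarrow> (k, q, v) \<in> pts (mixed f)" if "i \<le> k" "k \<le> j" "q < 4" for k q v
    using nthM[OF that] idx[OF that] that by (simp add: T list_sum_def ord_sum_def \<phi>_def pts_mixed)
  have mono: "nat (4 * (k - i)) + q < nat (4 * (k' - i)) + q' \<longleftrightarrow> cell_less (k, q) (k', q')"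
    "nat (4 * (k - i)) + q = nat (4 * (k' - i)) + q' \<longleftrightarrow> k = k' \<and> q = q'"
    if kk: "i \<le> k" "i \<le> k'" "q < 4" "q' < 4" for k q k' q'
  proof -
    obtain a b where "k = i + int a" "k' = i + int b" using kk(1,2) by (metis zle_iff_zadd)
    then have e: "nat (4 * (k - i)) = 4 * a" "nat (4 * (k' - i)) = 4 * b" "k < k' \<longleftrightarrow> a < b" "k = k' \<longleftrightarrow> a = b"
      by auto
    show "nat (4 * (k - i)) + q < nat (4 * (k' - i)) + q' \<longleftrightarrow> cell_less (k, q) (k', q')"
      "nat (4 * (k - i)) + q = nat (4 * (k' - i)) + q' \<longleftrightarrow> k = k' \<and> q = q'"
      unfolding e cell_less_simps using kk(3,4) by presburger+
  qed
  have ltT: "(\<phi> (k, q, v), \<phi> (k', q', v')) \<in> lt T \<longleftrightarrow> ((k, q, v), (k', q', v')) \<in> lt (mixed f)"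
    if "i \<le> k" "k \<le> j" "q < 4" "i \<le> k'" "k' \<le> j" "q' < 4" for k q v k' q' v'
  proof -
    have "(\<phi> (k, q, v), \<phi> (k', q', v')) \<in> lt T \<longleftrightarrow> \<phi> (k, q, v) \<in> pts T \<and> \<phi> (k', q', v') \<in> pts T \<and>
      (nat (4 * (k - i)) + q < nat (4 * (k' - i)) + q' \<or> 
       nat (4 * (k - i)) + q = nat (4 * (k' - i)) + q' \<and> (v, v') \<in> lt (Ms ! (nat (4 * (k - i)) + q)))"
      by (auto simp: T list_sum_def ord_sum_def \<phi>_def)
    then show ?thesis unfolding ptsT[OF that(1-3)] ptsT[OF that(4-6)] lt_mixed 
      using mono[OF that(1,4,3,6)] nthM[OF that(1-3)] by auto
  qed
  have rs: "r < 4" "s < 4" using xp yp x y by (auto simp: pts_mixed)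
  let ?I = "interval (mixed f) x y" and ?J = "interval T (\<phi> x) (\<phi> y)"
  have inI: "i \<le> k \<and> k \<le> j \<and> q < 4" if "(k, q, v) \<in> pts ?I" for k q v
    using that x y by (auto simp: pts_interval lt_mixed pts_mixed)
  have "\<phi> ` pts ?I = pts ?J"
  proof (intro equalityI subsetI)
    fix a assume "a \<in> \<phi> ` pts ?I"
    then obtain k q v where a: "a = \<phi> (k, q, v)" "(k, q, v) \<in> pts ?I" by auto
    then show "a \<in> pts ?J"
      using inI[OF a(2)] ptsT ltT x y ij rs by (simp add: pts_interval)
  next
    fix a assume a: "a \<in> pts ?J"
    obtain n v where nv: "a = (n, v)" by (cases a)
    have n: "n \<le> nat (4 * (j - i)) + s"
    proof -
      have "(a, \<phi> y) \<in> lt T" using a by (simp add: pts_interval)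
      then show ?thesis using nv y by (auto simp: T list_sum_def ord_sum_def \<phi>_def)
    qed
    \<comment> \<open>Inverts the numbering; the bound on \<open>n\<close> that comes from
      \<open>y\<close> keeps the group at most \<open>j\<close>.\<close>
    define k q where "k = i + int (n div 4)" and "q = n mod 4"
    have "int (nat (4 * (j - i))) = 4 * (j - i)" using ij by simp
    then have "int n \<le> 4 * (j - i) + 3" using n rs by linarith
    then have k: "i \<le> k" "k \<le> j" "q < 4" by (auto simp: k_def q_def)
    have a': "a = \<phi> (k, q, v)" by (simp add: nv \<phi>_def k_def q_def nat_mult_distrib)
    have "(k, q, v) \<in> pts ?I" using a ptsT[OF k] ltT[OF _ _ _ k] ltT[OF k] x y ij rs a'
      by (simp add: pts_interval)
    then show "a \<in> \<phi> ` pts ?I" using a' by blast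
  qed
  moreover have "inj_on \<phi> (pts ?I)"
  proof (rule inj_onI)
    fix a b assume ab: "a \<in> pts ?I" "b \<in> pts ?I" "\<phi> a = \<phi> b"
    obtain k q v k' q' v' where e: "a = (k, q, v)" "b = (k', q', v')" by (cases a; cases b)
    then show "a = b" using mono(2)[of k k' q q'] inI ab by (auto simp: \<phi>_def)
  qed
  ultimately have bij: "bij_betw \<phi> (pts ?I) (pts ?J)" by (simp add: bij_betw_def)
  have "(a, b) \<in> lt ?I \<longleftrightarrow> (\<phi> a, \<phi> b) \<in> lt ?J" if ab: "a \<in> pts ?I" "b \<in> pts ?I" for a b
  proof -
    obtain k q v k' q' v' where e: "a = (k, q, v)" "b = (k', q', v')" by (cases a; cases b)
    have "(\<phi> a, \<phi> b) \<in> lt T \<longleftrightarrow> (a, b) \<in> lt (mixed f)" using ltT inI ab e by blast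
    moreover have "\<phi> a \<in> pts ?J" "\<phi> b \<in> pts ?J" using bij ab bij_betw_apply by metis+
    ultimately show ?thesis using ab by (simp add: lt_interval)
  qed
  then have "?I \<cong>\<^sub>s ?J" using bij unfolding isomorphic_def by blast
  then have "?J \<cong>\<^sub>s K" using iso iso_sym iso_trans by metis
  moreover have "\<phi> x \<in> pts T" "\<phi> y \<in> pts T" "(\<phi> x, \<phi> y) \<in> lt T"
    using x y ptsT ltT ij rs xp yp xy by auto
  ultimately obtain j0 where j0: "j0 < length as" "pts ?J \<subseteq> {4 * j0 + 3} \<times> pts K"
    using K_only unfolding K_only_in_K_blocks_def Let_def T_def by blast
  let ?k = "i + int j0"
  have all: "cell a = (?k, 3)" if a: "a \<in> pts ?I" for a
  proof -
    obtain k q v where e: "a = (k, q, v)" by (cases a)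
    have "\<phi> a \<in> pts ?J" using bij a bij_betw_apply by metis
    then have "nat (4 * (k - i)) + q = 4 * j0 + 3" using j0(2) e by (auto simp: \<phi>_def)
    moreover have k: "i \<le> k" "q < 4" using inI[of k q v] a e by auto
    moreover obtain b where b: "k = i + int b" using k(1) by (metis zle_iff_zadd)
    ultimately have "4 * b + q = 4 * j0 + 3" by simp
    then have "b = j0 \<and> q = 3" using k(2) by presburger
    then show ?thesis using e b by simp
  qed
  have "pts ?I \<noteq> {}"
    using iso pts_K unfolding isomorphic_def bij_betw_def by (metis image_empty)
  then obtain a where a: "a \<in> pts ?I" by blast
  have "linear_order (mixed f)" by (rule linear_mixed) (rule adm)
  note lin = linear_orderD[OF this]
  have ap: "a \<in> pts (mixed f)" "(x, a) \<in> lt (mixed f)" "(a, y) \<in> lt (mixed f)" using a by (auto simp: pts_interval)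
  have xa: "cell_less (i, r) (?k, 3) \<or> (i, r) = (?k, 3)" using lt_mixed_imp[OF ap(2)] all[OF a] x by simp
  have ay: "cell_less (?k, 3) (j, s) \<or> (?k, 3) = (j, s)" using lt_mixed_imp[OF ap(3)] all[OF a] y by simp
  \<comment> \<open>Otherwise the single point \<open>rpt ?k\<close> would lie in the interval but
    outside the \<open>K\<close> block.\<close>
  have "\<not> cell_less (i, r) (?k, 2)"
  proof
    assume c: "cell_less (i, r) (?k, 2)"
    then have "(x, rpt ?k) \<in> lt (mixed f)" using lt_mixed_cell[OF xp rpt_in[of ?k]] x by auto
    moreover have "(rpt ?k, a) \<in> lt (mixed f)" using lt_mixed_cell[OF rpt_in[of ?k] ap(1)] all[OF a] by auto
    ultimately have "rpt ?k \<in> pts ?I" using lin(2)[OF _ ap(3)] by (simp add: pts_interval)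
    then show False using all by fastforce
  qed
  then have xk: "i = ?k" "2 \<le> r" using xa rs by auto
  have "y = lpt (?k + 1) \<or> j = ?k"
  proof (rule ccontr)
    assume c: "\<not> ?thesis"
    then have "cell y \<noteq> (?k + 1, 0)" using lpt_iff[OF yp] by simp
    then have "cell_less (?k + 1, 0) (j, s)" using ay c y by auto
    then have "(lpt (?k + 1), y) \<in> lt (mixed f)" using lt_mixed_cell[OF lpt_in[of "?k + 1"] yp] y by auto
    moreover have "(a, lpt (?k + 1)) \<in> lt (mixed f)" using lt_mixed_cell[OF ap(1) lpt_in[of "?k + 1"]] all[OF a] by auto
    ultimately have "lpt (?k + 1) \<in> pts ?I" using lin(2)[OF ap(2)] by (simp add: pts_interval)
    then show False using all by fastforce
  qed
  then show ?thesis using xk x y by auto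
qed

end


context mixable
begin

section \<open>A base level that recognises \<open>K\<close>\<close>

definition k_level :: omega1 where
  "k_level = (SOME k. k < l \<and> (\<forall>(N :: pt rstruct) N'. bf_le k N [] N' [] \<longrightarrow> N \<cong>\<^sub>s K \<longrightarrow> N' \<cong>\<^sub>s K))"

lemma k_level:
  fixes N N' :: "pt rstruct"
  shows "k_level < l" "bf_le k_level N [] N' [] \<Longrightarrow> N \<cong>\<^sub>s K \<Longrightarrow> N' \<cong>\<^sub>s K"
proof -
  have "\<exists>k. k < l \<and> (\<forall>(N :: pt rstruct) N'. bf_le k N [] N' [] \<longrightarrow> N \<cong>\<^sub>s K \<longrightarrow> N' \<cong>\<^sub>s K)"
    using SR_less_bf[OF SR_K limit, where 'b = pt] by metis
  from someI_ex[OF this, folded k_level_def]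
  show "k_level < l" "bf_le k_level N [] N' [] \<Longrightarrow> N \<cong>\<^sub>s K \<Longrightarrow> N' \<cong>\<^sub>s K" by blast+
qed

text \<open>Room for \<open>n\<close> further extensions or exchanges above the base level.\<close>

abbreviation up :: "nat \<Rightarrow> omega1" where "up n \<equiv> (osuc ^^ n) k_level"

lemma up_less: "m < n \<Longrightarrow> up m < up n"
  using le_osuc_pow[of "Suc m" n k_level] less_osuc[of "up m"] by (simp add: Suc_leI)

lemma up_le: "m \<le> n \<Longrightarrow> up m \<le> up n"
  by (rule le_osuc_pow)

lemma up_limit: "up n < l"
  by (rule limit_osuc_pow[OF limit k_level(1)])

lemma K_interval_bf_le:
  fixes M N :: "pt rstruct"
  assumes "bf_le k_level M [x, y] N [x', y']" "interval M x y \<cong>\<^sub>s K"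
  shows "interval N x' y' \<cong>\<^sub>s K"
  using k_level(2)[OF bf_le_interval[OF assms(1)]] assms(2) by simp

text \<open>The hypothesis on \<open>K\<close> blocks speaks of the \<open>L i\<close> only, so
  infinite values are replaced by an \<open>m\<close> with \<open>\<delta> m\<close> above
  \<open>k_level\<close>. The points \<open>x\<close> and \<open>y\<close> have partners in the same
  cells of the new sum, with a copy of \<open>K\<close> between them, and the conclusion depends
  only on cells.\<close>

lemma K_interval:
  assumes adm: "\<And>k. admissible (f k)" and xy: "(x, y) \<in> lt (mixed f)" and iso: "interval (mixed f) x y \<cong>\<^sub>s K"
  shows "\<exists>k. fst x = k \<and> 2 \<le> snd (cell x) \<and> (fst y = k \<or> y = lpt (k + 1))"
proof -
  obtain m where m: "k_level < \<delta> m" using delta_cofinal[OF k_level(1)] by blast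
  define g where "g k = (if f k = \<infinity> then enat m else f k)" for k
  have fin: "g k \<noteq> \<infinity>" for k by (simp add: g_def)
  have adm': "admissible (g k)" for k using fin by (simp add: admissible_def)
  have min: "min (enat m) (g k) = min (enat m) (f k)" for k by (simp add: g_def min_def)
  have p: "x \<in> pts (mixed f)" "y \<in> pts (mixed f)" using lt_mixed_imp[OF xy] by auto
  have "\<exists>cs. set cs \<subseteq> pts (component cell (mixed g) i) \<and> 
      length cs = length (filter (\<lambda>x. cell x = i) [x, y]) \<and>
      bf_le k_level (component cell (mixed f) i) (filter (\<lambda>x. cell x = i) [] @ filter (\<lambda>x. cell x = i) [x, y])
              (component cell (mixed g) i) (filter (\<lambda>x. cell x = i) [] @ cs)" for i
  proof -
    obtain k r where i: "i = (k, r)" by (cases i)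
    have le: "bf_le (\<delta> m) (component cell (mixed g) i) [] (component cell (mixed f) i) []"
      using component_mixed_equiv[of g k f m r, OF adm' adm min] i by simp
    have "set (filter (\<lambda>x. cell x = i) [x, y]) \<subseteq> pts (component cell (mixed f) i)"
      using p by (auto simp: component_def)
    from bf_le_ext[OF le m this] show ?thesis by (simp del: filter.simps) (metis filter.simps(1))
  qed
  from sum_step[OF refl this] obtain cs where cs: "set cs \<subseteq> pts (mixed g)" "map cell cs = map cell [x, y]"
    "\<And>i. bf_le k_level (component cell (mixed f) i) (filter (\<lambda>x. cell x = i) ([] @ [x, y]))
              (component cell (mixed g) i) (filter (\<lambda>x. cell x = i) ([] @ cs))" by blast
  obtain x' y' where c: "cs = [x', y']" using cs(2) by (auto simp: map_eq_Cons_conv)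
  have cell: "cell x' = cell x" "cell y' = cell y" using cs(2) c by auto
  have p': "x' \<in> pts (mixed g)" "y' \<in> pts (mixed g)" using cs(1) c by auto
  have le: "bf_le k_level (mixed f) [x, y] (mixed g) [x', y']"
  proof (rule bf_le_sum[OF layered_mixed layered_mixed])
    show "bf_le k_level (component cell (mixed f) i) (filter (\<lambda>x. cell x = i) [x, y])
              (component cell (mixed g) i) (filter (\<lambda>x. cell x = i) [x', y'])" for i
      using cs(3)[of i] unfolding c append_Nil .
  qed (use p p' cell in auto)
  have "(x', y') \<in> lt (mixed g)" using atomic_nth(2)[OF bf_le_atomic[OF le], of 0 1] xy by simp
  then obtain k where k: "fst x' = k" "2 \<le> snd (cell x')" "fst y' = k \<or> y' = lpt (k + 1)"
    using K_interval_finite[OF fin _ K_interval_bf_le[OF le iso]] by blast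
  have "y = lpt (k + 1)" if "y' = lpt (k + 1)" using that cell(2) lpt_iff[OF p(2), of "k + 1"] by (metis cell_simps(2))
  moreover have "fst x = fst x'" "fst y = fst y'" using cell by (simp_all add: cell_def)
  ultimately show ?thesis using k cell by auto
qed


subsection \<open>Recovering the cells\<close>

text \<open>Maximality is needed because \<open>K\<close> may contain proper intervals isomorphic to \<open>K\<close>.\<close>

definition max_K :: "pt rstruct \<Rightarrow> pt \<Rightarrow> pt \<Rightarrow> bool" where
  "max_K M x y \<longleftrightarrow> x \<in> pts M \<and> y \<in> pts M \<and> (x, y) \<in> lt M \<and> interval M x y \<cong>\<^sub>s K \<and>
     (\<forall>u\<in>pts M. \<forall>v\<in>pts M. (u, v) \<in> lt M \<and> interval M u v \<cong>\<^sub>s K \<and> (u = x \<or> (u, x) \<in> lt M) \<and>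
        (v = y \<or> (y, v) \<in> lt M) \<longrightarrow> u = x \<and> v = y)"

lemma lt_endpoint:
  assumes "x \<in> pts (mixed f)"
  shows "(lpt k, x) \<in> lt (mixed f) \<longleftrightarrow> cell_less (k, 0) (cell x)" "(x, lpt k) \<in> lt (mixed f) \<longleftrightarrow> cell_less (cell x) (k, 0)"
    "(rpt k, x) \<in> lt (mixed f) \<longleftrightarrow> cell_less (k, 2) (cell x)" "(x, rpt k) \<in> lt (mixed f) \<longleftrightarrow> cell_less (cell x) (k, 2)"
  using lt_mixed_cell[OF lpt_in[of k] assms] lt_mixed_cell[OF assms lpt_in[of k]]
    lt_mixed_cell[OF rpt_in[of k] assms] lt_mixed_cell[OF assms rpt_in[of k]]
    lpt_iff[OF assms, of k] rpt_iff[OF assms, of k]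
  by (cases "cell x = (k, 0)"; cases "cell x = (k, 2)"; simp add: lt_mixed lpt_def rpt_def cell_less_def)+

lemma between_cell:
  assumes "x \<in> pts (mixed f)"
  shows "(lpt k, x) \<in> lt (mixed f) \<and> (x, rpt k) \<in> lt (mixed f) \<longleftrightarrow> cell x = (k, 1)"
    "(rpt k, x) \<in> lt (mixed f) \<and> (x, lpt (k + 1)) \<in> lt (mixed f) \<longleftrightarrow> cell x = (k, 3)"
  using cell_bound[OF assms] by (cases "cell x"; auto simp: lt_endpoint[OF assms])+

lemma interval_cell:
  shows "interval (mixed f) (lpt k) (rpt k) = component cell (mixed f) (k, 1)"
    "interval (mixed f) (rpt k) (lpt (k + 1)) = component cell (mixed f) (k, 3)"
proof -
  have restr_cong: "restr M A = restr M B" if "\<And>x. x \<in> pts M \<Longrightarrow> x \<in> A \<longleftrightarrow> x \<in> B" for M :: "pt rstruct" and A B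
  proof -
    have "pts M \<inter> A = pts M \<inter> B" using that by auto
    then show ?thesis by (simp add: restr_def)
  qed
  show "interval (mixed f) (lpt k) (rpt k) = component cell (mixed f) (k, 1)"
    unfolding interval_restr component_def by (rule restr_cong) (use between_cell(1) in simp)
  show "interval (mixed f) (rpt k) (lpt (k + 1)) = component cell (mixed f) (k, 3)"
    unfolding interval_restr component_def by (rule restr_cong) (use between_cell(2) in simp)
qed

lemma component_mixed_iso: "admissible (f k) \<Longrightarrow> r < 4 \<Longrightarrow> component cell (mixed f) (k, r) \<cong>\<^sub>s cell_struct f k r"
  using component_mixed[of f k r] iso_sym[OF iso_img[OF inj_inc]] by simp

text \<open>Every interval isomorphic to \<open>K\<close> lies in one from \<open>rpt k\<close> to
  \<open>lpt (k + 1)\<close>, and none of these contains another.\<close>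

lemma max_K_mixed:
  assumes adm: "\<And>k. admissible (f k)"
  shows "max_K (mixed f) x y \<longleftrightarrow> (\<exists>k. x = rpt k \<and> y = lpt (k + 1))"
proof
  have iso: "interval (mixed f) (rpt k) (lpt (k + 1)) \<cong>\<^sub>s K" for k
    using component_mixed_iso[of f k 3, OF adm] interval_cell(2)[of f k] by simp
  have lt: "(rpt k, lpt (k + 1)) \<in> lt (mixed f)" for k
    using lt_mixed_cell[OF rpt_in[of k] lpt_in[of "k + 1"]] by simp
  {
    assume mx: "max_K (mixed f) x y"
    then have p: "x \<in> pts (mixed f)" "y \<in> pts (mixed f)" and "(x, y) \<in> lt (mixed f)" "interval (mixed f) x y \<cong>\<^sub>s K"
      by (auto simp: max_K_def)
    then obtain k where k: "fst x = k" "2 \<le> snd (cell x)" "fst y = k \<or> y = lpt (k + 1)"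
      using K_interval[of f, OF adm] by blast
    have "rpt k = x \<or> (rpt k, x) \<in> lt (mixed f)"
    proof (cases "cell x = (k, 2)")
      case True
      then show ?thesis using rpt_iff[OF p(1)] by simp
    next
      case False
      then show ?thesis using lt_mixed_cell[OF rpt_in p(1), of k] k(1,2) by (cases x) auto
    qed
    moreover have "lpt (k + 1) = y \<or> (y, lpt (k + 1)) \<in> lt (mixed f)"
      using k(3) lt_mixed_cell[OF p(2) lpt_in, of "k + 1"] by (cases y) auto
    ultimately show "\<exists>k. x = rpt k \<and> y = lpt (k + 1)"
      using mx lt iso unfolding max_K_def by (metis lpt_in rpt_in)
  next
    assume "\<exists>k. x = rpt k \<and> y = lpt (k + 1)"
    then obtain k where xy: "x = rpt k" "y = lpt (k + 1)" by blast
    have "u = x \<and> v = y" if uv: "u \<in> pts (mixed f)" "v \<in> pts (mixed f)" "(u, v) \<in> lt (mixed f)" "interval (mixed f) u v \<cong>\<^sub>s K"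
      "u = x \<or> (u, x) \<in> lt (mixed f)" "v = y \<or> (y, v) \<in> lt (mixed f)" for u v
    proof -
      obtain j where j: "fst u = j" "2 \<le> snd (cell u)" "fst v = j \<or> v = lpt (j + 1)"
        using K_interval[of f, OF adm uv(3,4)] by blast
      have "fst u < k \<or> fst u = k \<and> snd (cell u) \<le> 2"
        using uv(5) lt_mixed_imp[of u x f] xy(1) by (cases u) (auto simp: rpt_def)
      moreover have "k + 1 \<le> fst v" using uv(6) lt_mixed_imp[of y v f] xy(2) by (cases v) (auto simp: lpt_def)
      ultimately have "v = lpt (k + 1)" "cell u = (k, 2)" using j by (cases u; auto simp: lpt_def)+
      then show ?thesis using rpt_iff[OF uv(1)] xy by simp
    qed
    then have "\<forall>u\<in>pts (mixed f). \<forall>v\<in>pts (mixed f). (u, v) \<in> lt (mixed f) \<and> interval (mixed f) u v \<cong>\<^sub>s K \<and>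
        (u = x \<or> (u, x) \<in> lt (mixed f)) \<and> (v = y \<or> (y, v) \<in> lt (mixed f)) \<longrightarrow> u = x \<and> v = y"
      by blast
    moreover have "x \<in> pts (mixed f)" "y \<in> pts (mixed f)" "(x, y) \<in> lt (mixed f)" "interval (mixed f) x y \<cong>\<^sub>s K"
      unfolding xy using lt[of k] iso[of k] by simp_all
    ultimately show "max_K (mixed f) x y" unfolding max_K_def by (intro conjI)
  }
qed

text \<open>A competitor in \<open>N\<close> is pulled back to \<open>M\<close>, where maximality
  makes it coincide with \<open>x\<close> and \<open>y\<close>; the atomic type carries these
  equalities back to \<open>N\<close>.\<close>

lemma max_K_bf_le:
  assumes le: "bf_le (up 2) M [x, y] N [x', y']" and p: "x' \<in> pts N" "y' \<in> pts N" and mx: "max_K M x y"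
  shows "max_K N x' y'"
proof -
  have "(x', y') \<in> lt N" using atomic_nth(2)[OF bf_le_atomic[OF le], of 0 1] mx by (simp add: max_K_def)
  moreover have "interval N x' y' \<cong>\<^sub>s K"
    using K_interval_bf_le[OF bf_le_mono[OF le]] up_le[of 0 2] mx by (simp add: max_K_def)
  moreover have "u' = x' \<and> v' = y'" if uv: "u' \<in> pts N" "v' \<in> pts N" "(u', v') \<in> lt N" "interval N u' v' \<cong>\<^sub>s K"
      "u' = x' \<or> (u', x') \<in> lt N" "v' = y' \<or> (y', v') \<in> lt N" for u' v'
  proof -
    obtain cs where cs: "set cs \<subseteq> pts M" "length cs = length [u', v']" "bf_le (up 1) N ([x', y'] @ [u', v']) M ([x, y] @ cs)"
      using bf_le_ext[OF le up_less[of 1 2], of "[u', v']"] uv by auto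
    obtain u v where c: "cs = [u, v]" using cs(2) by (auto simp: length_Suc_conv)
    have le': "bf_le (up 1) N [x', y', u', v'] M [x, y, u, v]" using cs(3) c by simp
    note at = atomic_nth[OF bf_le_atomic[OF le']]
    have "bf_le (up 0) N [u', v'] M [u, v]"
      by (rule bf_le_zip[OF bf_le_mono[OF le' up_le]]) auto
    then have "interval M u v \<cong>\<^sub>s K" using K_interval_bf_le uv(4) by simp
    moreover have "(u, v) \<in> lt M" using at(2)[of 2 3] uv(3) by simp
    moreover have "u = x \<or> (u, x) \<in> lt M" using at(1)[of 2 0] at(2)[of 2 0] uv(5) by auto
    moreover have "v = y \<or> (y, v) \<in> lt M" using at(1)[of 3 1] at(2)[of 1 3] uv(6) by auto
    ultimately have "u = x \<and> v = y" using mx cs(1) c unfolding max_K_def by auto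
    then show ?thesis using at(1)[of 2 0] at(1)[of 3 1] by auto
  qed
  ultimately show ?thesis using p unfolding max_K_def by blast
qed

text \<open>\<open>lpt k\<close> is recognised as the right end of a maximal copy of
  \<open>K\<close>. One level goes into exchanging the sides, one into naming
  \<open>rpt (k - 1)\<close>, and \<open>up 2\<close> remains for maximality.\<close>

lemma lpt_bf_le:
  assumes adm: "\<And>k. admissible (f k)" "\<And>k. admissible (g k)"
    and le: "bf_le (up 4) (mixed f) [lpt k] (mixed g) [x]" and x: "x \<in> pts (mixed g)"
  shows "\<exists>j. x = lpt j"
proof -
  have "bf_le (up 3) (mixed g) [x] (mixed f) [lpt k]" by (rule bf_le_swap[OF le up_less]) simp
  then obtain cs where cs: "set cs \<subseteq> pts (mixed g)" "length cs = length [rpt (k - 1)]"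
    "bf_le (up 2) (mixed f) ([lpt k] @ [rpt (k - 1)]) (mixed g) ([x] @ cs)"
    using bf_le_ext[OF _ up_less[of 2 3], of "mixed g" "[x]" "mixed f" "[lpt k]" "[rpt (k - 1)]"] by auto
  obtain y where c: "cs = [y]" using cs(2) by (auto simp: length_Suc_conv)
  have le': "bf_le (up 2) (mixed f) [rpt (k - 1), lpt k] (mixed g) [y, x]"
    by (rule bf_le_zip[OF cs(3)]) (auto simp: c)
  have "max_K (mixed f) (rpt (k - 1)) (lpt k)"
    unfolding max_K_mixed[of f, OF adm(1)] by (intro exI[of _ "k - 1"]) simp
  then have "max_K (mixed g) y x"
    using max_K_bf_le[OF le'] cs(1) c x by auto
  then show ?thesis using max_K_mixed[of g, OF adm(2)] by blast
qed

section \<open>Distances between the single points, and the cells\<close>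

lemma lt_lpt: "(lpt i, lpt j) \<in> lt (mixed f) \<longleftrightarrow> i < j"
  by (auto simp: lt_mixed lpt_def pts_mixed)

lemma lpt_inj: "lpt i = lpt j \<longleftrightarrow> i = j"
  by (simp add: lpt_def)

text \<open>The points \<open>lpt t\<close> to \<open>lpt k\<close> are answered by a strictly
  increasing chain of such points, so the distance cannot shrink. An exchange and an extension lead
  from \<open>up 6\<close> to the \<open>up 4\<close> of \<open>lpt_bf_le\<close>.\<close>

lemma lpt_distance_le:
  assumes adm: "\<And>k. admissible (f k)" "\<And>k. admissible (g k)"
    and le: "bf_le (up 6) (mixed f) [lpt t, lpt k] (mixed g) [lpt s, lpt j]" and tk: "t \<le> k"
  shows "k - t \<le> j - s"
proof -
  let ?n = "nat (k - t)"
  let ?ps = "map (\<lambda>i. lpt (t + int i)) [0..<Suc ?n]"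
  have "bf_le (up 5) (mixed g) [lpt s, lpt j] (mixed f) [lpt t, lpt k]" by (rule bf_le_swap[OF le up_less]) simp
  moreover have "set ?ps \<subseteq> pts (mixed f)" by auto
  ultimately obtain cs where cs: "set cs \<subseteq> pts (mixed g)" "length cs = length ?ps"
    "bf_le (up 4) (mixed f) ([lpt t, lpt k] @ ?ps) (mixed g) ([lpt s, lpt j] @ cs)"
    using bf_le_ext[OF _ up_less[of 4 5]] by (metis (no_types, lifting) lessI numeral_eq_Suc pred_numeral_simps(3) numeral_nat(1))
  have len: "length cs = Suc ?n" using cs(2) by simp
  note at = atomic_nth[OF bf_le_atomic[OF cs(3)]]
  have psn: "?ps ! i = lpt (t + int i)" if "i \<le> ?n" for i using that by (simp del: upt_Suc)
  have "\<exists>m. cs ! i = lpt m" if i: "i \<le> ?n" for i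
  proof (rule lpt_bf_le[OF adm])
    show "bf_le (up 4) (mixed f) [lpt (t + int i)] (mixed g) [cs ! i]"
      by (rule bf_le_sub[OF cs(3), of _ "[2 + i]"]) (use i psn[OF i] in \<open>auto simp del: upt_Suc\<close>)
    show "cs ! i \<in> pts (mixed g)" using cs(1) len i by (metis le_imp_less_Suc nth_mem subsetD)
  qed
  then obtain m where m: "\<And>i. i \<le> ?n \<Longrightarrow> cs ! i = lpt (m i)" by metis
  have step: "m i < m (Suc i)" if "Suc i \<le> ?n" for i
  proof -
    have "(lpt (t + int i), lpt (t + int (Suc i))) \<in> lt (mixed f) \<longleftrightarrow> (lpt (m i), lpt (m (Suc i))) \<in> lt (mixed g)"
      using at(2)[of "2 + i" "2 + Suc i"] that psn[of i] psn[of "Suc i"] m[of i] m[of "Suc i"] by (simp del: upt_Suc)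
    then show ?thesis by (simp add: lt_lpt)
  qed
  have "m 0 = s"
    using at(1)[of 0 2] psn[of 0] m[of 0] by (simp add: lpt_inj del: upt_Suc)
  have "s + int i \<le> m i" if "i \<le> ?n" for i
    using that
  proof (induction i)
    case (Suc i)
    then show ?case using step[of i] by simp
  qed (simp add: \<open>m 0 = s\<close>)
  moreover have "m ?n = j"
    using at(1)[of 1 "2 + ?n"] psn[of ?n] m[of ?n] tk by (simp add: lpt_inj del: upt_Suc)
  ultimately show ?thesis using tk by fastforce
qed

text \<open>One more level lets the inequality be used in both directions; a negative distance is
  handled by listing the two points in the other order.\<close>

lemma lpt_distance:
  assumes adm: "\<And>k. admissible (f k)" "\<And>k. admissible (g k)"
    and le: "bf_le (up 7) (mixed f) [lpt t, lpt k] (mixed g) [lpt s, lpt j]"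
  shows "k - t = j - s"
proof -
  have main: "k - t = j - s" if le: "bf_le (up 7) (mixed f) [lpt t, lpt k] (mixed g) [lpt s, lpt j]" and tk: "t \<le> k" for t k s j
  proof -
    have "bf_le (up 6) (mixed f) [lpt t, lpt k] (mixed g) [lpt s, lpt j]" by (rule bf_le_mono[OF le up_le]) simp
    then have 1: "k - t \<le> j - s" using lpt_distance_le[of f g, OF adm] tk by blast
    have "bf_le (up 6) (mixed g) [lpt s, lpt j] (mixed f) [lpt t, lpt k]" by (rule bf_le_swap[OF le up_less]) simp
    then have "j - s \<le> k - t" using lpt_distance_le[of g f, OF adm(2,1)] 1 tk by force
    then show ?thesis using 1 by simp
  qed
  show ?thesis
  proof (cases "t \<le> k")
    case True
    then show ?thesis using main[OF le] by blast
  next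
    case False
    have "bf_le (up 7) (mixed f) [lpt k, lpt t] (mixed g) [lpt j, lpt s]" by (rule bf_le_zip[OF le]) auto
    then show ?thesis using main[of k t j s] False by simp
  qed
qed

text \<open>A left point is placed by its distance from the base point. A right point starts a
  maximal copy of \<open>K\<close> whose other end \<open>lpt (k + 1)\<close> is placed by distance;
  naming that end leads from \<open>up 9\<close> to \<open>up 7\<close>.\<close>

lemma endpoint_bf_le:
  assumes adm: "\<And>k. admissible (f k)" "\<And>k. admissible (g k)"
    and le: "bf_le (up 9) (mixed f) [lpt t, x] (mixed g) [lpt s, y]" and y: "y \<in> pts (mixed g)"
  shows "x = lpt k \<Longrightarrow> y = lpt (k - t + s)" "x = rpt k \<Longrightarrow> y = rpt (k - t + s)"
proof -
  have dist: "j = k - t + s" if "bf_le (up 7) (mixed f) [lpt t, lpt k] (mixed g) [lpt s, lpt j]" for k j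
    using lpt_distance[of f g, OF adm that] by simp
  {
    assume x: "x = lpt k"
    have "bf_le (up 4) (mixed f) [lpt k] (mixed g) [y]"
      by (rule bf_le_zip[OF bf_le_mono[OF le up_le]]) (auto simp: x)
    then obtain j where j: "y = lpt j" using lpt_bf_le[of f g, OF adm] y by blast
    have "bf_le (up 7) (mixed f) [lpt t, lpt k] (mixed g) [lpt s, lpt j]"
      using bf_le_mono[OF le up_le] x j by simp
    then show "y = lpt (k - t + s)" using dist j by simp
  next
    assume x: "x = rpt k"
    have "bf_le (up 8) (mixed g) [lpt s, y] (mixed f) [lpt t, x]" by (rule bf_le_swap[OF le up_less]) simp
    then obtain cs where cs: "set cs \<subseteq> pts (mixed g)" "length cs = length [lpt (k + 1)]"
      "bf_le (up 7) (mixed f) ([lpt t, x] @ [lpt (k + 1)]) (mixed g) ([lpt s, y] @ cs)"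
      using bf_le_ext[OF _ up_less[of 7 8], of "mixed g" "[lpt s, y]" "mixed f" "[lpt t, x]" "[lpt (k + 1)]"] by auto
    obtain z where c: "cs = [z]" using cs(2) by (auto simp: length_Suc_conv)
    have "bf_le (up 2) (mixed f) [x, lpt (k + 1)] (mixed g) [y, z]"
      by (rule bf_le_zip[OF bf_le_mono[OF cs(3) up_le]]) (auto simp: c)
    moreover have "max_K (mixed f) x (lpt (k + 1))" using max_K_mixed[of f, OF adm(1)] x by blast
    ultimately have "max_K (mixed g) y z" using max_K_bf_le cs(1) c y by auto
    then obtain j where j: "y = rpt j" "z = lpt (j + 1)" using max_K_mixed[of g, OF adm(2)] by blast
    have "bf_le (up 7) (mixed f) [lpt t, lpt (k + 1)] (mixed g) [lpt s, lpt (j + 1)]"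
      by (rule bf_le_zip[OF cs(3)]) (auto simp: c j)
    then have "j = k - t + s" using dist[of "k + 1" "j + 1"] by simp
    then show "y = rpt (k - t + s)" using j by simp
  }
qed

text \<open>A point of a copy of \<open>L\<close> or \<open>K\<close> is placed by the two single
  points around it; naming these leads from \<open>up 11\<close> to \<open>up 9\<close>.\<close>

lemma cell_bf_le:
  assumes adm: "\<And>k. admissible (f k)" "\<And>k. admissible (g k)"
    and le: "bf_le (up 11) (mixed f) [lpt t, x] (mixed g) [lpt s, y]" and p: "x \<in> pts (mixed f)" "y \<in> pts (mixed g)"
    and c: "cell x = (k, r)"
  shows "cell y = (k - t + s, r)"
proof -
  have le9: "bf_le (up 9) (mixed f) [lpt t, x] (mixed g) [lpt s, y]" by (rule bf_le_mono[OF le up_le]) simp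
  have ends: "\<exists>a b. a \<in> pts (mixed g) \<and> b \<in> pts (mixed g) \<and> bf_le (up 9) (mixed f) [lpt t, x, u, v] (mixed g) [lpt s, y, a, b] \<and>
     bf_le (up 9) (mixed f) [lpt t, u] (mixed g) [lpt s, a] \<and> bf_le (up 9) (mixed f) [lpt t, v] (mixed g) [lpt s, b] \<and>
     ((u, x) \<in> lt (mixed f) \<longrightarrow> (a, y) \<in> lt (mixed g)) \<and> ((x, v) \<in> lt (mixed f) \<longrightarrow> (y, b) \<in> lt (mixed g))" 
    if uv: "u \<in> pts (mixed f)" "v \<in> pts (mixed f)" for u v
  proof -
    have "bf_le (up 10) (mixed g) [lpt s, y] (mixed f) [lpt t, x]" by (rule bf_le_swap[OF le up_less]) simp
    then obtain cs where cs: "set cs \<subseteq> pts (mixed g)" "length cs = length [u, v]"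
      "bf_le (up 9) (mixed f) ([lpt t, x] @ [u, v]) (mixed g) ([lpt s, y] @ cs)"
      using bf_le_ext[OF _ up_less[of 9 10], of "mixed g" "[lpt s, y]" "mixed f" "[lpt t, x]" "[u, v]"] uv by auto
    obtain a b where ab: "cs = [a, b]" using cs(2) by (auto simp: length_Suc_conv)
    have le': "bf_le (up 9) (mixed f) [lpt t, x, u, v] (mixed g) [lpt s, y, a, b]" using cs(3) ab by simp
    note at = atomic_nth(2)[OF bf_le_atomic[OF le']]
    have "bf_le (up 9) (mixed f) [lpt t, u] (mixed g) [lpt s, a]" "bf_le (up 9) (mixed f) [lpt t, v] (mixed g) [lpt s, b]"
      by (rule bf_le_zip[OF le']; auto)+
    then show ?thesis using le' at[of 2 1] at[of 1 3] cs(1) ab by (intro exI[of _ a] exI[of _ b]) auto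
  qed
  have "r < 4" using cell_bound[OF p(1)] c by simp
  then consider "r = 0" | "r = 1" | "r = 2" | "r = 3" by linarith
  then show ?thesis
  proof cases
    case 1
    then show ?thesis using lpt_iff[OF p(1), of k] c endpoint_bf_le(1)[of f g, OF adm le9 p(2)] by simp
  next
    case 3
    then show ?thesis using rpt_iff[OF p(1), of k] c endpoint_bf_le(2)[of f g, OF adm le9 p(2)] by simp
  next
    case 2
    have "(lpt k, x) \<in> lt (mixed f) \<and> (x, rpt k) \<in> lt (mixed f)" using between_cell(1)[OF p(1)] c 2 by simp
    moreover obtain a b where ab: "a \<in> pts (mixed g)" "b \<in> pts (mixed g)"
      "bf_le (up 9) (mixed f) [lpt t, lpt k] (mixed g) [lpt s, a]" "bf_le (up 9) (mixed f) [lpt t, rpt k] (mixed g) [lpt s, b]"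
      "(lpt k, x) \<in> lt (mixed f) \<longrightarrow> (a, y) \<in> lt (mixed g)" "(x, rpt k) \<in> lt (mixed f) \<longrightarrow> (y, b) \<in> lt (mixed g)"
      using ends[OF lpt_in[of k] rpt_in[of k]] by blast
    ultimately have "(a, y) \<in> lt (mixed g) \<and> (y, b) \<in> lt (mixed g)" by blast
    moreover have "a = lpt (k - t + s)" using endpoint_bf_le(1)[of f g, OF adm ab(3,1) refl] .
    moreover have "b = rpt (k - t + s)" using endpoint_bf_le(2)[of f g, OF adm ab(4,2) refl] .
    ultimately show ?thesis using between_cell(1)[OF p(2)] 2 by blast
  next
    case 4
    have "(rpt k, x) \<in> lt (mixed f) \<and> (x, lpt (k + 1)) \<in> lt (mixed f)" using between_cell(2)[OF p(1)] c 4 by simp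
    moreover obtain a b where ab: "a \<in> pts (mixed g)" "b \<in> pts (mixed g)"
      "bf_le (up 9) (mixed f) [lpt t, rpt k] (mixed g) [lpt s, a]" "bf_le (up 9) (mixed f) [lpt t, lpt (k + 1)] (mixed g) [lpt s, b]"
      "(rpt k, x) \<in> lt (mixed f) \<longrightarrow> (a, y) \<in> lt (mixed g)" "(x, lpt (k + 1)) \<in> lt (mixed f) \<longrightarrow> (y, b) \<in> lt (mixed g)"
      using ends[OF rpt_in[of k] lpt_in[of "k + 1"]] by blast
    ultimately have "(a, y) \<in> lt (mixed g) \<and> (y, b) \<in> lt (mixed g)" by blast
    moreover have "a = rpt (k - t + s)" using endpoint_bf_le(2)[of f g, OF adm ab(3,1) refl] .
    moreover have "b = lpt ((k - t + s) + 1)" 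
      using endpoint_bf_le(1)[of f g, OF adm ab(4,2) refl] by (simp add: algebra_simps)
    ultimately show ?thesis using between_cell(2)[OF p(2)] 4 by blast
  qed
qed

end


section \<open>The Scott sentence\<close>

lemma pts_component: "pts (component loc M i) = {x \<in> pts M. loc x = i}"
  by (auto simp: component_def)

text \<open>The axioms are universal in at most three points, so one extension by a triple decides
  them. This supplies the linearity that a limit structure must have. That the order stays within
  the points is invisible to tuples of points and is assumed.\<close>

lemma linear_order_bf_le:
  assumes Y: "linear_order Y" and le: "bf_le b Y [] X []" "a < b" and lt: "lt X \<subseteq> pts X \<times> pts X"
  shows "linear_order X"
proof -
  have triple: "\<exists>x' y' z'. x' \<in> pts Y \<and> y' \<in> pts Y \<and> atomic_equiv X [x, y, z] Y [x', y', z']"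
    if xyz: "x \<in> pts X" "y \<in> pts X" "z \<in> pts X" for x y z
  proof -
    have "set [x, y, z] \<subseteq> pts X" using xyz by simp
    from bf_le_ext[OF le this] obtain cs where cs: "set cs \<subseteq> pts Y" "length cs = length [x, y, z]"
      "bf_le a X ([] @ [x, y, z]) Y ([] @ cs)" by blast
    obtain x' y' z' where c: "cs = [x', y', z']" using cs(2) by (auto simp: length_Suc_conv)
    have "x' \<in> pts Y \<and> y' \<in> pts Y \<and> atomic_equiv X [x, y, z] Y [x', y', z']"
      using cs(1) bf_le_atomic[OF cs(3)] c by simp
    then show ?thesis by blast
  qed
  show ?thesis
  proof (rule linear_orderI)
    show xp: "x \<in> pts X \<and> y \<in> pts X" if "(x, y) \<in> lt X" for x y using lt that by auto
    show "(x, x) \<notin> lt X" for x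
    proof
      assume x: "(x, x) \<in> lt X"
      then obtain x' y' z' where at: "atomic_equiv X [x, x, x] Y [x', y', z']" using triple[of x x x] xp by blast
      show False using atomic_nth(2)[OF at, of 0 0] x linear_orderD(1)[OF Y] by simp
    qed
    show "(x, z) \<in> lt X" if xyz: "(x, y) \<in> lt X" "(y, z) \<in> lt X" for x y z
    proof -
      obtain x' y' z' where at: "atomic_equiv X [x, y, z] Y [x', y', z']" using triple[of x y z] xp xyz by blast
      show ?thesis using atomic_nth(2)[OF at, of 0 1] atomic_nth(2)[OF at, of 1 2] atomic_nth(2)[OF at, of 0 2]
        xyz linear_orderD(2)[OF Y, of x' y' z'] by simp
    qed
    show "(x, y) \<in> lt X \<or> (y, x) \<in> lt X" if xy: "x \<in> pts X" "y \<in> pts X" "x \<noteq> y" for x y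
    proof -
      obtain x' y' z' where at: "x' \<in> pts Y" "y' \<in> pts Y" "atomic_equiv X [x, y, y] Y [x', y', z']"
        using triple[of x y y] xy by blast
      show ?thesis using atomic_nth[OF at(3), of 0 1] atomic_nth(2)[OF at(3), of 1 0] 
        xy(3) linear_orderD(3)[OF Y at(1,2)] by simp
    qed
  qed
qed

context mixable
begin

text \<open>For a finite value the Scott rank of \<open>L n\<close> decides. For \<infinity>,
  \<open>X\<close> inherits the equivalences that make it a limit structure; limit structures have
  their points in \<open>nat\<close>, hence the passage through \<open>to_nat\<close>.\<close>

lemma block_iso_limit:
  fixes X Y :: "pt rstruct"
  assumes eq: "\<And>b. b < l \<Longrightarrow> bf_equiv b X Y" and Y: "Y \<cong>\<^sub>s block a" and adm: "admissible a"
    and lt: "lt X \<subseteq> pts X \<times> pts X" and lin: "linear_order Y"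
  shows "X \<cong>\<^sub>s block a"
proof (cases a)
  case (enat n)
  obtain k where k: "k < l" "\<And>(N :: pt rstruct) N'. bf_le k N [] N' [] \<Longrightarrow> N \<cong>\<^sub>s L n \<Longrightarrow> N' \<cong>\<^sub>s L n"
    using SR_less_bf[OF SR_L[of n] limit, where 'b = pt] by metis
  show ?thesis using k(2)[of Y X] eq[OF k(1)] Y enat by (simp add: bf_equiv_def)
next
  case infinity
  let ?h = "to_nat :: pt \<Rightarrow> nat"
  have inj: "inj ?h" by simp
  have Y': "img ?h Y \<cong>\<^sub>s Linf" using iso_trans[OF iso_sym[OF iso_img[OF inj]] Y] infinity by simp
  have u: "unique_limit_structure \<delta> L Linf" using adm infinity by (simp add: admissible_def)
  have eq': "bf_equiv b (img ?h X) Linf" if "b < l" for b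
    by (rule bf_equiv_trans[OF _ iso_bf_equiv[OF Y']]) (simp only: bf_equiv_img[OF inj] eq[OF that])
  have "linear_order (img ?h X)"
  proof (rule linear_order_bf_le)
    show "linear_order Linf" using linear_block[OF adm] infinity by simp
    show "bf_le (\<delta> 0) Linf [] (img ?h X) []" using eq'[OF delta_less] by (simp add: bf_equiv_def)
    show "0 < \<delta> 0" by (rule delta_0)
    show "lt (img ?h X) \<subseteq> pts (img ?h X) \<times> pts (img ?h X)" using lt by (auto simp: img_def)
  qed
  moreover have "\<exists>i\<ge>n. bf_equiv (\<delta> n) (img ?h X) (L i)" for n
  proof -
    obtain i where "i \<ge> n" "bf_equiv (\<delta> n) Linf (L i)"
      using u unfolding unique_limit_structure_def limit_structure_def by blast
    then show ?thesis using bf_equiv_trans[OF eq'[OF delta_less]] by blast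
  qed
  ultimately have "img ?h X \<cong>\<^sub>s Linf"
    using u unfolding unique_limit_structure_def limit_structure_def by blast
  then show ?thesis using iso_trans[OF iso_img[OF inj]] infinity by simp
qed

text \<open>The hypothesis is one-sided, but \<open>l\<close> is a limit, so both directions hold at
  every level below \<open>l\<close>. The cells of \<open>N\<close> are obtained by matching its
  points with points of the mixed sum over the two base points.\<close>

lemma iso_if_bf_le:
  fixes N :: "pt rstruct"
  assumes adm: "\<And>k. admissible (f k)" and b: "b \<in> pts N" and le: "bf_le l (mixed f) [lpt 0] N [b]"
  shows "N \<cong>\<^sub>s mixed f"
proof -
  let ?M = "mixed f" and ?a = "lpt 0"
  have fwd: "\<exists>ds. set ds \<subseteq> pts N \<and> length ds = length cs \<and> bf_le c ?M (?a # cs) N (b # ds)"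
    if "c < l" "set cs \<subseteq> pts ?M" for c cs
  proof -
    have "bf_le (osuc c) N [b] ?M [?a]" by (rule bf_le_swap[OF le limit_osuc[OF limit that(1)]])
    from bf_le_ext[OF this less_osuc that(2)] show ?thesis by (metis append_Cons append_Nil)
  qed
  have bwd: "\<exists>cs. set cs \<subseteq> pts ?M \<and> length cs = length ds \<and> bf_le c N (b # ds) ?M (?a # cs)"
    if "c < l" "set ds \<subseteq> pts N" for c ds
    using bf_le_ext[OF le that] by (metis append_Cons append_Nil)
  have cell_M: "cell x = cell y" if "bf_le (up 11) ?M [?a, x] ?M [?a, y]" "x \<in> pts ?M" "y \<in> pts ?M" for x y
    using cell_bf_le[of f f, OF adm adm that, of "fst (cell x)" "snd (cell x)"] by simp
  \<comment> \<open>The cell of some match of \<open>z\<close>. Two matches are linked through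
    \<open>N\<close> at \<open>up 11\<close>, the level of \<open>cell_bf_le\<close>, so the choice
    does not matter; the exchange of sides in this link accounts for \<open>up 12\<close>.\<close>
  define cN where "cN z = cell (SOME c. c \<in> pts ?M \<and> bf_le (up 12) N [b, z] ?M [?a, c])" for z
  have cN: "cN z = cell c" if z: "z \<in> pts N" and c: "c \<in> pts ?M" and bf: "bf_le (up 12) N [b, z] ?M [?a, c]" for z c
  proof -
    let ?c = "SOME c. c \<in> pts ?M \<and> bf_le (up 12) N [b, z] ?M [?a, c]"
    have c': "?c \<in> pts ?M \<and> bf_le (up 12) N [b, z] ?M [?a, ?c]"
      by (rule someI[of _ c]) (use c bf in blast)
    have "bf_le (up 11) ?M [?a, ?c] N [b, z]" by (rule bf_le_swap[OF conjunct2[OF c'] up_less]) simp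
    moreover have "bf_le (up 11) N [b, z] ?M [?a, c]" by (rule bf_le_mono[OF bf up_le]) simp
    ultimately have "bf_le (up 11) ?M [?a, ?c] ?M [?a, c]" by (rule bf_le_trans)
    then show ?thesis unfolding cN_def using cell_M c c' by blast
  qed
  have match: "\<exists>cs. set cs \<subseteq> pts ?M \<and> length cs = length ds \<and> map cN ds = map cell cs \<and> bf_le c N (b # ds) ?M (?a # cs)"
    if c: "c < l" "up 12 \<le> c" and ds: "set ds \<subseteq> pts N" for c ds
  proof -
    obtain cs where cs: "set cs \<subseteq> pts ?M" "length cs = length ds" "bf_le c N (b # ds) ?M (?a # cs)"
      using bwd[OF c(1) ds] by blast
    have "cN (ds ! i) = cell (cs ! i)" if i: "i < length ds" for i
    proof (rule cN)
      show "ds ! i \<in> pts N" using nth_mem[OF i] ds by (rule rev_subsetD)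
      show "cs ! i \<in> pts ?M" using nth_mem[of i cs] cs(1,2) i by (metis subsetD)
      show "bf_le (up 12) N [b, ds ! i] ?M [?a, cs ! i]"
        by (rule bf_le_sub[OF bf_le_mono[OF cs(3) c(2)], of _ "[0, Suc i]"]) (use i in auto)
    qed
    then have "map cN ds = map cell cs" using cs(2) by (simp add: list_eq_iff_nth_eq)
    then show ?thesis using cs by blast
  qed
  have match1: "\<exists>x. x \<in> pts ?M \<and> cN z = cell x \<and> bf_le (up 12) N [b, z] ?M [?a, x]" if "z \<in> pts N" for z
  proof -
    have "set [z] \<subseteq> pts N" using that by simp
    from match[OF up_limit order_refl this] show ?thesis by (auto simp: length_Suc_conv)
  qed
  have match2: "\<exists>x y. x \<in> pts ?M \<and> y \<in> pts ?M \<and> cN z = cell x \<and> cN w = cell y \<and>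
     (z = w \<longleftrightarrow> x = y) \<and> ((z, w) \<in> lt N \<longleftrightarrow> (x, y) \<in> lt ?M)" if zw: "z \<in> pts N" "w \<in> pts N" for z w
  proof -
    have "set [z, w] \<subseteq> pts N" using zw by simp
    from match[OF up_limit order_refl this] obtain cs where cs: "set cs \<subseteq> pts ?M" "length cs = length [z, w]"
      "map cN [z, w] = map cell cs" "bf_le (up 12) N (b # [z, w]) ?M (?a # cs)" by blast
    obtain x y where c: "cs = [x, y]" using cs(2) by (auto simp: length_Suc_conv)
    note at = atomic_nth[OF bf_le_atomic[OF cs(4)], of 1 2]
    show ?thesis by (intro exI[of _ x] exI[of _ y]) (use at cs(1,3) c in auto)
  qed
  have layered_N: "(z, w) \<in> lt N \<longleftrightarrow> cell_less (cN z) (cN w)" if "z \<in> pts N" "w \<in> pts N" "cN z \<noteq> cN w" for z w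
    using match2[OF that(1,2)] lt_mixed_cell that(3) by metis
  \<comment> \<open>\<open>up 13\<close> pays for the exchange that returns to the level
    \<open>up 12\<close> of \<open>cN\<close>.\<close>
  have point: "\<exists>d\<in>pts N. cN d = cell y" if y: "y \<in> pts ?M" for y
  proof -
    obtain ds where ds: "set ds \<subseteq> pts N" "length ds = length [y]" "bf_le (up 13) ?M (?a # [y]) N (b # ds)"
      using fwd[OF up_limit, of "[y]" 13] y by auto
    then obtain d where d: "ds = [d]" by (auto simp: length_Suc_conv)
    have "bf_le (up 12) N [b, d] ?M [?a, y]" using bf_le_swap[OF ds(3) up_less[of 12 13]] d by simp
    then show ?thesis using cN[of d y] ds(1) d y by auto
  qed
  have component_eq: "component cN N i \<cong>\<^sub>s component cell ?M i" for i
  proof -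
    obtain k r where i: "i = (k, r)" by (cases i)
    have single_case: "component cN N i \<cong>\<^sub>s component cell ?M i" 
      if y: "y \<in> pts ?M" "\<And>x. x \<in> pts ?M \<Longrightarrow> cell x = i \<longleftrightarrow> x = y" for y
    proof -
      have yi: "cell y = i" using y by blast
      obtain d where d: "d \<in> pts N" "cN d = i" using point[OF y(1)] yi by auto
      have ud: "z = d" if z: "z \<in> pts N" "cN z = i" for z
        using match2[OF z(1) d(1)] y(2) z(2) d(2) by metis
      have "(d, d) \<in> lt N \<longleftrightarrow> (y, y) \<in> lt ?M"
        using match2[OF d(1) d(1)] y(2) d(2) by metis
      moreover have "pts (component cN N i) = {d}" unfolding pts_component using d ud by blast
      moreover have "pts (component cell ?M i) = {y}" unfolding pts_component using y by blast
      ultimately show ?thesis unfolding isomorphic_def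
        by (intro exI[of _ "\<lambda>_. y"]) (simp add: component_def lt_restr bij_betw_def)
    qed
    \<comment> \<open>The endpoints lie in one-point cells, so every match of \<open>d\<close> and
      \<open>e\<close> that respects cells is exactly \<open>u\<close> and \<open>v\<close>.\<close>
    have interval_case: "\<exists>d e. component cN N i = interval N d e \<and> (\<forall>c<l. bf_equiv c (interval N d e) (interval ?M u v))"
      if uv: "u \<in> pts ?M" "v \<in> pts ?M" and
        btw: "\<And>x. x \<in> pts ?M \<Longrightarrow> (u, x) \<in> lt ?M \<and> (x, v) \<in> lt ?M \<longleftrightarrow> cell x = i" and
        uniq: "\<And>x. x \<in> pts ?M \<Longrightarrow> cell x = cell u \<Longrightarrow> x = u" "\<And>x. x \<in> pts ?M \<Longrightarrow> cell x = cell v \<Longrightarrow> x = v" for u v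
    proof -
      obtain d e where de: "d \<in> pts N" "cN d = cell u" "e \<in> pts N" "cN e = cell v"
        using point uv by metis
      have "(d, z) \<in> lt N \<and> (z, e) \<in> lt N \<longleftrightarrow> cN z = i" if z: "z \<in> pts N" for z
      proof -
        have "set [z, d, e] \<subseteq> pts N" using z de by simp
        from match[OF up_limit order_refl this] obtain cs where cs: "set cs \<subseteq> pts ?M" "length cs = length [z, d, e]"
          "map cN [z, d, e] = map cell cs" "bf_le (up 12) N (b # [z, d, e]) ?M (?a # cs)" by blast
        obtain x u' v' where c: "cs = [x, u', v']" using cs(2) by (auto simp: length_Suc_conv)
        have "u' = u" "v' = v" using cs(1,3) c de uniq by auto
        then show ?thesis
          using atomic_nth(2)[OF bf_le_atomic[OF cs(4)], of 2 1] atomic_nth(2)[OF bf_le_atomic[OF cs(4)], of 1 3]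
            c btw[of x] cs(1,3) by auto
      qed
      then have "pts N \<inter> {z. cN z = i} = pts N \<inter> {z. (d, z) \<in> lt N \<and> (z, e) \<in> lt N}" by auto
      then have "component cN N i = interval N d e" by (simp add: component_def interval_restr restr_def)
      moreover have le1: "bf_le c (interval N d e) [] (interval ?M u v) []" if "c < l" for c
      proof -
        \<comment> \<open>Matches are known to respect cells only from \<open>up 12\<close> on, so
          the level is raised here and lowered afterwards.\<close>
        let ?c = "max c (up 12)"
        have c: "?c < l" "up 12 \<le> ?c" using that up_limit by auto
        have "set [d, e] \<subseteq> pts N" using de by simp
        from match[OF c this] obtain cs where cs: "set cs \<subseteq> pts ?M" "length cs = length [d, e]"
          "map cN [d, e] = map cell cs" "bf_le ?c N (b # [d, e]) ?M (?a # cs)" by blast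
        obtain u' v' where uv': "cs = [u', v']" using cs(2) by (auto simp: length_Suc_conv)
        have "u' = u" "v' = v" using cs(1,3) uv' de uniq by auto
        then have "bf_le ?c N [d, e] ?M [u, v]" using uv' by (intro bf_le_zip[OF cs(4)]) auto
        then have "bf_le c N [d, e] ?M [u, v]" by (rule bf_le_mono) simp
        from bf_le_interval[OF this] show ?thesis by simp
      qed
      moreover have "bf_le c (interval ?M u v) [] (interval N d e) []" if "c < l" for c
        by (rule bf_le_swap[OF le1[OF limit_osuc[OF limit that]] less_osuc])
      ultimately show ?thesis unfolding bf_equiv_def by blast
    qed
    have M_i: "component cell ?M i \<cong>\<^sub>s cell_struct f k r" if "r < 4" 
      using component_mixed_iso[of f k r, OF adm that] i by simp
    have lin_i: "linear_order (component cell ?M i)"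
      using linear_mixed[of f, OF adm] unfolding linear_order_def strict_linear_order_on_def component_def
      by (auto simp: lt_restr irrefl_def total_on_def trans_def)
    have big: "component cN N i \<cong>\<^sub>s component cell ?M i"
      if "r < 4" and ic: "interval ?M u v = component cell ?M i" and 
         ex: "\<exists>d e. component cN N i = interval N d e \<and> (\<forall>c<l. bf_equiv c (interval N d e) (interval ?M u v))"
         and r: "cell_struct f k r = block a" "admissible a" for u v a
    proof -
      obtain d e where de: "component cN N i = interval N d e" "\<And>c. c < l \<Longrightarrow> bf_equiv c (interval N d e) (interval ?M u v)"
        using ex by blast
      have "interval N d e \<cong>\<^sub>s block a"
        by (rule block_iso_limit[OF de(2)]) (use ic M_i[OF \<open>r < 4\<close>] lin_i r in \<open>auto simp: lt_interval\<close>)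
      then show ?thesis using de(1) M_i[OF \<open>r < 4\<close>] r(1) iso_trans iso_sym by metis
    qed
    consider "r = 0" | "r = 1" | "r = 2" | "r = 3" | "\<not> r < 4" by linarith
    then show ?thesis
    proof cases
      case 1
      then show ?thesis using single_case[of "lpt k"] lpt_iff i by simp
    next
      case 3
      then show ?thesis using single_case[of "rpt k"] rpt_iff i by simp
    next
      case 2
      have "\<exists>d e. component cN N i = interval N d e \<and> (\<forall>c<l. bf_equiv c (interval N d e) (interval ?M (lpt k) (rpt k)))"
        by (rule interval_case) (use between_cell(1) i 2 lpt_iff rpt_iff in auto)
      then show ?thesis using big[of "lpt k" "rpt k" "f k"] interval_cell(1) i 2 adm by simp
    next
      case 4
      have "\<exists>d e. component cN N i = interval N d e \<and> (\<forall>c<l. bf_equiv c (interval N d e) (interval ?M (rpt k) (lpt (k + 1))))"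
        by (rule interval_case) (use between_cell(2) i 4 lpt_iff rpt_iff in auto)
      then obtain d e where de: "component cN N i = interval N d e" 
        "\<And>c. c < l \<Longrightarrow> bf_equiv c (interval N d e) (interval ?M (rpt k) (lpt (k + 1)))" by blast
      have Mi: "component cell ?M i \<cong>\<^sub>s K" using M_i 4 by simp
      have "interval ?M (rpt k) (lpt (k + 1)) \<cong>\<^sub>s K" using Mi interval_cell(2)[of f k] i 4 by simp
      then have "interval N d e \<cong>\<^sub>s K"
        using k_level(2) de(2)[OF k_level(1)] unfolding bf_equiv_def by blast
      then show ?thesis using de(1) iso_trans[OF _ iso_sym[OF Mi]] by simp
    next
      case 5
      have "pts (component cell ?M i) = {}" using cell_bound 5 i by (force simp: component_def)
      moreover have "pts (component cN N i) = {}" using match1 cell_bound 5 i by (force simp: component_def)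
      ultimately show ?thesis by (simp add: isomorphic_def bij_betw_def)
    qed
  qed
  show ?thesis
    by (rule iso_glue[of N cN cell_less ?M cell]) (use layered_N lt_mixed_cell component_eq in auto)
qed

lemma has_sigma_scott_sentence:
  assumes adm: "\<And>k. admissible (f k)"
  shows "has_scott_sentence (mixed f) (CSigma (osuc l))"
proof -
  obtain p where p: "pi_fm l p" "fv p \<subseteq> {..<1}" 
    "\<And>N e. sat N p e \<longleftrightarrow> bf_le l (mixed f) [lpt 0] N [e 0]"
    using bf_definable_limit[OF limit, of "mixed f" "[lpt 0]"] unfolding bf_definable_def by auto
  define q where "q = Disj (\<lambda>_. foldr Ex [0] p)"
  have sig: "sigma_fm (osuc l) q"
    unfolding q_def by (rule sigma_step[OF osuc_pos less_osuc p(1)])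
  have fv: "fv q = {}" using p(2) by (auto simp: q_def)
  have q: "models N q \<longleftrightarrow> N \<cong>\<^sub>s mixed f" for N :: "pt rstruct"
  proof
    assume "models N q"
    then have "sat N q (\<lambda>_. undefined)" by (simp add: models_def)
    then obtain b where "b \<in> pts N" "bf_le l (mixed f) [lpt 0] N [b]" by (auto simp: q_def p(3))
    then show "N \<cong>\<^sub>s mixed f" using iso_if_bf_le[of f, OF adm] by blast
  next
    assume "N \<cong>\<^sub>s mixed f"
    then have "mixed f \<cong>\<^sub>s N" by (rule iso_sym)
    then obtain h where h: "bij_betw h (pts (mixed f)) (pts N)"
      "\<forall>x\<in>pts (mixed f). \<forall>y\<in>pts (mixed f). (x, y) \<in> lt (mixed f) \<longleftrightarrow> (h x, h y) \<in> lt N" by (auto simp: isomorphic_def)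
    have "bf_le l (mixed f) [lpt 0] N [h (lpt 0)]"
      using bf_le_iso_map[OF h, of "[lpt 0]"] by simp
    moreover have "h (lpt 0) \<in> pts N" using h(1) lpt_in bij_betw_apply by metis
    ultimately show "models N q" by (auto simp: q_def p(3) models_def)
  qed
  have "models N q \<longleftrightarrow> N \<cong>\<^sub>s mixed f" for N :: "nat rstruct"
  proof -
    \<comment> \<open>\<open>bf_definable\<close> compares structures on one type, so structures on
      \<open>nat\<close> are embedded into the type of the mixed sum.\<close>
    let ?h = "\<lambda>z :: nat. (0, 0, z) :: pt"
    have inj: "inj ?h" by (auto simp: inj_def)
    have "models N q \<longleftrightarrow> img ?h N \<cong>\<^sub>s mixed f" using models_img[OF inj fv, of N] q by simp
    also have "\<dots> \<longleftrightarrow> N \<cong>\<^sub>s mixed f"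
      by (rule iffI[OF iso_trans[OF iso_img[OF inj]] iso_trans[OF iso_sym[OF iso_img[OF inj]]]])
    finally show ?thesis .
  qed
  then show ?thesis using sig fv unfolding has_scott_sentence_def scott_sentence_def by auto
qed

end


section \<open>No simpler Scott sentence\<close>

lemma iso_interval:
  assumes h: "bij_betw h (pts M) (pts N)" "\<forall>x\<in>pts M. \<forall>y\<in>pts M. (x, y) \<in> lt M \<longleftrightarrow> (h x, h y) \<in> lt N"
    and uv: "u \<in> pts M" "v \<in> pts M"
  shows "interval M u v \<cong>\<^sub>s interval N (h u) (h v)"
proof -
  have inj: "inj_on h (pts M)" and im: "h ` pts M = pts N" using h(1) by (auto simp: bij_betw_def)
  have sub: "pts (interval M u v) \<subseteq> pts M" by (simp add: pts_interval)
  have img: "h ` pts (interval M u v) = pts (interval N (h u) (h v))"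
  proof (intro equalityI subsetI)
    fix y assume "y \<in> h ` pts (interval M u v)"
    then obtain x where "y = h x" "x \<in> pts M" "(u, x) \<in> lt M" "(x, v) \<in> lt M" by (auto simp: pts_interval)
    then show "y \<in> pts (interval N (h u) (h v))" using h(2) uv im by (simp add: pts_interval) blast
  next
    fix y assume y: "y \<in> pts (interval N (h u) (h v))"
    then obtain x where x: "x \<in> pts M" "y = h x" using im by (auto simp: pts_interval)
    then have "x \<in> pts (interval M u v)" using y h(2) uv by (simp add: pts_interval)
    then show "y \<in> h ` pts (interval M u v)" using x by blast
  qed
  have "bij_betw h (pts (interval M u v)) (pts (interval N (h u) (h v)))"
    using inj_on_subset[OF inj sub] img by (simp add: bij_betw_def)
  moreover have "(x, y) \<in> lt (interval M u v) \<longleftrightarrow> (h x, h y) \<in> lt (interval N (h u) (h v))"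
    if xy: "x \<in> pts (interval M u v)" "y \<in> pts (interval M u v)" for x y
  proof -
    have "h x \<in> pts (interval N (h u) (h v))" "h y \<in> pts (interval N (h u) (h v))" using img xy by auto
    then show ?thesis using xy h(2) sub by (simp add: lt_interval subset_iff)
  qed
  ultimately show ?thesis unfolding isomorphic_def by blast
qed

section \<open>Shifts and their uniform approximation\<close>

definition shift :: "int \<Rightarrow> (int \<Rightarrow> 'a) \<Rightarrow> int \<Rightarrow> 'a" where
  "shift s f k = f (k + s)"

text \<open>Agreement is required at all positions at once and not on a finite window, since all
  blocks without parameters have to be equivalent at level \<open>\<delta> m\<close>.\<close>

definition near :: "nat \<Rightarrow> (int \<Rightarrow> enat) \<Rightarrow> (int \<Rightarrow> enat) \<Rightarrow> bool" where
  "near m g h \<longleftrightarrow> (\<forall>k. min (enat m) (g k) = min (enat m) (h k))"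

lemma near_refl: "near m g g"
  and near_trans: "near m g h \<Longrightarrow> near m h u \<Longrightarrow> near m g u"
  by (auto simp: near_def)

lemma near_mono: "m \<le> n \<Longrightarrow> near n g h \<Longrightarrow> near m g h"
  unfolding near_def by (metis enat_ord_simps(1) min.absorb1 min.assoc)

lemma min_enat_less: "a < enat m \<Longrightarrow> min (enat m) a = min (enat m) b \<Longrightarrow> b = a"
  by (auto simp: min_def split: if_splits)

lemma enat_distinguish: "a \<noteq> b \<Longrightarrow> \<exists>m. \<forall>n\<ge>m. min (enat n) a \<noteq> min (enat n) b"
proof (induction a b rule: linorder_wlog)
  case (le a b)
  then obtain i where i: "a = enat i" "a < b" by (cases a) auto
  show ?case
    by (rule exI[of _ "Suc i"]) (use i in \<open>auto simp: min_def Suc_ile_eq\<close>)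
qed metis

text \<open>At stage \<open>(s, m)\<close> of the construction of a limit of shifts of \<open>f\<close>, the values above \<open>m\<close> can
  still change, except for values that are infinite at every later stage.\<close>

definition decided :: "(int \<Rightarrow> enat) \<Rightarrow> int \<Rightarrow> nat \<Rightarrow> int \<Rightarrow> bool" where
  "decided f s m k \<longleftrightarrow> f (k + s) < enat m \<or> (\<forall>s'. near m (shift s' f) (shift s f) \<longrightarrow> f (k + s') = \<infinity>)"

lemma decided_eq:
  assumes "decided f s m k" "near m (shift s' f) (shift s f)"
  shows "f (k + s') = f (k + s)"
proof (cases "f (k + s) < enat m")
  case True
  have "min (enat m) (f (k + s)) = min (enat m) (f (k + s'))"
    using assms(2) by (simp add: near_def shift_def)
  then show ?thesis using True min_enat_less by blast
next
  case False
  then show ?thesis using assms near_refl unfolding decided_def by metis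
qed

lemma decided_later:
  assumes "decided f s m k" "near m (shift s' f) (shift s f)" "m \<le> m'"
  shows "decided f s' m' k"
proof (cases "f (k + s) < enat m")
  case True
  then have "f (k + s') < enat m'"
    using decided_eq[OF assms(1,2)] assms(3) by (metis enat_ord_simps(1) order_less_le_trans)
  then show ?thesis by (simp add: decided_def)
next
  case False
  then have inf: "near m (shift u f) (shift s f) \<Longrightarrow> f (k + u) = \<infinity>" for u
    using assms(1) by (auto simp: decided_def)
  have "near m (shift u f) (shift s f)" if "near m' (shift u f) (shift s' f)" for u
    using near_trans[OF near_mono[OF assms(3) that] assms(2)] .
  then show ?thesis using inf unfolding decided_def by blast
qed

text \<open>If some shift within precision \<open>m\<close> has a finite value at \<open>k\<close>,
  it is taken and the precision is raised above that value. Otherwise the value is infinite in all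
  of them, hence decided already.\<close>

lemma decide_one: "\<exists>s' m'. m \<le> m' \<and> near m (shift s' f) (shift s f) \<and> decided f s' m' k"
proof (cases "\<exists>s'. near m (shift s' f) (shift s f) \<and> f (k + s') \<noteq> \<infinity>")
  case True
  then obtain s' v where s': "near m (shift s' f) (shift s f)" "f (k + s') = enat v" by auto
  then have "decided f s' (max m (Suc v)) k" by (simp add: decided_def less_max_iff_disj)
  then show ?thesis using s'(1) max.cobounded1 by blast
next
  case False
  then have "decided f s m k" by (auto simp: decided_def)
  then show ?thesis using near_refl by blast
qed

lemma decide_finite:
  assumes "finite W"
  shows "\<exists>s' m'. m \<le> m' \<and> near m (shift s' f) (shift s f) \<and> (\<forall>k\<in>W. decided f s' m' k)"
  using assms
proof (induction W)
  case empty
  then show ?case using near_refl by blast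
next
  case (insert k W)
  then obtain s1 m1 where 1: "m \<le> m1" "near m (shift s1 f) (shift s f)" "\<forall>k\<in>W. decided f s1 m1 k" by blast
  obtain s2 m2 where 2: "m1 \<le> m2" "near m1 (shift s2 f) (shift s1 f)" "decided f s2 m2 k"
    using decide_one by blast
  have "m \<le> m2" using 1 2 by simp
  moreover have "near m (shift s2 f) (shift s f)" using near_trans[OF near_mono[OF 1(1) 2(2)] 1(2)] .
  moreover have "\<forall>j\<in>insert k W. decided f s2 m2 j" using 2(3) decided_later[OF _ 2(2,1)] 1(3) by blast
  ultimately show ?case by blast
qed

text \<open>If the current shift is the one to be avoided, a further shift by a period of the
  truncation at \<open>m\<close> keeps the precision but changes the function, as \<open>f\<close>
  is not periodic. A precision that shows the difference at one position then excludes every later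
  limit.\<close>

lemma avoid_shift:
  assumes "almost_periodic f"
  shows "\<exists>s' m'. m \<le> m' \<and> near m (shift s' f) (shift s f) \<and> (\<forall>h. near m' h (shift s' f) \<longrightarrow> h \<noteq> shift t f)"
proof -
  have "periodic (\<lambda>k. min (enat m) (f k))" using assms by (simp add: almost_periodic_def)
  then obtain p where p: "p > 0" "\<And>k. min (enat m) (f (k + p)) = min (enat m) (f k)"
    unfolding periodic_def by blast
  have "\<exists>s'. near m (shift s' f) (shift s f) \<and> shift s' f \<noteq> shift t f"
  proof (cases "shift s f = shift t f")
    case True
    have "shift (s + p) f \<noteq> shift s f"
    proof
      assume eq: "shift (s + p) f = shift s f"
      have "f (k + p) = f k" for k
        using fun_cong[OF eq, of "k - s"] by (simp add: shift_def algebra_simps)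
      then have "periodic f" using p(1) by (auto simp: periodic_def)
      then show False using assms by (simp add: almost_periodic_def)
    qed
    moreover have "near m (shift (s + p) f) (shift s f)"
      using p(2) by (simp add: near_def shift_def add.assoc[symmetric])
    ultimately show ?thesis using True by metis
  qed (use near_refl in blast)
  then obtain s' k where s': "near m (shift s' f) (shift s f)" "shift s' f k \<noteq> shift t f k" by (metis ext)
  from enat_distinguish[OF s'(2)] obtain m' where
    m': "\<forall>n\<ge>m'. min (enat n) (shift s' f k) \<noteq> min (enat n) (shift t f k)" by blast
  have "h \<noteq> shift t f" if "near (max m m') h (shift s' f)" for h
    using that m' unfolding near_def by (metis max.cobounded2)
  then show ?thesis using s'(1) max.cobounded1 by blast
qed

text \<open>The disjunct that holds is kept as a formula of its own; its level is a successor below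
  the limit \<open>l\<close> even if the whole formula has level \<open>l\<close>.\<close>

lemma sigma_fm_persists:
  fixes M :: "'a rstruct"
  assumes sig: "sigma_fm b p" and b: "b \<le> l" "limit_ordinal l" and sat: "sat M p e" and vs: "fv p \<subseteq> set vs"
  obtains c where "c < l" "\<And>N e'. bf_le c N (map e' vs) M (map e vs) \<Longrightarrow> sat N p e'"
  using sig
proof cases
  case sigma_zero
  then show thesis
    using that[OF limit_pos[OF b(2)]] bf_le_preserves(1)[OF sig vs _ sat] by simp
next
  case (sigma_step c P xs)
  then obtain i where i: "sat M (foldr Ex (xs i) (P i)) e" using sat by auto
  let ?q = "Disj (\<lambda>_. foldr Ex (xs i) (P i))"
  have q: "sigma_fm (osuc (c i)) ?q"
    by (rule sigma_fm_pi_fm.sigma_step[OF osuc_pos less_osuc]) (rule sigma_step)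
  have "c i < l" using sigma_step(3)[of i] b(1) by simp
  then have "osuc (c i) < l" by (rule limit_osuc[OF b(2)])
  moreover have "sat N p e'" if "bf_le (osuc (c i)) N (map e' vs) M (map e vs)" for N e'
  proof -
    have "sat N ?q e'"
      by (rule bf_le_preserves(1)[OF q _ that]) (use vs i sigma_step(1) in auto)
    then show ?thesis using sigma_step(1) by auto
  qed
  ultimately show thesis using that by blast
qed

text \<open>Sentences in every class that does not lie above \<open>\<Sigma>\<^bsub>\<lambda>+1\<^esub>\<close> are of this form.\<close>

definition univ_form :: "omega1 \<Rightarrow> fm \<Rightarrow> bool" where
  "univ_form l p \<longleftrightarrow> (\<exists>xs P b. (\<forall>i::nat. sigma_fm (b i) (P i) \<and> b i \<le> l \<and> fv (P i) \<subseteq> set (xs i)) \<and>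
     (\<forall>M :: pt rstruct. models M p \<longleftrightarrow> (\<forall>i e. (\<forall>v\<in>set (xs i). e v \<in> pts M) \<longrightarrow> sat M (P i) e)))"

lemma univ_form_sigma:
  assumes "sigma_fm a p" "a \<le> l" "fv p = {}"
  shows "univ_form l p"
  unfolding univ_form_def
  by (rule exI[of _ "\<lambda>_. []"], rule exI[of _ "\<lambda>_. p"], rule exI[of _ "\<lambda>_. a"])
     (use assms in \<open>auto simp: models_def\<close>)

text \<open>The outer universal blocks are absorbed into the quantifier over assignments, which
  leaves \<Sigma>-formulas of level at most \<open>l\<close>.\<close>

lemma univ_form_pi:
  assumes "pi_fm a p" "a \<le> osuc l" "fv p = {}"
  shows "univ_form l p"
  using assms(1)
proof cases
  case pi_zero
  then show ?thesis using univ_form_sigma[OF sigma_zero zero_le_omega1 assms(3)] by blast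
next
  case (pi_step b P xs)
  have "b i \<le> l" for i using pi_step(3)[of i] assms(2) less_osuc_iff by (meson order_less_le_trans)
  moreover have "fv (P i) \<subseteq> set (xs i)" for i using assms(3) pi_step(1) by auto
  moreover have "models M p \<longleftrightarrow> (\<forall>i e. (\<forall>v\<in>set (xs i). e v \<in> pts M) \<longrightarrow> sat M (P i) e)" for M :: "pt rstruct"
    unfolding models_def pi_step(1) sat.simps sat_foldr_All by blast
  ultimately show ?thesis unfolding univ_form_def using pi_step(4) by blast
qed

lemma univ_form_And:
  assumes "univ_form l p" "univ_form l q"
  shows "univ_form l (And p q)"
proof -
  obtain xs P b where p: "\<And>i::nat. sigma_fm (b i) (P i) \<and> b i \<le> l \<and> fv (P i) \<subseteq> set (xs i)"
    "\<And>M :: pt rstruct. models M p \<longleftrightarrow> (\<forall>i e. (\<forall>v\<in>set (xs i). e v \<in> pts M) \<longrightarrow> sat M (P i) e)"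
    using assms(1) unfolding univ_form_def by blast
  obtain ys Q c where q: "\<And>i::nat. sigma_fm (c i) (Q i) \<and> c i \<le> l \<and> fv (Q i) \<subseteq> set (ys i)"
    "\<And>M :: pt rstruct. models M q \<longleftrightarrow> (\<forall>i e. (\<forall>v\<in>set (ys i). e v \<in> pts M) \<longrightarrow> sat M (Q i) e)"
    using assms(2) unfolding univ_form_def by blast
  let ?xs = "\<lambda>i. if even i then xs (i div 2) else ys (i div 2)"
  let ?P = "\<lambda>i. if even i then P (i div 2) else Q (i div 2)"
  let ?b = "\<lambda>i. if even i then b (i div 2) else c (i div 2)"
  have all: "(\<forall>i. X i) \<longleftrightarrow> (\<forall>i. X (2 * i)) \<and> (\<forall>i. X (2 * i + 1))" for X :: "nat \<Rightarrow> bool"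
    by (metis evenE oddE)
  have "models M (And p q) \<longleftrightarrow> (\<forall>i e. (\<forall>v\<in>set (?xs i). e v \<in> pts M) \<longrightarrow> sat M (?P i) e)" for M :: "pt rstruct"
  proof -
    have "models M (And p q) \<longleftrightarrow> models M p \<and> models M q" by (auto simp: models_def)
    then show ?thesis unfolding p(2) q(2)
      using all[of "\<lambda>i. \<forall>e. (\<forall>v\<in>set (?xs i). e v \<in> pts M) \<longrightarrow> sat M (?P i) e"] by simp
  qed
  moreover have "sigma_fm (?b i) (?P i) \<and> ?b i \<le> l \<and> fv (?P i) \<subseteq> set (?xs i)" for i
    using p(1) q(1) by simp
  ultimately show ?thesis unfolding univ_form_def
    by (intro exI[of _ ?xs] exI[of _ ?P] exI[of _ ?b]) blast
qed

context mixable
begin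

section \<open>Isomorphic mixed sums and shifts\<close>

lemma shift_iso: "mixed (shift s f) \<cong>\<^sub>s mixed f"
proof -
  let ?h = "\<lambda>x :: pt. (fst x + s, snd x)"
  have cs: "cell_struct (shift s f) k r = cell_struct f (k + s) r" for k r
    by (simp add: cell_struct_def shift_def)
  have pt: "?h x \<in> pts (mixed f) \<longleftrightarrow> x \<in> pts (mixed (shift s f))" for x
    by (cases x) (simp add: pts_mixed cs)
  have "y \<in> ?h ` pts (mixed (shift s f))" if "y \<in> pts (mixed f)" for y
  proof -
    have "(fst y - s, snd y) \<in> pts (mixed (shift s f))" using that pt[of "(fst y - s, snd y)"] by simp
    then show ?thesis by (rule rev_image_eqI) simp
  qed
  then have "bij_betw ?h (pts (mixed (shift s f))) (pts (mixed f))"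
    using pt by (auto simp: bij_betw_def inj_on_def)
  moreover have "(x, y) \<in> lt (mixed (shift s f)) \<longleftrightarrow> (?h x, ?h y) \<in> lt (mixed f)" for x y
    by (cases x; cases y) (simp add: lt_mixed pts_mixed cs)
  ultimately show ?thesis unfolding isomorphic_def by blast
qed

text \<open>An isomorphism preserves every level, so it carries \<open>lpt 0\<close> to some
  \<open>lpt t\<close> and the points around each block to those around the block \<open>t\<close>
  places further. Isomorphic blocks have equal indices.\<close>

lemma iso_imp_shift:
  assumes adm: "\<And>k. admissible (f k)" "\<And>k. admissible (g k)" and iso: "mixed g \<cong>\<^sub>s mixed f"
  shows "\<exists>t. g = shift t f"
proof -
  obtain h where h: "bij_betw h (pts (mixed g)) (pts (mixed f))"
    "\<forall>x\<in>pts (mixed g). \<forall>y\<in>pts (mixed g). (x, y) \<in> lt (mixed g) \<longleftrightarrow> (h x, h y) \<in> lt (mixed f)"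
    using iso by (auto simp: isomorphic_def)
  have hp: "h x \<in> pts (mixed f)" if "x \<in> pts (mixed g)" for x using bij_betw_apply[OF h(1) that] .
  have "bf_le (up 4) (mixed g) [lpt 0] (mixed f) [h (lpt 0)]"
    using bf_le_iso_map[OF h, of "[lpt 0]"] by simp
  then obtain t where t: "h (lpt 0) = lpt t" using lpt_bf_le[of g f, OF adm(2,1)] hp[OF lpt_in] by blast
  have le: "bf_le (up 9) (mixed g) [lpt 0, x] (mixed f) [lpt t, h x]" if "x \<in> pts (mixed g)" for x
    using bf_le_iso_map[OF h, of "[lpt 0, x]"] that t by simp
  have "g k = f (k + t)" for k
  proof -
    have l: "h (lpt k) = lpt (k + t)" using endpoint_bf_le(1)[of g f, OF adm(2,1) le[OF lpt_in] hp[OF lpt_in] refl] by simp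
    have r: "h (rpt k) = rpt (k + t)" using endpoint_bf_le(2)[of g f, OF adm(2,1) le[OF rpt_in] hp[OF rpt_in] refl] by simp
    have "component cell (mixed g) (k, 1) \<cong>\<^sub>s component cell (mixed f) (k + t, 1)"
      using iso_interval[OF h lpt_in[of k] rpt_in[of k]] unfolding l r interval_cell(1) .
    moreover have "component cell (mixed g) (k, 1) \<cong>\<^sub>s block (g k)" using component_mixed_iso[of g k 1, OF adm(2)] by simp
    moreover have "component cell (mixed f) (k + t, 1) \<cong>\<^sub>s block (f (k + t))" using component_mixed_iso[of f "k + t" 1, OF adm(1)] by simp
    ultimately have "block (g k) \<cong>\<^sub>s block (f (k + t))"
      by (meson iso_sym iso_trans)
    then show ?thesis using block_iso_eq adm by blast
  qed
  then show ?thesis by (intro exI[of _ t]) (simp add: shift_def fun_eq_iff)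
qed

lemma pts_mixed_cong: "g (fst x) = h (fst x) \<Longrightarrow> x \<in> pts (mixed g) \<longleftrightarrow> x \<in> pts (mixed h)"
  by (cases x) (simp add: pts_mixed cell_struct_def)

text \<open>The order of the choices matters. The positions of the tuple are decided before the
  level \<open>c\<close> at which truth persists is read off; then the precision is raised until
  \<open>\<delta> j\<close> exceeds \<open>c\<close>, and only then is the shift by \<open>t\<close>
  avoided. The conclusion speaks of every \<open>h\<close> within the new precision, so that it
  applies to the limit.\<close>

lemma generic_step:
  assumes adm: "\<And>k. admissible (f k)" and ap: "almost_periodic f"
    and P: "sigma_fm b P" "b \<le> l" "fv P \<subseteq> set vs"
    and sat: "\<And>s e. (\<forall>v\<in>set vs. e v \<in> pts (mixed (shift s f))) \<Longrightarrow> sat (mixed (shift s f)) P e"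
    and W: "finite W" "\<And>v. v \<in> set vs \<Longrightarrow> fst (e v) \<in> W"
  shows "\<exists>s' m'. m \<le> m' \<and> near m (shift s' f) (shift s f) \<and> (\<forall>k\<in>W. decided f s' m' k) \<and>
    (\<forall>h. near m' h (shift s' f) \<and> (\<forall>k\<in>W. h k = f (k + s')) \<and> (\<forall>k. admissible (h k)) \<longrightarrow>
       h \<noteq> shift t f \<and> ((\<forall>v\<in>set vs. e v \<in> pts (mixed h)) \<longrightarrow> sat (mixed h) P e))"
proof -
  obtain s1 m1 where 1: "m \<le> m1" "near m (shift s1 f) (shift s f)" "\<forall>k\<in>W. decided f s1 m1 k"
    using decide_finite[OF W(1)] by blast
  \<comment> \<open>If the tuple does not lie in the current sum, the condition is void and any
    level below \<open>l\<close> will do.\<close>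
  have "\<exists>c<l. \<forall>N. bf_le c N (map e vs) (mixed (shift s1 f)) (map e vs) \<longrightarrow> 
      (\<forall>v\<in>set vs. e v \<in> pts (mixed (shift s1 f))) \<longrightarrow> sat N P e"
  proof (cases "\<forall>v\<in>set vs. e v \<in> pts (mixed (shift s1 f))")
    case True
    obtain c where "c < l" "\<And>N e'. bf_le c N (map e' vs) (mixed (shift s1 f)) (map e vs) \<Longrightarrow> sat N P e'"
      using sigma_fm_persists[OF P(1,2) limit sat[OF True] P(3)] by metis
    then show ?thesis by blast
  qed (use limit_pos[OF limit] in blast)
  then obtain c where c: "c < l" "\<And>N. bf_le c N (map e vs) (mixed (shift s1 f)) (map e vs) \<Longrightarrow> 
      \<forall>v\<in>set vs. e v \<in> pts (mixed (shift s1 f)) \<Longrightarrow> sat N P e" by blast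
  obtain j where j: "c < \<delta> j" using delta_cofinal[OF c(1)] by blast
  let ?m2 = "max m1 j"
  obtain s2 m3 where 2: "?m2 \<le> m3" "near ?m2 (shift s2 f) (shift s1 f)"
    "\<And>h. near m3 h (shift s2 f) \<Longrightarrow> h \<noteq> shift t f" using avoid_shift[OF ap] by metis
  have near1: "near m1 (shift s2 f) (shift s1 f)" by (rule near_mono[OF _ 2(2)]) simp
  have "m \<le> m3" using 1 2 by simp
  moreover have "near m (shift s2 f) (shift s f)" using near_trans[OF near_mono[OF 1(1) near1] 1(2)] .
  moreover have "\<forall>k\<in>W. decided f s2 m3 k" using decided_later[OF _ near1, of _ m3] 1(3) 2(1) by simp
  moreover have "h \<noteq> shift t f \<and> ((\<forall>v\<in>set vs. e v \<in> pts (mixed h)) \<longrightarrow> sat (mixed h) P e)"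
    if h: "near m3 h (shift s2 f)" "\<forall>k\<in>W. h k = f (k + s2)" "\<forall>k. admissible (h k)" for h
  proof (intro conjI impI)
    show "h \<noteq> shift t f" by (rule 2(3)[OF h(1)])
    assume e: "\<forall>v\<in>set vs. e v \<in> pts (mixed h)"
    \<comment> \<open>Decided positions keep their values from \<open>s1\<close> to
      \<open>s2\<close>, so the blocks that hold the tuple are literally the same.\<close>
    have hW: "h k = shift s1 f k" if "k \<in> W" for k
      using that h(2) decided_eq[OF _ near1, of k] 1(3) by (simp add: shift_def)
    then have e1: "\<forall>v\<in>set vs. e v \<in> pts (mixed (shift s1 f))"
      using e pts_mixed_cong[of h _ "shift s1 f"] W(2) by blast
    have "near j h (shift s1 f)"
      by (rule near_trans[OF near_mono[OF _ h(1)] near_mono[OF _ 2(2)]]) (use 2(1) in auto)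
    then have "bf_le (\<delta> j) (mixed h) (map e vs) (mixed (shift s1 f)) (map e vs)"
      by (intro mixed_equiv) (use h(3) adm e W(2) hW in \<open>auto simp: near_def shift_def\<close>)
    then have "bf_le c (mixed h) (map e vs) (mixed (shift s1 f)) (map e vs)"
      by (rule bf_le_mono) (use j in simp)
    then show "sat (mixed h) P e" using c(2) e1 by blast
  qed
  ultimately show ?thesis by blast
qed

text \<open>Each stage treats one triple: an instance of the sentence, a tuple, and a shift to be
  avoided. Once is enough, since the outcome binds every function that respects the later
  stages.\<close>

lemma generic_limit:
  assumes adm: "\<And>k. admissible (f k)" and ap: "almost_periodic f" and form: "univ_form l p"
    and mod: "\<And>s. models (mixed (shift s f)) p"
  shows "\<exists>g. (\<forall>k. admissible (g k)) \<and> (\<forall>t. g \<noteq> shift t f) \<and> models (mixed g) p"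
proof -
  obtain vs P b where p: "\<And>i::nat. sigma_fm (b i) (P i) \<and> b i \<le> l \<and> fv (P i) \<subseteq> set (vs i)"
    "\<And>M :: pt rstruct. models M p \<longleftrightarrow> (\<forall>i e. (\<forall>v\<in>set (vs i). e v \<in> pts M) \<longrightarrow> sat M (P i) e)"
    using form unfolding univ_form_def by blast
  have sat: "sat (mixed (shift s f)) (P i) e" if "\<forall>v\<in>set (vs i). e v \<in> pts (mixed (shift s f))" for s i e
    using mod[of s] that unfolding p(2) by blast
  define I where "I n = fst (from_nat n :: nat \<times> pt list \<times> int)" for n
  \<comment> \<open>A list codes the tuple and is read as an assignment; only the variables of
    \<open>vs (I n)\<close> matter.\<close>
  define E where "E n = (\<lambda>v. fst (snd (from_nat n :: nat \<times> pt list \<times> int)) ! v)" for n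
  define T where "T n = snd (snd (from_nat n :: nat \<times> pt list \<times> int))" for n
  \<comment> \<open>The growing window makes every position decided eventually, so that a limit
    exists; the other positions carry the tuple of this stage.\<close>
  define W where "W n = {- int n..int n} \<union> (\<lambda>v. fst (E n v)) ` set (vs (I n))" for n
  have W: "finite (W n)" "v \<in> set (vs (I n)) \<Longrightarrow> fst (E n v) \<in> W n" for n v by (auto simp: W_def)
  define Q where "Q n x y \<longleftrightarrow> snd x \<le> snd y \<and> near (snd x) (shift (fst y) f) (shift (fst x) f) \<and>
     (\<forall>k\<in>W n. decided f (fst y) (snd y) k) \<and>
     (\<forall>h. near (snd y) h (shift (fst y) f) \<and> (\<forall>k\<in>W n. h k = f (k + fst y)) \<and> (\<forall>k. admissible (h k)) \<longrightarrow>
       h \<noteq> shift (T n) f \<and> ((\<forall>v\<in>set (vs (I n)). E n v \<in> pts (mixed h)) \<longrightarrow> sat (mixed h) (P (I n)) (E n)))"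
    for n :: nat and x y :: "int \<times> nat"
  have "\<exists>y. Q n x y" for n x
  proof -
    have "sigma_fm (b (I n)) (P (I n))" "b (I n) \<le> l" "fv (P (I n)) \<subseteq> set (vs (I n))" using p(1) by auto
    from generic_step[where f = f and e = "E n" and m = "snd x" and s = "fst x" and t = "T n",
        OF adm ap this sat W]
    obtain s' m' where "Q n x (s', m')" unfolding Q_def fst_conv snd_conv by blast
    then show ?thesis by blast
  qed
  then obtain F where F: "\<And>n x. Q n x (F n x)" by metis
  define \<sigma> where "\<sigma> = rec_nat (0, 0) F"
  have Q: "Q n (\<sigma> n) (\<sigma> (Suc n))" for n using F by (simp add: \<sigma>_def)
  define s where "s n = fst (\<sigma> n)" for n
  define m where "m n = snd (\<sigma> n)" for n
  have m_Suc: "m n \<le> m (Suc n)" and near_Suc: "near (m n) (shift (s (Suc n)) f) (shift (s n) f)"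
    and dec: "k \<in> W n \<Longrightarrow> decided f (s (Suc n)) (m (Suc n)) k" for n k
    using Q[of n] by (auto simp: Q_def s_def m_def)
  have final: "h \<noteq> shift (T n) f \<and> ((\<forall>v\<in>set (vs (I n)). E n v \<in> pts (mixed h)) \<longrightarrow> sat (mixed h) (P (I n)) (E n))"
    if "near (m (Suc n)) h (shift (s (Suc n)) f)" "\<forall>k\<in>W n. h k = f (k + s (Suc n))" "\<forall>k. admissible (h k)" for n h
    using Q[of n] that by (auto simp: Q_def s_def m_def)
  have m_mono: "n \<le> j \<Longrightarrow> m n \<le> m j" for n j by (rule lift_Suc_mono_le[of m]) (use m_Suc in auto)
  have near: "near (m n) (shift (s j) f) (shift (s n) f)" if "n \<le> j" for n j
    using that
  proof (induction j rule: dec_induct)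
    case (step j)
    then show ?case using near_trans[OF near_mono[OF m_mono near_Suc]] by blast
  qed (rule near_refl)
  have stable: "f (k + s j) = f (k + s (Suc n))" if "k \<in> W n" "Suc n \<le> j" for k n j
    using decided_eq[OF dec[OF that(1)] near[OF that(2)]] .
  \<comment> \<open>Position \<open>k\<close> lies in the window of stage |k|, so its value is fixed
    from the next stage on.\<close>
  define g where "g k = f (k + s (Suc (nat \<bar>k\<bar>)))" for k
  have g_eq: "g k = f (k + s j)" if "Suc (nat \<bar>k\<bar>) \<le> j" for k j
  proof -
    have "- \<bar>k\<bar> \<le> k" "k \<le> \<bar>k\<bar>" by linarith+
    then have "k \<in> W (nat \<bar>k\<bar>)" by (simp add: W_def)
    from stable[OF this that] show ?thesis by (simp add: g_def)
  qed
  have g_near: "near (m n) g (shift (s n) f)" for n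
    unfolding near_def
  proof
    fix k
    let ?j = "max n (Suc (nat \<bar>k\<bar>))"
    have "g k = shift (s ?j) f k" using g_eq[of k ?j] by (simp add: shift_def)
    moreover have "near (m n) (shift (s ?j) f) (shift (s n) f)" by (rule near) simp
    ultimately show "min (enat (m n)) (g k) = min (enat (m n)) (shift (s n) f k)" by (simp add: near_def)
  qed
  have g_W: "g k = f (k + s (Suc n))" if "k \<in> W n" for k n
    using g_eq[of k "max (Suc n) (Suc (nat \<bar>k\<bar>))"] stable[OF that, of "max (Suc n) (Suc (nat \<bar>k\<bar>))"] by simp
  have g_adm: "admissible (g k)" for k using adm by (simp add: g_def)
  note gfinal = final[of _ g, OF g_near ballI[OF g_W] allI[OF g_adm]]
  have "g \<noteq> shift t f" for t
    using gfinal[of "to_nat (0 :: nat, [] :: pt list, t)"] by (simp add: T_def)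
  moreover have "sat (mixed g) (P i) e" if e: "\<forall>v\<in>set (vs i). e v \<in> pts (mixed g)" for i e
  proof -
    \<comment> \<open>The list reaches the largest variable of \<open>vs i\<close>; the inserted 0
      keeps \<open>Max\<close> defined if there is none.\<close>
    let ?es = "map e [0..<Suc (Max (insert 0 (set (vs i))))]"
    let ?n = "to_nat (i, ?es, 0 :: int)"
    have I: "I ?n = i" by (simp add: I_def)
    have E: "E ?n v = e v" if "v \<in> set (vs i)" for v
    proof -
      have "v \<le> Max (insert 0 (set (vs i)))" using that by (intro Max_ge) auto
      then have "?es ! v = e v" by (subst nth_map) (auto simp del: upt_Suc)
      then show ?thesis by (simp add: E_def del: upt_Suc)
    qed
    have "sat (mixed g) (P i) (E ?n)" using gfinal[of ?n] e E unfolding I by simp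
    then show ?thesis using sat_cong[of "P i" "E ?n" e "mixed g"] E p(1)[of i] by blast
  qed
  then have "models (mixed g) p" unfolding p(2) by blast
  ultimately show ?thesis using g_adm by blast
qed

lemma no_univ_form:
  assumes adm: "\<And>k. admissible (f k)" and ap: "almost_periodic f" and form: "univ_form l p"
  shows "\<not> scott_sentence (mixed f) p"
proof
  assume scott: "scott_sentence (mixed f) p"
  have "models (mixed (shift s f)) p" for s
    using scott_sentence_countable[OF scott] shift_iso by blast
  then obtain g where g: "\<And>k. admissible (g k)" "\<And>t. g \<noteq> shift t f" "models (mixed g) p"
    using generic_limit[of f, OF adm ap form] by blast
  have "mixed g \<cong>\<^sub>s mixed f" using scott_sentence_countable[OF scott] g(3) by blast
  then show False using iso_imp_shift[of f g, OF adm g(1)] g(2) by blast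
qed

lemma scott_complexity_mixed:
  assumes adm: "\<And>k. admissible (f k)" and ap: "almost_periodic f"
  shows "scott_complexity (mixed f) (CSigma (osuc l))"
  unfolding scott_complexity_def
proof (intro conjI allI impI)
  show "has_scott_sentence (mixed f) (CSigma (osuc l))" using has_sigma_scott_sentence[of f, OF adm] .
  fix D assume "has_scott_sentence (mixed f) D"
  then obtain p where p: "in_class D p" "scott_sentence (mixed f) p" by (auto simp: has_scott_sentence_def)
  have fv: "fv p = {}" using p(2) by (simp add: scott_sentence_def)
  show "complexity_le (CSigma (osuc l)) D"
  proof (rule ccontr)
    assume D: "\<not> ?thesis"
    \<comment> \<open>What is left is \<Sigma> and d-\<Sigma> of level at most \<open>l\<close>, and
      \<Pi> of level at most \<open>osuc l\<close>.\<close>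
    have "univ_form l p"
    proof (cases D)
      case (CSigma a)
      then show ?thesis using p(1) D fv by (intro univ_form_sigma[of a]) (auto simp: osuc_le_iff)
    next
      case (CdSigma a)
      then obtain q r where qr: "p = And q r" "sigma_fm a q" "pi_fm a r" using p(1) by auto
      have a: "a \<le> l" using D CdSigma by (simp add: osuc_le_iff)
      have "a \<le> osuc l" using a le_osuc by (meson order_trans)
      then show ?thesis using univ_form_And univ_form_sigma[OF qr(2) a] univ_form_pi[OF qr(3)] fv qr(1) by simp
    next
      case (CPi a)
      then show ?thesis using p(1) D fv by (intro univ_form_pi[of a]) auto
    qed
    then show False using no_univ_form[of f, OF adm ap] p(2) by blast
  qed
qed

end

theorem theorem4p1:
  fixes l :: omega1 and \<delta> :: "nat \<Rightarrow> omega1"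
    and L :: "nat \<Rightarrow> nat rstruct" and K Linf :: "nat rstruct"
    and f :: "int \<Rightarrow> enat"
  assumes "limit_ordinal l"
    and "mixable_along l \<delta> L K"
    and "almost_periodic f"
    and "(\<forall>n. f n \<noteq> \<infinity>) \<or> unique_limit_structure \<delta> L Linf"
  shows "scott_complexity (mixed_sum L K Linf f) (CSigma (osuc l))"
proof -
  interpret mixable l \<delta> L K Linf by unfold_locales (rule assms)+
  have "admissible (f k)" for k using assms(4) by (auto simp: admissible_def)
  from scott_complexity_mixed[of f, OF this assms(3)] show ?thesis by (simp add: mixed_def)
qed

end
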